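(* Let $G$ be a connected reductive algebraic group over an algebraically closed field of characteristic $\ell>0$, and let $F$ be a Steinberg endomorphism of $G$. Let $A\le G^F$ be a finite subgroup, let $w\in C_G(A)/C_G(A)^\circ$, and let $A_w={}^gA\le G^F$, where $g\in G$ is chosen with $g^{-1}F(g)C_G(A)^\circ=w$. Then $$N_G(A_w)^F/(C_G(A_w)^\circ)^F\cong (N_G(A)/C_G(A)^\circ)^{wF},$$ $$C_G(A_w)^F/(C_G(A_w)^\circ)^F\cong (C_G(A)/C_G(A)^\circ)^{wF}.$$
   Context: A Steinberg endomorphism of a linear algebraic group $G$ is an endomorphism $F:G\to G$ some power of which is a Frobenius morphism with respect to some $\mathbb F_q$-structure. $X^\sigma$ denotes the fixed points of a map $\sigma:X\to X$. $H^\circ$ is the identity component of $H$; ${}^gA=gAg^{-1}$. $wF$ denotes the map $x\mapsto wF(x)w^{-1}$ on $N_G(A)/C_G(A)^\circ$ (respectively $C_G(A)/C_G(A)^\circ$), where $F$ acts on the quotient in the induced way. *)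

theory Defs
  imports
    "HOL-Analysis.Abstract_Topology"
    "HOL-Analysis.Abstract_Topology_2"
    "HOL-Algebra.Coset"
    "HOL-Algebra.Group_Action"
    "HOL-Computational_Algebra.Polynomial"
    "HOL-Library.FuncSet"
begin

section \<open>Affine varieties\<close>

text \<open>
  An affine variety over an algebraically closed field \<open>'k\<close> is a set \<open>X\<close> together with its
  coordinate ring \<open>A\<close>, a finitely generated algebra of functions \<open>X \<rightarrow> 'k\<close> whose algebra
  homomorphisms to \<open>'k\<close> are exactly the evaluations at the points of \<open>X\<close>. Functions on \<open>X\<close> are
  extensional, so that functions that agree on \<open>X\<close> are equal.
\<close>

text \<open>Subalgebras of functions on \<open>X\<close> over a subfield \<open>S\<close> of \<open>'k\<close>.\<close>

definition fun_subalgebra :: "'k::field set \<Rightarrow> 'a set \<Rightarrow> ('a \<Rightarrow> 'k) set \<Rightarrow> bool" where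
  "fun_subalgebra S X A \<longleftrightarrow>
     A \<subseteq> extensional X \<and>
     (\<forall>c\<in>S. (\<lambda>x\<in>X. c) \<in> A) \<and>
     (\<forall>f\<in>A. \<forall>g\<in>A. (\<lambda>x\<in>X. f x + g x) \<in> A \<and> (\<lambda>x\<in>X. f x * g x) \<in> A)"

definition finitely_generated_algebra :: "'k::field set \<Rightarrow> 'a set \<Rightarrow> ('a \<Rightarrow> 'k) set \<Rightarrow> bool" where
  "finitely_generated_algebra S X A \<longleftrightarrow>
     fun_subalgebra S X A \<and>
     (\<exists>T. finite T \<and> T \<subseteq> A \<and> A = fun_subalgebra S X hull T)"

definition algebra_hom :: "'a set \<Rightarrow> ('a \<Rightarrow> 'k::field) set \<Rightarrow> (('a \<Rightarrow> 'k) \<Rightarrow> 'k) \<Rightarrow> bool" where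
  "algebra_hom X A \<phi> \<longleftrightarrow>
     (\<forall>c. \<phi> (\<lambda>x\<in>X. c) = c) \<and>
     (\<forall>f\<in>A. \<forall>g\<in>A. \<phi> (\<lambda>x\<in>X. f x + g x) = \<phi> f + \<phi> g \<and> \<phi> (\<lambda>x\<in>X. f x * g x) = \<phi> f * \<phi> g)"

definition affine_variety :: "'a set \<Rightarrow> ('a \<Rightarrow> 'k::alg_closed_field) set \<Rightarrow> bool" where
  "affine_variety X A \<longleftrightarrow>
     finitely_generated_algebra UNIV X A \<and>
     (\<forall>\<phi>. algebra_hom X A \<phi> \<longrightarrow> (\<exists>!x. x \<in> X \<and> (\<forall>f\<in>A. \<phi> f = f x)))"

definition variety_morphism ::
  "'a set \<Rightarrow> ('a \<Rightarrow> 'k::alg_closed_field) set \<Rightarrow> 'b set \<Rightarrow> ('b \<Rightarrow> 'k) set \<Rightarrow> ('a \<Rightarrow> 'b) \<Rightarrow> bool" where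
  "variety_morphism X A Y B \<phi> \<longleftrightarrow> \<phi> \<in> X \<rightarrow> Y \<and> (\<forall>f\<in>B. compose X f \<phi> \<in> A)"

text \<open>
  The coordinate ring of \<open>X \<times> Y\<close>: the functions \<open>(x, y) \<mapsto> \<Sum>i. f\<^sub>i x * g\<^sub>i y\<close> with
  \<open>f\<^sub>i \<in> A\<close> and \<open>g\<^sub>i \<in> B\<close>, that is, \<open>A \<otimes> B\<close>.
\<close>

definition prod_regular ::
  "'a set \<Rightarrow> ('a \<Rightarrow> 'k::field) set \<Rightarrow> 'b set \<Rightarrow> ('b \<Rightarrow> 'k) set \<Rightarrow> ('a \<times> 'b \<Rightarrow> 'k) set" where
  "prod_regular X A Y B =
     fun_subalgebra UNIV (X \<times> Y) hull
       ((\<lambda>f. \<lambda>z\<in>X \<times> Y. f (fst z)) ` A \<union> (\<lambda>g. \<lambda>z\<in>X \<times> Y. g (snd z)) ` B)"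

text \<open>Open sets are the complements in \<open>X\<close> of the zero loci of sets of regular functions.\<close>

definition zariski_open :: "'a set \<Rightarrow> ('a \<Rightarrow> 'k::field) set \<Rightarrow> 'a set \<Rightarrow> bool" where
  "zariski_open X A U \<longleftrightarrow> (\<exists>S\<subseteq>A. U = X - {x \<in> X. \<forall>f\<in>S. f x = 0})"

definition zariski :: "'a set \<Rightarrow> ('a \<Rightarrow> 'k::field) set \<Rightarrow> 'a topology" where
  "zariski X A = topology (zariski_open X A)"

lemma zariski_open_iff:
  "zariski_open X A U \<longleftrightarrow> (\<exists>S\<subseteq>A. \<forall>x. x \<in> U \<longleftrightarrow> x \<in> X \<and> (\<exists>f\<in>S. f x \<noteq> 0))"
  unfolding zariski_open_def by (simp add: Set.set_eq_iff cong: conj_cong)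

lemma istopology_zariski_open:
  assumes A: "fun_subalgebra S X A"
  shows "istopology (zariski_open X A)"
  unfolding istopology_def
proof (intro conjI allI impI)
  fix U V assume "zariski_open X A U" "zariski_open X A V"
  then obtain S T where S: "S \<subseteq> A" "\<And>x. x \<in> U \<longleftrightarrow> x \<in> X \<and> (\<exists>f\<in>S. f x \<noteq> 0)"
    and T: "T \<subseteq> A" "\<And>x. x \<in> V \<longleftrightarrow> x \<in> X \<and> (\<exists>f\<in>T. f x \<noteq> 0)"
    unfolding zariski_open_iff by metis
  define W where "W = (\<lambda>(f, g). \<lambda>x\<in>X. f x * g x) ` (S \<times> T)"
  have "W \<subseteq> A"
  proof
    fix h assume "h \<in> W"
    then obtain f g where "f \<in> S" "g \<in> T" "h = (\<lambda>x\<in>X. f x * g x)"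
      unfolding W_def by auto
    moreover from this have "f \<in> A" "g \<in> A"
      using S(1) T(1) by auto
    ultimately show "h \<in> A"
      using A unfolding fun_subalgebra_def by simp
  qed
  moreover have "x \<in> U \<inter> V \<longleftrightarrow> x \<in> X \<and> (\<exists>f\<in>W. f x \<noteq> 0)" for x
    unfolding W_def by (auto simp: S(2) T(2))
  ultimately show "zariski_open X A (U \<inter> V)"
    unfolding zariski_open_iff by metis
next
  fix \<K> assume "\<forall>K\<in>\<K>. zariski_open X A K"
  then obtain S where S: "\<And>K. K \<in> \<K> \<Longrightarrow> S K \<subseteq> A"
    "\<And>K x. K \<in> \<K> \<Longrightarrow> x \<in> K \<longleftrightarrow> x \<in> X \<and> (\<exists>f\<in>S K. f x \<noteq> 0)"
    unfolding zariski_open_iff by metis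
  have "(\<Union>K\<in>\<K>. S K) \<subseteq> A"
    using S(1) by auto
  moreover have "x \<in> \<Union>\<K> \<longleftrightarrow> x \<in> X \<and> (\<exists>f\<in>(\<Union>K\<in>\<K>. S K). f x \<noteq> 0)" for x
  proof -
    have "x \<in> \<Union>\<K> \<longleftrightarrow> (\<exists>K\<in>\<K>. x \<in> K)" by (simp only: Union_iff)
    also have "\<dots> \<longleftrightarrow> (\<exists>K\<in>\<K>. x \<in> X \<and> (\<exists>f\<in>S K. f x \<noteq> 0))"
      by (rule bex_cong[OF refl]) (rule S(2))
    finally show ?thesis by (simp only: UN_iff bex_simps) blast
  qed
  ultimately show "zariski_open X A (\<Union>\<K>)"
    unfolding zariski_open_iff by (intro exI[of _ "\<Union>K\<in>\<K>. S K"] conjI allI)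
qed

lemma openin_zariski:
  "fun_subalgebra S X A \<Longrightarrow> openin (zariski X A) U \<longleftrightarrow> zariski_open X A U"
  by (simp add: zariski_def istopology_zariski_open)

section \<open>Linear algebraic groups\<close>

record ('a, 'k) alg_group = "'a monoid" +
  regular :: "('a \<Rightarrow> 'k) set"

definition linear_algebraic_group :: "('a, 'k::alg_closed_field) alg_group \<Rightarrow> bool" where
  "linear_algebraic_group G \<longleftrightarrow>
     group G \<and>
     affine_variety (carrier G) (regular G) \<and>
     variety_morphism
       (carrier G \<times> carrier G) (prod_regular (carrier G) (regular G) (carrier G) (regular G))
       (carrier G) (regular G) (\<lambda>(x, y). x \<otimes>\<^bsub>G\<^esub> y) \<and>
     variety_morphism (carrier G) (regular G) (carrier G) (regular G) (\<lambda>x. inv\<^bsub>G\<^esub> x)"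

abbreviation zariski_group :: "('a, 'k::alg_closed_field) alg_group \<Rightarrow> 'a topology" where
  "zariski_group G \<equiv> zariski (carrier G) (regular G)"

definition identity_component :: "('a, 'k::alg_closed_field) alg_group \<Rightarrow> 'a set \<Rightarrow> 'a set" where
  "identity_component G H = connected_component_of_set (subtopology (zariski_group G) H) \<one>\<^bsub>G\<^esub>"

text \<open>
  An element is unipotent if right translation by it is a locally unipotent operator on the
  coordinate ring; this is independent of any embedding into a general linear group.
\<close>

definition unipotent_element :: "('a, 'k::alg_closed_field) alg_group \<Rightarrow> 'a \<Rightarrow> bool" where
  "unipotent_element G u \<longleftrightarrow>
     u \<in> carrier G \<and>
     (\<forall>f\<in>regular G. \<exists>n::nat.
        ((\<lambda>h. \<lambda>x\<in>carrier G. h (x \<otimes>\<^bsub>G\<^esub> u) - h x) ^^ n) f = (\<lambda>x\<in>carrier G. 0))"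

text \<open>
  There is a largest closed connected normal unipotent subgroup, and it is therefore the union
  of all of them.
\<close>

definition unipotent_radical :: "('a, 'k::alg_closed_field) alg_group \<Rightarrow> 'a set" where
  "unipotent_radical G =
     \<Union>{U. U \<lhd> G \<and> closedin (zariski_group G) U \<and> connectedin (zariski_group G) U \<and>
          (\<forall>u\<in>U. unipotent_element G u)}"

definition connected_reductive_group :: "('a, 'k::alg_closed_field) alg_group \<Rightarrow> bool" where
  "connected_reductive_group G \<longleftrightarrow>
     linear_algebraic_group G \<and>
     connected_space (zariski_group G) \<and>
     unipotent_radical G = {\<one>\<^bsub>G\<^esub>}"

section \<open>Steinberg endomorphisms\<close>

definition subfield_of_order :: "nat \<Rightarrow> 'k::alg_closed_field set" where
  "subfield_of_order q = {c. c ^ q = c}"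

definition fun_independent :: "'k::field set \<Rightarrow> 'a set \<Rightarrow> ('a \<Rightarrow> 'k) set \<Rightarrow> bool" where
  "fun_independent S X T \<longleftrightarrow>
     (\<forall>c \<in> T \<rightarrow> S. (\<forall>x\<in>X. (\<Sum>t\<in>T. c t * t x) = 0) \<longrightarrow> (\<forall>t\<in>T. c t = 0))"

text \<open>
  An \<open>\<bbbF>\<^sub>q\<close>-structure on a variety is a finitely generated \<open>\<bbbF>\<^sub>q\<close>-subalgebra \<open>A\<^sub>0\<close> of its coordinate
  ring \<open>A\<close> for which the multiplication map \<open>'k \<otimes> A\<^sub>0 \<rightarrow> A\<close>, the tensor product taken over \<open>\<bbbF>\<^sub>q\<close>,
  is bijective. The third conjunct below is surjectivity, the last one injectivity.
\<close>

definition Fq_structure ::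
  "nat \<Rightarrow> 'a set \<Rightarrow> ('a \<Rightarrow> 'k::alg_closed_field) set \<Rightarrow> ('a \<Rightarrow> 'k) set \<Rightarrow> bool" where
  "Fq_structure q X A A\<^sub>0 \<longleftrightarrow>
     A\<^sub>0 \<subseteq> A \<and>
     finitely_generated_algebra (subfield_of_order q) X A\<^sub>0 \<and>
     (\<forall>f\<in>A. \<exists>T c. finite T \<and> T \<subseteq> A\<^sub>0 \<and> f = (\<lambda>x\<in>X. \<Sum>t\<in>T. c t * t x)) \<and>
     (\<forall>T. finite T \<and> T \<subseteq> A\<^sub>0 \<and> fun_independent (subfield_of_order q) X T
          \<longrightarrow> fun_independent UNIV X T)"

definition algebraic_endomorphism ::
  "('a, 'k::alg_closed_field) alg_group \<Rightarrow> ('a \<Rightarrow> 'a) \<Rightarrow> bool" where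
  "algebraic_endomorphism G F \<longleftrightarrow>
     F \<in> hom G G \<and> variety_morphism (carrier G) (regular G) (carrier G) (regular G) F"

text \<open>
  The comorphism of the Frobenius morphism of an \<open>\<bbbF>\<^sub>q\<close>-structure \<open>A\<^sub>0\<close> is \<open>c * f \<mapsto> c * f ^ q\<close> for
  \<open>c\<close> in \<open>'k\<close> and \<open>f \<in> A\<^sub>0\<close>. Then \<open>A\<^sub>0\<close> consists of the regular functions whose image under the
  comorphism is their \<open>q\<close>-th power, so that, \<open>F\<close> being a group endomorphism, multiplication and
  inversion are defined over \<open>\<bbbF>\<^sub>q\<close> automatically.
\<close>

definition frobenius_morphism ::
  "nat \<Rightarrow> ('a, 'k::alg_closed_field) alg_group \<Rightarrow> ('a \<Rightarrow> 'a) \<Rightarrow> bool" where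
  "frobenius_morphism q G F \<longleftrightarrow>
     algebraic_endomorphism G F \<and>
     (\<exists>A\<^sub>0. Fq_structure q (carrier G) (regular G) A\<^sub>0 \<and>
           (\<forall>f\<in>A\<^sub>0. compose (carrier G) f F = (\<lambda>x\<in>carrier G. f x ^ q)))"

definition steinberg_endomorphism ::
  "('a, 'k::alg_closed_field) alg_group \<Rightarrow> ('a \<Rightarrow> 'a) \<Rightarrow> bool" where
  "steinberg_endomorphism G F \<longleftrightarrow>
     algebraic_endomorphism G F \<and>
     (\<exists>m e::nat. 0 < m \<and> 0 < e \<and> frobenius_morphism (CHAR('k) ^ e) G (F ^^ m))"

section \<open>Centralisers, fixed points and twisted quotients\<close>

definition centralizer :: "('a, 'm) monoid_scheme \<Rightarrow> 'a set \<Rightarrow> 'a set" where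
  "centralizer G A = {x \<in> carrier G. \<forall>a\<in>A. x \<otimes>\<^bsub>G\<^esub> a = a \<otimes>\<^bsub>G\<^esub> x}"

definition fixed_points :: "('a \<Rightarrow> 'a) \<Rightarrow> 'a set \<Rightarrow> 'a set" where
  "fixed_points \<sigma> X = {x \<in> X. \<sigma> x = x}"

definition conjugate_set :: "('a, 'm) monoid_scheme \<Rightarrow> 'a \<Rightarrow> 'a set \<Rightarrow> 'a set" where
  "conjugate_set G g A = g <#\<^bsub>G\<^esub> A #>\<^bsub>G\<^esub> inv\<^bsub>G\<^esub> g"

abbreviation subgroup_quotient ::
  "('a, 'm) monoid_scheme \<Rightarrow> 'a set \<Rightarrow> 'a set \<Rightarrow> 'a set monoid" where
  "subgroup_quotient G N H \<equiv> (G\<lparr>carrier := N\<rparr>) Mod H"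

text \<open>The map induced by \<open>F\<close> on cosets of \<open>H\<close>: it sends \<open>H x\<close> to \<open>H (F x)\<close> if \<open>F ` H \<subseteq> H\<close>.\<close>

definition induced_map :: "('a, 'm) monoid_scheme \<Rightarrow> 'a set \<Rightarrow> ('a \<Rightarrow> 'a) \<Rightarrow> 'a set \<Rightarrow> 'a set" where
  "induced_map G H F X = H <#>\<^bsub>G\<^esub> (F ` X)"

text \<open>The map \<open>wF\<close> on \<open>N/H\<close>, that is, \<open>x \<mapsto> w (F x) w\<^sup>-\<^sup>1\<close>, and its group of fixed points.\<close>

definition twisted_map ::
  "('a, 'm) monoid_scheme \<Rightarrow> 'a set \<Rightarrow> 'a set \<Rightarrow> ('a \<Rightarrow> 'a) \<Rightarrow> 'a set \<Rightarrow> 'a set \<Rightarrow> 'a set" where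
  "twisted_map G N H F w X =
     w \<otimes>\<^bsub>subgroup_quotient G N H\<^esub> induced_map G H F X
       \<otimes>\<^bsub>subgroup_quotient G N H\<^esub> inv\<^bsub>subgroup_quotient G N H\<^esub> w"

definition twisted_fixed_group ::
  "('a, 'm) monoid_scheme \<Rightarrow> 'a set \<Rightarrow> 'a set \<Rightarrow> ('a \<Rightarrow> 'a) \<Rightarrow> 'a set \<Rightarrow> 'a set monoid" where
  "twisted_fixed_group G N H F w =
     (subgroup_quotient G N H)
       \<lparr>carrier := fixed_points (twisted_map G N H F w) (carrier (subgroup_quotient G N H))\<rparr>"

end

theory Submission
  imports Defs "HOL-Library.Function_Algebras" "HOL-Library.Multiset"
begin

text \<open>
  Put \<open>C = C\<^sub>G(A)\<^sup>\<circ>\<close> and \<open>n = g\<^sup>-\<^sup>1 F(g)\<close>, an element of \<open>C\<^sub>G(A)\<close>. Conjugation by \<open>g\<close> carries \<open>A\<close>,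
  its normaliser, its centraliser and \<open>C\<close> to the corresponding objects for \<open>A\<^sub>w\<close>, and it turns the
  action of \<open>F\<close> on the latter into \<open>\<sigma>(x) = n F(x) n\<^sup>-\<^sup>1\<close>, a lift of \<open>wF\<close>. With \<open>N\<close> the
  normaliser or the centraliser of \<open>A\<close>, it remains to see that the fixed points of \<open>\<sigma>\<close> on \<open>N\<close> map onto
  those on \<open>N / C\<close>; the kernel is clear. If the coset of
  \<open>x\<close> is fixed then \<open>\<sigma>(x) = d x\<close> with \<open>d \<in> C\<close>, and some \<open>c x\<close> with \<open>c \<in> C\<close> is fixed as soon as \<open>d\<close> is
  of the form \<open>\<sigma>(c)\<^sup>-\<^sup>1 c\<close>. That is the Lang-Steinberg theorem for \<open>F\<close> on the closed connected \<open>F\<close>-stable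
  subgroup \<open>C\<^sub>G(A\<^sub>w)\<^sup>\<circ>\<close>; the group theory is in \<open>twisted_quotient_iso\<close>, and most of what follows
  proves \<open>lang_steinberg_closed_subgroup\<close>.

  Let \<open>H\<close> be such a subgroup, \<open>B\<close> its coordinate ring, and let \<open>F ^ M\<close> be a Frobenius morphism for \<open>q\<close>.
  The group \<open>H\<close> acts on itself by \<open>x \<cdot> a = x a F(x)\<^sup>-\<^sup>1\<close>, and the claim is that there is one orbit.
  As \<open>H\<close> is connected, it is enough that every orbit is open, that is, that the image of
  \<open>L(x) = x a F(x)\<^sup>-\<^sup>1\<close> contains a neighbourhood of \<open>a\<close>. This follows from two facts about the
  comorphism of \<open>L\<close>.

  First, the image of \<open>L\<close> is closed, because \<open>B\<close> is a finite module over \<open>L\<^sup>*B\<close>. With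
  \<open>\<nu>\<^sub>n(y) = y F(y) \<dots> F\<^sup>n\<^sup>-\<^sup>1(y)\<close> one has \<open>\<nu>\<^sub>n(L(x)) = x \<nu>\<^sub>n(a) F\<^sup>n(x)\<^sup>-\<^sup>1\<close>. For \<open>n = M s\<close> and a generator
  \<open>t\<close> of \<open>B\<close> with \<open>t(F\<^sup>M(x)) = t(x)\<^sup>q\<close>, the power of \<open>t\<close> with exponent \<open>q\<^sup>s\<close> therefore maps \<open>x\<close> to
  \<open>t(\<nu>\<^sub>n(L(x))\<^sup>-\<^sup>1 x \<nu>\<^sub>n(a))\<close>, which is a combination over \<open>L\<^sup>*B\<close> of functions of \<open>x\<close> whose degree in the
  generators is bounded independently of \<open>s\<close>. For large \<open>s\<close> such a relation lowers the degree
  (\<open>finite_module_of_powers\<close>, \<open>lang_map_finite\<close>). Nakayama's lemma, together with the fact that a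
  nonzero finite-dimensional algebra over an algebraically closed field has a character, then gives a
  point above each zero of the kernel of \<open>L\<^sup>*\<close> (\<open>finite_image_closed\<close>).

  Secondly, \<open>L\<close> is infinitesimally injective. After translating \<open>a\<close> to the identity, \<open>L\<close> becomes
  \<open>x \<mapsto> x E(x)\<^sup>-\<^sup>1\<close> for the conjugate endomorphism \<open>E(x) = a F(x) a\<^sup>-\<^sup>1\<close>, and it acts as \<open>1 - E\<^sup>*\<close> on the
  cotangent space at the identity. There \<open>E\<^sup>*\<close> is nilpotent because \<open>F ^ M\<close> takes \<open>q\<close>-th powers. Hence
  a function killed by \<open>L\<^sup>*\<close> lies in every power of the maximal ideal at the identity. By Krull's
  intersection theorem, which rests on Hilbert's basis theorem, all of these functions vanish near
  the identity (\<open>vanishing_near_one\<close>). Their zero set is the closure of the image, and so the image.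
\<close>

section \<open>Subrings and spans\<close>

text \<open>
  Rings are subsets of a fixed commutative ring type, so that inclusions between them are literal
  inclusions of sets.
\<close>

definition is_subring :: "'r::comm_ring_1 set \<Rightarrow> bool" where
  "is_subring S \<longleftrightarrow> 1 \<in> S \<and> (\<forall>x\<in>S. \<forall>y\<in>S. x - y \<in> S \<and> x * y \<in> S)"

definition is_ideal :: "'r::comm_ring_1 set \<Rightarrow> 'r set \<Rightarrow> bool" where
  "is_ideal S I \<longleftrightarrow> I \<subseteq> S \<and> 0 \<in> I \<and> (\<forall>x\<in>I. \<forall>y\<in>I. x + y \<in> I) \<and> (\<forall>s\<in>S. \<forall>x\<in>I. s * x \<in> I)"

text \<open>
  The coefficient set need not be a subring: taking an ideal for it gives products of an ideal
  with a module, as in Nakayama's lemma and in the definition of powers of an ideal.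
\<close>

inductive_set rspan :: "'r::comm_ring_1 set \<Rightarrow> 'r set \<Rightarrow> 'r set" for S T where
  zero: "0 \<in> rspan S T"
| add: "\<lbrakk>s \<in> S; t \<in> T; x \<in> rspan S T\<rbrakk> \<Longrightarrow> s * t + x \<in> rspan S T"

context
  fixes S :: "'r::comm_ring_1 set"
  assumes S: "is_subring S"
begin

lemma subring_one: "1 \<in> S" and subring_diff: "x \<in> S \<Longrightarrow> y \<in> S \<Longrightarrow> x - y \<in> S"
  and subring_mult: "x \<in> S \<Longrightarrow> y \<in> S \<Longrightarrow> x * y \<in> S"
  using S by (auto simp: is_subring_def)

lemma subring_zero: "0 \<in> S"
  using subring_diff[OF subring_one subring_one] by simp

lemma subring_minus: "x \<in> S \<Longrightarrow> - x \<in> S"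
  using subring_diff[OF subring_zero] by fastforce

lemma subring_add: "x \<in> S \<Longrightarrow> y \<in> S \<Longrightarrow> x + y \<in> S"
  using subring_diff[OF _ subring_minus, of x y] by simp

lemma subring_sum: "(\<And>i. i \<in> A \<Longrightarrow> f i \<in> S) \<Longrightarrow> sum f A \<in> S"
  by (induction A rule: infinite_finite_induct) (auto intro: subring_add subring_zero)

lemma subring_power: "x \<in> S \<Longrightarrow> x ^ n \<in> S"
  by (induction n) (auto intro: subring_one subring_mult)

lemma subring_prod_mset: "set_mset M \<subseteq> S \<Longrightarrow> prod_mset M \<in> S"
  by (induction M) (auto intro: subring_one subring_mult)

lemma subring_poly: "(\<And>i. coeff p i \<in> S) \<Longrightarrow> t \<in> S \<Longrightarrow> poly p t \<in> S"
  unfolding poly_altdef by (auto intro: subring_sum subring_mult subring_power)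

lemma is_ideal_self: "is_ideal S S"
  by (auto simp: is_ideal_def intro: subring_zero subring_add subring_mult)

end

lemma rspan_gen: "s \<in> S \<Longrightarrow> t \<in> T \<Longrightarrow> s * t \<in> rspan S T"
  using rspan.add[OF _ _ rspan.zero] by fastforce

lemma rspan_base: "1 \<in> S \<Longrightarrow> t \<in> T \<Longrightarrow> t \<in> rspan S T"
  using rspan_gen by fastforce

lemma rspan_add: "x \<in> rspan S T \<Longrightarrow> y \<in> rspan S T \<Longrightarrow> x + y \<in> rspan S T"
  by (induction rule: rspan.induct) (auto simp: add.assoc intro: rspan.add)

lemma rspan_sum: "(\<And>i. i \<in> A \<Longrightarrow> f i \<in> rspan S T) \<Longrightarrow> sum f A \<in> rspan S T"
  by (induction A rule: infinite_finite_induct) (auto intro: rspan_add rspan.zero)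

lemma rspan_mono: "S \<subseteq> S' \<Longrightarrow> T \<subseteq> T' \<Longrightarrow> rspan S T \<subseteq> rspan S' T'"
proof
  fix x assume st: "S \<subseteq> S'" "T \<subseteq> T'" and "x \<in> rspan S T"
  from this(3) show "x \<in> rspan S' T'"
    by induction (use st in \<open>auto intro: rspan.intros\<close>)
qed

lemma rspan_scale:
  assumes "\<And>s. s \<in> S \<Longrightarrow> c * s \<in> S'" "x \<in> rspan S T"
  shows "c * x \<in> rspan S' T"
  using assms(2)
proof induction
  case (add s t x)
  have "c * (s * t + x) = (c * s) * t + c * x" by (simp add: algebra_simps)
  then show ?case using add assms(1) by (auto intro: rspan.add)
qed (auto intro: rspan.zero)

lemma rspan_least:
  assumes "0 \<in> X" "\<And>x y. x \<in> X \<Longrightarrow> y \<in> X \<Longrightarrow> x + y \<in> X" "\<And>s t. s \<in> S \<Longrightarrow> t \<in> T \<Longrightarrow> s * t \<in> X"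
  shows "rspan S T \<subseteq> X"
proof
  fix x assume "x \<in> rspan S T"
  then show "x \<in> X" by induction (use assms in auto)
qed

lemma rspan_trans:
  assumes "is_subring S" "T \<subseteq> rspan S T'"
  shows "rspan S T \<subseteq> rspan S T'"
  by (rule rspan_least)
    (use assms in \<open>auto intro: rspan.zero rspan_add rspan_scale subring_mult\<close>)

lemma rspan_is_ideal:
  assumes "is_subring S" "T \<subseteq> S"
  shows "is_ideal S (rspan S T)"
  unfolding is_ideal_def
proof (intro conjI ballI)
  show "rspan S T \<subseteq> S"
    by (rule rspan_least) (use assms in \<open>auto intro: subring_zero subring_add subring_mult\<close>)
qed (use assms in \<open>auto intro: rspan.zero rspan_add rspan_scale subring_mult\<close>)

lemma rspan_finite_support:
  assumes "x \<in> rspan S T"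
  obtains T' where "finite T'" "T' \<subseteq> T" "x \<in> rspan S T'"
proof -
  have "\<exists>T'. finite T' \<and> T' \<subseteq> T \<and> x \<in> rspan S T'"
    using assms
  proof induction
    case zero
    show ?case by (intro exI[of _ "{}"]) (auto intro: rspan.zero)
  next
    case (add s t x)
    then obtain T' where "finite T'" "T' \<subseteq> T" "x \<in> rspan S T'" by auto
    moreover have "rspan S T' \<subseteq> rspan S (insert t T')" by (intro rspan_mono) auto
    ultimately show ?case
      using add by (intro exI[of _ "insert t T'"]) (auto intro: rspan.add)
  qed
  then show thesis using that by blast
qed

lemma rspan_finite_subset_support:
  assumes "finite T" "T \<subseteq> rspan S I" "is_subring S"
  obtains T' where "finite T'" "T' \<subseteq> I" "T \<subseteq> rspan S T'"
proof -
  have "\<forall>x\<in>T. \<exists>T'. finite T' \<and> T' \<subseteq> I \<and> x \<in> rspan S T'"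
    using assms(2) by (meson rspan_finite_support subsetD)
  then obtain f where f: "\<And>x. x \<in> T \<Longrightarrow> finite (f x) \<and> f x \<subseteq> I \<and> x \<in> rspan S (f x)" by metis
  show thesis
  proof (rule that[of "\<Union>(f ` T)"])
    show "T \<subseteq> rspan S (\<Union>(f ` T))"
    proof
      fix x assume "x \<in> T"
      then have "rspan S (f x) \<subseteq> rspan S (\<Union>(f ` T))" by (intro rspan_mono) auto
      with f \<open>x \<in> T\<close> show "x \<in> rspan S (\<Union>(f ` T))" by blast
    qed
  qed (use f assms in auto)
qed

lemma rspan_insert:
  assumes S: "0 \<in> S" "\<And>x y. x \<in> S \<Longrightarrow> y \<in> S \<Longrightarrow> x + y \<in> S"
    and x: "x \<in> rspan S (insert g T)"
  obtains s y where "s \<in> S" "y \<in> rspan S T" "x = s * g + y"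
proof -
  have "\<exists>s\<in>S. \<exists>y\<in>rspan S T. x = s * g + y"
    using x
  proof induction
    case zero
    have "(0::'a) = 0 * g + 0" by simp
    then show ?case using S(1) rspan.zero by blast
  next
    case (add s t x)
    then obtain s' y where sy: "s' \<in> S" "y \<in> rspan S T" "x = s' * g + y" by blast
    show ?case
    proof (cases "t = g")
      case True
      then have "s * t + x = (s + s') * g + y" using sy by (simp add: algebra_simps)
      then show ?thesis using sy add(1) S(2) by blast
    next
      case False
      then have "s * t + y \<in> rspan S T" using add sy by (auto intro: rspan.add)
      moreover have "s * t + x = s' * g + (s * t + y)" using sy by (simp add: algebra_simps)
      ultimately show ?thesis using sy(1) by blast
    qed
  qed
  then show thesis using that by blast
qed

section \<open>Noetherian rings\<close>

text \<open>
  Spans of arbitrary subsets are used in place of ideals: every subset contains a finite subset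
  spanning the same ideal.
\<close>

definition noetherian :: "'r::comm_ring_1 set \<Rightarrow> bool" where
  "noetherian S \<longleftrightarrow> (\<forall>I\<subseteq>S. \<exists>T. finite T \<and> T \<subseteq> I \<and> I \<subseteq> rspan S T)"

lemma noetherian_generators:
  "noetherian S \<Longrightarrow> I \<subseteq> S \<Longrightarrow> \<exists>T. finite T \<and> T \<subseteq> I \<and> I \<subseteq> rspan S T"
  by (simp add: noetherian_def)

lemma noetherian_sequence:
  fixes a :: "nat \<Rightarrow> 'r::comm_ring_1"
  assumes "noetherian S" "\<And>i. a i \<in> S"
  shows "\<exists>n. range a \<subseteq> rspan S (a ` {..<n})"
proof -
  have "\<exists>T. finite T \<and> T \<subseteq> range a \<and> range a \<subseteq> rspan S T"
    using assms(1)[unfolded noetherian_def, rule_format, of "range a"] assms(2) by auto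
  then obtain T where T: "finite T" "T \<subseteq> range a" "range a \<subseteq> rspan S T" by auto
  then obtain M where M: "finite M" "T = a ` M" by (meson finite_subset_image)
  obtain n where "M \<subseteq> {..<n}" using finite_nat_bounded[OF M(1)] by auto
  then have "T \<subseteq> a ` {..<n}" using M by auto
  then have "rspan S T \<subseteq> rspan S (a ` {..<n})" by (intro rspan_mono) auto
  then show ?thesis using T by blast
qed

text \<open>
  Dependent choice in the form in which a failure of finite generation is used: each term is bad
  relative to the finitely many earlier ones.
\<close>

lemma sequence_avoiding_finite_sets:
  assumes "\<And>T. finite T \<Longrightarrow> T \<subseteq> I \<Longrightarrow> \<exists>x\<in>I. Q T x"
  shows "\<exists>f :: nat \<Rightarrow> 'x. \<forall>n. f n \<in> I \<and> Q (f ` {..<n}) (f n)"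
proof -
  define pick where "pick = (\<lambda>T. SOME x. x \<in> I \<and> Q T x)"
  have pick: "pick T \<in> I" "Q T (pick T)" if "finite T" "T \<subseteq> I" for T
    using someI_ex[of "\<lambda>x. x \<in> I \<and> Q T x"] assms[OF that] unfolding pick_def by auto
  define g where "g = rec_nat ({} :: 'x set) (\<lambda>_ T. insert (pick T) T)"
  have g: "g 0 = {}" "g (Suc n) = insert (pick (g n)) (g n)" for n
    by (simp_all add: g_def)
  define f where "f = (\<lambda>n. pick (g n))"
  have gf: "g n = f ` {..<n}" for n
    by (induction n) (auto simp: g f_def lessThan_Suc)
  have fin: "finite (g n) \<and> g n \<subseteq> I" for n
    by (induction n) (auto simp: g pick)
  have "f n \<in> I \<and> Q (f ` {..<n}) (f n)" for n
    using pick[of "g n"] fin[of n] unfolding gf[symmetric] by (simp add: f_def)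
  then show ?thesis by blast
qed

definition adjoin :: "'r::comm_ring_1 set \<Rightarrow> 'r \<Rightarrow> 'r set" where
  "adjoin S t = {poly p t |p. \<forall>i. coeff p i \<in> S}"

lemma coeff_mult_in_subring:
  assumes "is_subring S" "\<And>i. coeff p i \<in> S" "\<And>i. coeff q i \<in> S"
  shows "coeff (p * q) i \<in> S"
  unfolding coeff_mult using assms by (auto intro: subring_sum subring_mult)

lemma adjoin_is_subring:
  assumes "is_subring S"
  shows "is_subring (adjoin S t)"
  unfolding is_subring_def
proof (intro conjI ballI)
  show "1 \<in> adjoin S t"
    unfolding adjoin_def using assms
    by (auto intro!: exI[of _ 1] simp: coeff_pCons subring_one subring_zero)
next
  fix x y assume "x \<in> adjoin S t" "y \<in> adjoin S t"
  then obtain p q where p: "x = poly p t" "y = poly q t" "\<forall>i. coeff p i \<in> S" "\<forall>i. coeff q i \<in> S"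
    by (auto simp: adjoin_def)
  show "x - y \<in> adjoin S t"
    unfolding adjoin_def using p assms by (auto intro!: exI[of _ "p - q"] subring_diff)
  show "x * y \<in> adjoin S t"
    unfolding adjoin_def using p assms
    by (auto intro!: exI[of _ "p * q"] coeff_mult_in_subring)
qed

lemma adjoin_base:
  assumes "is_subring S"
  shows "S \<subseteq> adjoin S t"
proof
  fix s assume "s \<in> S"
  then have "\<forall>i. coeff [:s:] i \<in> S" by (auto simp: coeff_pCons subring_zero[OF assms] split: nat.split)
  then show "s \<in> adjoin S t" unfolding adjoin_def by (auto intro!: exI[of _ "[:s:]"])
qed

lemma adjoin_generator:
  assumes "is_subring S"
  shows "t \<in> adjoin S t"
proof -
  have "\<forall>i. coeff [:0, 1:] i \<in> S"
    by (auto simp: coeff_pCons subring_zero[OF assms] subring_one[OF assms] split: nat.split)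
  then show ?thesis unfolding adjoin_def by (auto intro!: exI[of _ "[:0,1:]"])
qed

lemma adjoin_least:
  assumes "is_subring X" "S \<subseteq> X" "t \<in> X"
  shows "adjoin S t \<subseteq> X"
  unfolding adjoin_def using assms by (auto intro!: subring_poly)

text \<open>
  Choose polynomials of minimal degree, each outside the ideal spanned by the earlier ones. Their
  leading coefficients span a finitely generated ideal, so one of them is a combination of earlier
  ones, and subtracting the corresponding combination of polynomials, shifted to the right degree,
  contradicts minimality. Degrees are those of polynomials \<open>p\<close> with \<open>poly p t\<close> in the ideal, as \<open>t\<close> may
  satisfy algebraic relations over \<open>S\<close>.
\<close>

lemma hilbert_basis_adjoin:
  fixes S :: "'r::comm_ring_1 set"
  assumes S: "is_subring S" and N: "noetherian S"
  shows "noetherian (adjoin S t)"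
proof (rule ccontr)
  let ?P = "adjoin S t"
  have P: "is_subring ?P" by (rule adjoin_is_subring[OF S])
  assume "\<not> noetherian ?P"
  then obtain I0 where I0: "I0 \<subseteq> ?P" "\<And>T. finite T \<Longrightarrow> T \<subseteq> I0 \<Longrightarrow> \<not> I0 \<subseteq> rspan ?P T"
    unfolding noetherian_def by auto
  define I where "I = {p. (\<forall>i. coeff p i \<in> S) \<and> poly p t \<in> rspan ?P I0}"
  define Q where "Q = (\<lambda>T p. poly p t \<notin> rspan ?P ((\<lambda>q. poly q t) ` T) \<and>
     (\<forall>q\<in>I. degree q < degree p \<longrightarrow> poly q t \<in> rspan ?P ((\<lambda>q. poly q t) ` T)))"
  have step: "\<exists>p\<in>I. Q T p" if T: "finite T" "T \<subseteq> I" for T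
  proof -
    let ?T = "(\<lambda>q. poly q t) ` T"
    have "?T \<subseteq> rspan ?P I0" using T by (auto simp: I_def)
    then obtain T' where T': "finite T'" "T' \<subseteq> I0" "?T \<subseteq> rspan ?P T'"
      using rspan_finite_subset_support[OF finite_imageI[OF T(1)] _ P] by metis
    have "\<exists>x\<in>I0. x \<notin> rspan ?P ?T"
      using I0(2)[OF T'(1,2)] rspan_trans[OF P T'(3)] by blast
    then obtain x where x: "x \<in> I0" "x \<notin> rspan ?P ?T" by blast
    then obtain p where p: "\<forall>i. coeff p i \<in> S" "x = poly p t" using I0(1) by (auto simp: adjoin_def)
    have "p \<in> I \<and> poly p t \<notin> rspan ?P ?T"
      using p x subring_one[OF P] by (auto simp: I_def intro: rspan_base)
    then obtain p' where "p' \<in> I \<and> poly p' t \<notin> rspan ?P ?T"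
      and min: "\<And>q. q \<in> I \<and> poly q t \<notin> rspan ?P ?T \<Longrightarrow> degree p' \<le> degree q"
      using ex_has_least_nat[of "\<lambda>p. p \<in> I \<and> poly p t \<notin> rspan ?P ?T" p degree] by blast
    then show ?thesis unfolding Q_def by (meson linorder_not_less)
  qed
  have "\<exists>f :: nat \<Rightarrow> 'r poly. \<forall>n. f n \<in> I \<and> Q (f ` {..<n}) (f n)"
    by (rule sequence_avoiding_finite_sets) (rule step)
  then obtain f :: "nat \<Rightarrow> 'r poly" where "\<forall>n. f n \<in> I \<and> Q (f ` {..<n}) (f n)" ..
  then have f: "\<And>n. f n \<in> I" "\<And>n. Q (f ` {..<n}) (f n)" by (simp_all only: simp_thms)
  have deg: "degree (f i) \<le> degree (f n)" if "i \<le> n" for i n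
  proof (rule ccontr)
    assume "\<not> ?thesis"
    then have "poly (f n) t \<in> rspan ?P ((\<lambda>q. poly q t) ` f ` {..<i})"
      using f(2)[of i] f(1)[of n] unfolding Q_def by auto
    moreover have "rspan ?P ((\<lambda>q. poly q t) ` f ` {..<i}) \<subseteq> rspan ?P ((\<lambda>q. poly q t) ` f ` {..<n})"
      using that by (intro rspan_mono) auto
    ultimately show False using f(2)[of n] unfolding Q_def by auto
  qed
  have fS: "coeff (f n) i \<in> S" for n i using f(1) by (auto simp: I_def)
  obtain n where n: "range (\<lambda>i. lead_coeff (f i)) \<subseteq> rspan S ((\<lambda>i. lead_coeff (f i)) ` {..<n})"
    using noetherian_sequence[OF N, of "\<lambda>i. lead_coeff (f i)"] fS by auto
  let ?d = "degree (f n)"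
  \<comment> \<open>Multiplying by a monomial raises the earlier polynomials to degree \<open>?d\<close>, which is possible
    because the degrees increase with the index.\<close>
  have lift: "\<exists>q. (\<forall>i. coeff q i \<in> S) \<and> degree q \<le> ?d \<and> coeff q ?d = c \<and>
          poly q t \<in> rspan ?P ((\<lambda>q. poly q t) ` f ` {..<n})"
    if "c \<in> rspan S ((\<lambda>i. lead_coeff (f i)) ` {..<n})" for c
    using that
  proof induction
    case zero
    show ?case by (intro exI[of _ 0]) (auto intro: rspan.zero subring_zero[OF S])
  next
    case (add s l x)
    then obtain q i where q: "\<forall>i. coeff q i \<in> S" "degree q \<le> ?d" "coeff q ?d = x"
      "poly q t \<in> rspan ?P ((\<lambda>q. poly q t) ` f ` {..<n})" and i: "i < n" "l = lead_coeff (f i)" by auto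
    let ?m = "monom s (?d - degree (f i))"
    let ?q = "?m * f i + q"
    have d: "degree (f i) \<le> ?d" using deg i by auto
    have mS: "coeff ?m j \<in> S" for j using \<open>s \<in> S\<close> subring_zero[OF S] by (auto simp: coeff_monom)
    have "\<forall>j. coeff ?q j \<in> S"
      using q(1) coeff_mult_in_subring[OF S mS fS] by (auto intro: subring_add[OF S])
    moreover have "degree ?q \<le> ?d"
    proof (rule degree_add_le)
      have "degree (?m * f i) \<le> degree ?m + degree (f i)" by (rule degree_mult_le)
      also have "\<dots> \<le> ?d" using degree_monom_le[of s "?d - degree (f i)"] d by linarith
      finally show "degree (?m * f i) \<le> ?d" .
    qed (use q in auto)
    moreover have "coeff ?q ?d = s * l + x"
      using d q(3) i by (simp add: coeff_monom_mult)
    moreover have "poly ?m t \<in> ?P" using mS by (auto simp: adjoin_def)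
    then have "poly ?q t \<in> rspan ?P ((\<lambda>q. poly q t) ` f ` {..<n})"
      using q(4) i by (auto intro!: rspan.add)
    ultimately show ?case by blast
  qed
  obtain q where q: "\<forall>i. coeff q i \<in> S" "degree q \<le> ?d" "coeff q ?d = lead_coeff (f n)"
    "poly q t \<in> rspan ?P ((\<lambda>q. poly q t) ` f ` {..<n})"
    using lift[of "lead_coeff (f n)"] n by blast
  define h where "h = f n - q"
  have notin: "poly h t \<notin> rspan ?P ((\<lambda>q. poly q t) ` f ` {..<n})"
  proof
    assume "poly h t \<in> rspan ?P ((\<lambda>q. poly q t) ` f ` {..<n})"
    then have "poly h t + poly q t \<in> rspan ?P ((\<lambda>q. poly q t) ` f ` {..<n})"
      using q(4) by (rule rspan_add)
    then show False using f(2)[of n] by (simp add: h_def Q_def)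
  qed
  then have "h \<noteq> 0" using rspan.zero[of ?P] by auto
  moreover have "degree h \<le> ?d" unfolding h_def using q by (intro degree_diff_le) auto
  moreover have "coeff h ?d = 0" unfolding h_def using q by simp
  ultimately have "degree h < ?d"
    by (metis le_neq_implies_less leading_coeff_0_iff)
  moreover have "h \<in> I"
  proof -
    have ideal: "is_ideal ?P (rspan ?P I0)" by (rule rspan_is_ideal[OF P I0(1)])
    have "(\<lambda>q. poly q t) ` f ` {..<n} \<subseteq> rspan ?P I0" using f(1) by (auto simp: I_def)
    then have "poly q t \<in> rspan ?P I0" using rspan_trans[OF P] q(4) by blast
    moreover have "poly (f n) t \<in> rspan ?P I0" using f(1) by (auto simp: I_def)
    moreover have "-1 \<in> ?P" using subring_minus[OF P subring_one[OF P]] .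
    ultimately have "poly (f n) t + (-1) * poly q t \<in> rspan ?P I0"
      using ideal unfolding is_ideal_def by blast
    then show ?thesis using q(1) fS by (auto simp: I_def h_def intro: subring_diff[OF S])
  qed
  ultimately show False using f(2)[of n] notin unfolding Q_def by auto
qed

lemma hilbert_basis:
  fixes S :: "'r::comm_ring_1 set"
  assumes "finite T" "is_subring S" "noetherian S"
  shows "\<exists>P. is_subring P \<and> noetherian P \<and> S \<union> T \<subseteq> P \<and>
    (\<forall>X. is_subring X \<longrightarrow> S \<union> T \<subseteq> X \<longrightarrow> P \<subseteq> X)"
  using assms(1)
proof induction
  case empty
  show ?case using assms by (intro exI[of _ S]) auto
next
  case (insert t T)
  then obtain P where P: "is_subring P" "noetherian P" "S \<union> T \<subseteq> P"
    "\<And>X. is_subring X \<Longrightarrow> S \<union> T \<subseteq> X \<Longrightarrow> P \<subseteq> X" by blast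
  show ?case
  proof (intro exI[of _ "adjoin P t"] conjI allI impI)
    show "S \<union> insert t T \<subseteq> adjoin P t"
      using P(3) adjoin_base[OF P(1), of t] adjoin_generator[OF P(1), of t] by blast
    show "adjoin P t \<subseteq> X" if "is_subring X" "S \<union> insert t T \<subseteq> X" for X
      using that P(4) by (intro adjoin_least) auto
  qed (use P in \<open>auto intro: adjoin_is_subring hilbert_basis_adjoin\<close>)
qed

lemma noetherian_finitely_generated:
  fixes K T :: "'r::comm_ring_1 set"
  assumes K: "is_subring K" "noetherian K" and T: "finite T"
    and B: "is_subring B" "K \<union> T \<subseteq> B" "\<And>X. is_subring X \<Longrightarrow> K \<union> T \<subseteq> X \<Longrightarrow> B \<subseteq> X"
  shows "noetherian B"
proof -
  obtain P where P: "is_subring P" "noetherian P" "K \<union> T \<subseteq> P"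
    "\<And>X. is_subring X \<Longrightarrow> K \<union> T \<subseteq> X \<Longrightarrow> P \<subseteq> X" using hilbert_basis[OF T K] by blast
  have "P = B" using P(4)[OF B(1,2)] B(3)[OF P(1,3)] by auto
  then show ?thesis using P by simp
qed

lemma field_noetherian:
  fixes K :: "'r::comm_ring_1 set"
  assumes K: "is_subring K" and inv: "\<And>c. c \<in> K \<Longrightarrow> c \<noteq> 0 \<Longrightarrow> \<exists>d\<in>K. d * c = 1"
  shows "noetherian K"
  unfolding noetherian_def
proof (intro allI impI)
  fix I assume "I \<subseteq> K"
  show "\<exists>T. finite T \<and> T \<subseteq> I \<and> I \<subseteq> rspan K T"
  proof (cases "I \<subseteq> {0}")
    case True
    then show ?thesis by (intro exI[of _ "{}"]) (auto intro: rspan.zero)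
  next
    case False
    then obtain c where c: "c \<in> I" "c \<noteq> 0" by auto
    then obtain d where d: "d \<in> K" "d * c = 1" using inv \<open>I \<subseteq> K\<close> by blast
    have "x \<in> rspan K {c}" if "x \<in> I" for x
    proof -
      have "x = (x * d) * c" using d by (simp add: mult.assoc)
      moreover have "x * d \<in> K" using that \<open>I \<subseteq> K\<close> d by (auto intro: subring_mult[OF K])
      ultimately show ?thesis using rspan_gen[of "x * d" K c "{c}"] by simp
    qed
    then show ?thesis using c by (intro exI[of _ "{c}"]) auto
  qed
qed

section \<open>Powers of ideals and Krull's intersection theorem\<close>

primrec ideal_power :: "'r::comm_ring_1 set \<Rightarrow> 'r set \<Rightarrow> nat \<Rightarrow> 'r set" where
  "ideal_power B m 0 = B"
| "ideal_power B m (Suc n) = rspan m (ideal_power B m n)"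

context
  fixes B m :: "'r::comm_ring_1 set"
  assumes B: "is_subring B" and m: "is_ideal B m"
begin

lemma ideal_mult: "b \<in> B \<Longrightarrow> x \<in> m \<Longrightarrow> b * x \<in> m"
  and ideal_add: "x \<in> m \<Longrightarrow> y \<in> m \<Longrightarrow> x + y \<in> m"
  and ideal_zero: "0 \<in> m" and ideal_subset: "x \<in> m \<Longrightarrow> x \<in> B"
  using m by (auto simp: is_ideal_def)

lemma ideal_minus: "x \<in> m \<Longrightarrow> - x \<in> m"
  using ideal_mult[OF subring_minus[OF B subring_one[OF B]], of x] by simp

lemma ideal_diff: "x \<in> m \<Longrightarrow> y \<in> m \<Longrightarrow> x - y \<in> m"
  using ideal_add[OF _ ideal_minus, of x y] by simp

lemma ideal_sum: "(\<And>i. i \<in> A \<Longrightarrow> f i \<in> m) \<Longrightarrow> sum f A \<in> m"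
  by (induction A rule: infinite_finite_induct) (auto intro: ideal_zero ideal_add)

lemma ideal_power_is_ideal: "is_ideal B (ideal_power B m n)"
proof (induction n)
  case 0
  then show ?case by (simp add: is_ideal_self[OF B])
next
  case (Suc n)
  have "rspan m (ideal_power B m n) \<subseteq> B"
    by (rule rspan_least)
      (use Suc ideal_subset subring_zero[OF B] subring_add[OF B] subring_mult[OF B] in \<open>auto simp: is_ideal_def\<close>)
  then show ?case
    by (auto simp: is_ideal_def intro: rspan.zero rspan_add rspan_scale ideal_mult)
qed

lemma ideal_power_1: "ideal_power B m 1 = m"
proof
  have "rspan m B \<subseteq> m"
    by (rule rspan_least) (metis ideal_zero ideal_add ideal_mult mult.commute)+
  then show "ideal_power B m 1 \<subseteq> m" by simp
  show "m \<subseteq> ideal_power B m 1"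
    using rspan_gen[of _ m 1 B] subring_one[OF B] by auto
qed

lemma ideal_power_Suc_subset: "ideal_power B m (Suc n) \<subseteq> ideal_power B m n"
proof -
  have "rspan m (ideal_power B m n) \<subseteq> ideal_power B m n"
    by (rule rspan_least)
      (use ideal_power_is_ideal[of n] ideal_subset in \<open>auto simp: is_ideal_def\<close>)
  then show ?thesis by simp
qed

lemma ideal_power_mono: "i \<le> j \<Longrightarrow> ideal_power B m j \<subseteq> ideal_power B m i"
  by (induction rule: dec_induct) (use ideal_power_Suc_subset in blast)+

lemma ideal_power_mult:
  "x \<in> ideal_power B m i \<Longrightarrow> y \<in> ideal_power B m j \<Longrightarrow> x * y \<in> ideal_power B m (i + j)"
proof (induction i arbitrary: x)
  case 0
  then show ?case using ideal_power_is_ideal[of j] by (auto simp: is_ideal_def)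
next
  case (Suc i)
  have "rspan m (ideal_power B m i) \<subseteq> {x. x * y \<in> rspan m (ideal_power B m (i + j))}"
  proof (rule rspan_least)
    fix s t assume "s \<in> m" "t \<in> ideal_power B m i"
    then show "s * t \<in> {x. x * y \<in> rspan m (ideal_power B m (i + j))}"
      using Suc by (auto simp: mult.assoc intro: rspan_gen)
  qed (auto simp: distrib_right intro: rspan.zero rspan_add)
  then show ?case using Suc.prems by auto
qed

lemma ideal_power_power: "x \<in> m \<Longrightarrow> x ^ n \<in> ideal_power B m n"
  by (induction n) (auto intro: rspan_gen subring_one[OF B])

end

text \<open>
  Consider the Rees algebra, generated by the constants \<open>b\<close> with \<open>b \<in> B\<close> and by \<open>u X\<close> with \<open>u \<in> m\<close>. It
  is Noetherian and contains all \<open>f X\<^sup>l\<close>, so some \<open>f X\<^sup>n\<^sup>+\<^sup>1\<close> is a combination of the \<open>f X\<^sup>i\<close> with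
  \<open>1 \<le> i \<le> n\<close>. Comparing coefficients of degree \<open>n + 1\<close> gives \<open>f = e f\<close>, where \<open>e\<close> is a sum of
  coefficients of positive degree of elements of the Rees algebra, hence in \<open>m\<close>.
\<close>

lemma krull_intersection:
  fixes B m :: "'r::comm_ring_1 set"
  assumes B: "is_subring B" and NB: "noetherian B"
    and m: "is_ideal B m" and f: "\<And>l. f \<in> ideal_power B m l"
  shows "\<exists>e\<in>m. f = e * f"
proof -
  have mB: "m \<subseteq> B" using m by (auto simp: is_ideal_def)
  then obtain U where U: "finite U" "U \<subseteq> m" "m \<subseteq> rspan B U"
    using noetherian_generators[OF NB] by metis
  define const where "const = (\<lambda>c::'r. [:c:])"
  have constB: "is_subring (const ` B)"
  proof -
    have "const x - const y = const (x - y)" "const x * const y = const (x * y)" for x y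
      by (simp_all add: const_def)
    moreover have "const 1 = 1" by (simp add: const_def)
    then have "1 \<in> const ` B" using imageI[OF subring_one[OF B], of const] by simp
    ultimately show ?thesis
      using subring_diff[OF B] subring_mult[OF B] by (simp add: is_subring_def)
  qed
  have constN: "noetherian (const ` B)"
    unfolding noetherian_def
  proof (intro allI impI)
    fix I assume "I \<subseteq> const ` B"
    then obtain I' where I': "I' \<subseteq> B" "I = const ` I'" by (meson subset_imageE)
    then obtain T where T: "finite T" "T \<subseteq> I'" "I' \<subseteq> rspan B T"
      using noetherian_generators[OF NB] by metis
    have "const x \<in> rspan (const ` B) (const ` T)" if "x \<in> rspan B T" for x
      using that
    proof induction
      case zero
      show ?case by (simp add: const_def rspan.zero)
    next
      case (add s t x)
      have "const (s * t + x) = const s * const t + const x" by (simp add: const_def)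
      then show ?case using add rspan.add[of "const s" "const ` B" "const t" "const ` T" "const x"] by simp
    qed
    then show "\<exists>T. finite T \<and> T \<subseteq> I \<and> I \<subseteq> rspan (const ` B) T"
      using T I' by (intro exI[of _ "const ` T"]) auto
  qed
  obtain P where P: "is_subring P" "noetherian P" "const ` B \<union> (\<lambda>u. monom u 1) ` U \<subseteq> P"
      "\<And>X. is_subring X \<Longrightarrow> const ` B \<union> (\<lambda>u. monom u 1) ` U \<subseteq> X \<Longrightarrow> P \<subseteq> X"
    using hilbert_basis[OF finite_imageI[OF U(1)] constB constN, of "\<lambda>u. monom u 1"] by blast
  \<comment> \<open>Finitely many generators \<open>U\<close> of \<open>m\<close> make \<open>P\<close> Noetherian; its elements stay inside the graded
    ring \<open>?R\<close>.\<close>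
  let ?R = "{p. \<forall>l. coeff p l \<in> ideal_power B m l}"
  note ip = ideal_power_is_ideal[OF B m]
  have "is_subring ?R"
    unfolding is_subring_def
  proof (intro conjI ballI)
    show "1 \<in> ?R"
      using ideal_zero[OF B ip] subring_one[OF B] by (simp add: one_pCons coeff_pCons rspan.zero split: nat.split)
    fix p q assume pq: "p \<in> ?R" "q \<in> ?R"
    then show "p - q \<in> ?R" using ideal_diff[OF B ip] by auto
    show "p * q \<in> ?R"
    proof safe
      fix l
      have "coeff p i * coeff q (l - i) \<in> ideal_power B m l" if "i \<le> l" for i
        using pq that ideal_power_mult[OF B m, of "coeff p i" i "coeff q (l - i)" "l - i"] by simp
      then show "coeff (p * q) l \<in> ideal_power B m l"
        unfolding coeff_mult by (intro ideal_sum[OF B ip]) auto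
    qed
  qed
  moreover have "const ` B \<union> (\<lambda>u. monom u 1) ` U \<subseteq> ?R"
  proof -
    have "const b \<in> ?R" if "b \<in> B" for b
      using that ideal_zero[OF B ip] by (simp add: const_def coeff_pCons rspan.zero split: nat.split)
    moreover have "monom u 1 \<in> ?R" if "u \<in> m" for u
      using that ideal_zero[OF B ip] ideal_power_1[OF B m] by (simp add: coeff_monom)
    ultimately show ?thesis using U(2) by blast
  qed
  ultimately have PR: "P \<subseteq> ?R" using P(4) by blast
  \<comment> \<open>Conversely \<open>P\<close> contains \<open>u X\<^sup>l\<close> for all \<open>u\<close> in the \<open>l\<close>-th power of \<open>m\<close>, so it is the Rees algebra.\<close>
  have monom_m: "monom u 1 \<in> P" if "u \<in> m" for u
  proof -
    have "rspan B U \<subseteq> {u. monom u 1 \<in> P}"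
    proof (rule rspan_least)
      fix s t assume "s \<in> B" "t \<in> U"
      then have "const s * monom t 1 \<in> P" using P(3) by (blast intro: subring_mult[OF P(1)])
      then show "s * t \<in> {u. monom u 1 \<in> P}" by (simp add: const_def smult_monom)
    qed (auto simp: add_monom[symmetric] intro: subring_zero[OF P(1)] subring_add[OF P(1)])
    then show ?thesis using U that by blast
  qed
  have monom_P: "monom u l \<in> P" if "u \<in> ideal_power B m l" for u l
    using that
  proof (induction l arbitrary: u)
    case 0
    then show ?case using P(3) by (auto simp: monom_0 const_def)
  next
    case (Suc l)
    have "rspan m (ideal_power B m l) \<subseteq> {u. monom u (Suc l) \<in> P}"
    proof (rule rspan_least)
      fix s t assume "s \<in> m" "t \<in> ideal_power B m l"
      then have "monom s 1 * monom t l \<in> P" using monom_m Suc by (auto intro: subring_mult[OF P(1)])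
      then show "s * t \<in> {u. monom u (Suc l) \<in> P}" by (simp add: mult_monom)
    qed (auto simp: add_monom[symmetric] intro: subring_zero[OF P(1)] subring_add[OF P(1)])
    then show ?case using Suc by auto
  qed
  obtain n where n: "range (\<lambda>l. monom f (Suc l)) \<subseteq> rspan P ((\<lambda>l. monom f (Suc l)) ` {..<n})"
    using noetherian_sequence[OF P(2), of "\<lambda>l. monom f (Suc l)"] monom_P f by auto
  have "rspan P ((\<lambda>l. monom f (Suc l)) ` {..<n}) \<subseteq> {p. \<exists>e\<in>m. coeff p (Suc n) = e * f}"
  proof (rule rspan_least)
    fix p q assume "p \<in> {p. \<exists>e\<in>m. coeff p (Suc n) = e * f}" "q \<in> {p. \<exists>e\<in>m. coeff p (Suc n) = e * f}"
    then show "p + q \<in> {p. \<exists>e\<in>m. coeff p (Suc n) = e * f}"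
      by (auto simp flip: distrib_right intro!: bexI ideal_add[OF B m])
  next
    fix s t assume s: "s \<in> P" "t \<in> (\<lambda>l. monom f (Suc l)) ` {..<n}"
    then obtain l where l: "l < n" "t = monom f (Suc l)" by auto
    have "coeff (s * t) (Suc n) = coeff s (n - l) * f"
      using l by (simp add: mult.commute[of s] coeff_monom_mult)
    moreover have "coeff s (n - l) \<in> m"
      using PR s l ideal_power_mono[OF B m, of 1 "n - l"] ideal_power_1[OF B m] by fastforce
    ultimately show "s * t \<in> {p. \<exists>e\<in>m. coeff p (Suc n) = e * f}" by auto
  qed (auto intro!: bexI[of _ 0] ideal_zero[OF B m])
  moreover have "monom f (Suc n) \<in> rspan P ((\<lambda>l. monom f (Suc l)) ` {..<n})" using n by blast
  ultimately have "\<exists>e\<in>m. coeff (monom f (Suc n)) (Suc n) = e * f" by blast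
  then show ?thesis by simp
qed

section \<open>Nakayama's lemma\<close>

text \<open>
  Gaussian elimination: a relation \<open>g = s g + y\<close> with \<open>s \<in> I\<close> and \<open>y\<close> in the
  span of the other generators becomes \<open>(1 - s) g = y\<close>, and after multiplication by \<open>1 - s\<close> the
  relations for the other generators no longer involve \<open>g\<close>.
\<close>

lemma nakayama:
  fixes R I :: "'r::comm_ring_1 set"
  assumes R: "is_subring R" and I: "is_ideal R I"
    and "finite G" "\<And>g. g \<in> G \<Longrightarrow> g \<in> rspan I G"
  shows "\<exists>r\<in>I. \<forall>g\<in>G. (1 - r) * g = 0"
  using assms(3,4)
proof (induction G rule: finite_induct)
  case empty
  then show ?case using ideal_zero[OF R I] by auto
next
  case (insert g G)
  have split: "\<exists>s\<in>I. \<exists>y\<in>rspan I G. x = s * g + y" if "x \<in> rspan I (insert g G)" for x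
    using rspan_insert[OF ideal_zero[OF R I] ideal_add[OF R I] that] by metis
  obtain s y where s: "s \<in> I" "y \<in> rspan I G" "g = s * g + y" using split insert.prems by blast
  then have g: "(1 - s) * g = y" by (simp add: algebra_simps)
  have sR: "1 - s \<in> R" using s ideal_subset[OF R I] by (auto intro: subring_diff[OF R] subring_one[OF R])
  have "h \<in> rspan I G" if "h \<in> G" for h
  proof -
    obtain a z where a: "a \<in> I" "z \<in> rspan I G" "h = a * g + z" using split insert.prems \<open>h \<in> G\<close> by blast
    have "h = s * h + (1 - s) * h" by (simp add: algebra_simps)
    also have "(1 - s) * h = a * ((1 - s) * g) + (1 - s) * z" by (simp add: a(3) algebra_simps)
    also have "\<dots> = a * y + (1 - s) * z" by (simp only: g)
    finally have h: "h = s * h + (a * y + (1 - s) * z)" .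
    have "s * h \<in> rspan I G" using s that by (auto intro: rspan_gen)
    moreover have "a * y \<in> rspan I G" "(1 - s) * z \<in> rspan I G"
      using rspan_scale[OF _ s(2), of a I] rspan_scale[OF _ a(2), of "1 - s" I]
        s(1) a(1) sR ideal_mult[OF R I] ideal_subset[OF R I] by auto
    ultimately show ?thesis using h by (metis rspan_add)
  qed
  then obtain r where r: "r \<in> I" "\<forall>g\<in>G. (1 - r) * g = 0" using insert.IH by blast
  have ry: "(1 - r) * y = 0"
    using s(2)
  proof induction
    case (add s t x)
    have "(1 - r) * (s * t + x) = s * ((1 - r) * t) + (1 - r) * x" by (simp add: algebra_simps)
    then show ?case using add r by simp
  qed simp
  \<comment> \<open>Chosen so that \<open>1 - ?r = (1 - r) (1 - s)\<close>.\<close>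
  let ?r = "r + s - r * s"
  have e: "1 - ?r = (1 - r) * (1 - s)" by (simp add: algebra_simps)
  have "?r \<in> I" using r s ideal_subset[OF R I]
    by (auto intro!: ideal_diff[OF R I] ideal_add[OF R I] ideal_mult[OF R I])
  moreover have "(1 - ?r) * g = 0"
    using g ry unfolding e by (simp add: mult.assoc)
  moreover have "(1 - ?r) * h = 0" if "h \<in> G" for h
    using r that unfolding e by (metis mult.commute mult.left_commute mult_zero_right)
  ultimately show ?case by blast
qed

section \<open>Points of affine algebras\<close>

definition constants :: "('a \<Rightarrow> 'k) set" where
  "constants = range (\<lambda>c _. c)"

lemma constants_iff: "f \<in> constants \<longleftrightarrow> (\<exists>c. f = (\<lambda>_. c))"
  by (auto simp: constants_def)

lemma constants_subset_member: "constants \<subseteq> B \<Longrightarrow> (\<lambda>_. c) \<in> B"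
  by (auto simp: constants_def)

lemma is_subring_constants: "is_subring (constants :: ('a \<Rightarrow> 'k::comm_ring_1) set)"
  by (auto simp: is_subring_def constants_iff fun_eq_iff)

lemma noetherian_constants: "noetherian (constants :: ('a \<Rightarrow> 'k::field) set)"
proof (rule field_noetherian[OF is_subring_constants])
  fix c :: "'a \<Rightarrow> 'k" assume "c \<in> constants" "c \<noteq> 0"
  then obtain d where "c = (\<lambda>_. d)" "d \<noteq> 0" by (auto simp: constants_iff fun_eq_iff)
  then show "\<exists>d\<in>constants. d * c = 1"
    by (intro bexI[of _ "\<lambda>_. inverse d"]) (auto simp: constants_iff fun_eq_iff)
qed

lemma power_fun_apply: "(f ^ n) x = f x ^ n" for f :: "'a \<Rightarrow> 'k::comm_ring_1"
  by (induction n) auto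

lemma sum_fun_apply: "(\<Sum>i\<in>A. f i) x = (\<Sum>i\<in>A. f i x)" for f :: "'i \<Rightarrow> 'a \<Rightarrow> 'k::comm_ring_1"
  by (induction A rule: infinite_finite_induct) auto

lemma sum_list_fun_apply: "(\<Sum>i\<leftarrow>xs. f i) x = (\<Sum>i\<leftarrow>xs. f i x)" for f :: "'i \<Rightarrow> 'a \<Rightarrow> 'k::comm_ring_1"
  by (induction xs) auto

lemma subring_sum_list: "is_subring S \<Longrightarrow> (\<And>i. i \<in> set xs \<Longrightarrow> f i \<in> S) \<Longrightarrow> (\<Sum>i\<leftarrow>xs. f i) \<in> S"
  by (induction xs) (auto intro: subring_zero subring_add)

lemma fun_scale_vector_space: "vector_space (\<lambda>(c::'k::field) (f::'a \<Rightarrow> 'k) x. c * f x)"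
  by unfold_locales (auto simp: fun_eq_iff algebra_simps)

text \<open>
  \<open>B / I\<close> has dimension at most \<open>card G\<close>, so the first \<open>card G + 1\<close> powers of \<open>b\<close> are linearly dependent
  in it.
\<close>

lemma dependent_modulo_ideal:
  fixes b :: "'a \<Rightarrow> 'k::field"
  assumes B: "is_subring B" "constants \<subseteq> B" and I: "is_ideal B I" and G: "finite G"
    and b: "b \<in> B" and span: "\<And>c. c \<in> B \<Longrightarrow> \<exists>v\<in>rspan constants G. c - v \<in> I"
  shows "\<exists>p. p \<noteq> 0 \<and> (\<lambda>x. poly p (b x)) \<in> I"
proof -
  interpret V: vector_space "\<lambda>(c::'k) (f::'a \<Rightarrow> 'k) x. c * f x" by (rule fun_scale_vector_space)
  have span_sub: "rspan constants G \<subseteq> V.span G"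
  proof (rule rspan_least)
    fix s t :: "'a \<Rightarrow> 'k" assume "s \<in> constants" "t \<in> G"
    then obtain c where c: "s = (\<lambda>_. c)" by (auto simp: constants_iff)
    have "(\<lambda>x. c * t x) \<in> V.span G" using \<open>t \<in> G\<close> by (intro V.span_scale V.span_base)
    then show "s * t \<in> V.span G" by (simp add: c times_fun_def)
  qed (auto intro: V.span_zero V.span_add)
  let ?n = "card G"
  have "\<forall>i. \<exists>v\<in>rspan constants G. b ^ i - v \<in> I" using span subring_power[OF B(1) b] by blast
  then obtain v where v: "\<And>i. v i \<in> rspan constants G" "\<And>i. b ^ i - v i \<in> I" by metis
  show ?thesis
  proof (cases "inj_on v {..?n}")
    case False
    then obtain i j where ij: "i \<noteq> j" "v i = v j" by (auto simp: inj_on_def)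
    have "(b ^ i - v i) - (b ^ j - v j) \<in> I" by (rule ideal_diff[OF B(1) I v(2) v(2)])
    then have "(\<lambda>x. poly (monom 1 i - monom 1 j) (b x)) \<in> I"
      using ij by (simp add: poly_monom fun_diff_def power_fun_apply)
    moreover have "coeff (monom 1 i - monom 1 j) i \<noteq> (0::'k)" using ij by (simp add: coeff_monom)
    ultimately show ?thesis by (metis coeff_0)
  next
    case inj: True
    have "V.dependent (v ` {..?n})"
    proof (rule ccontr)
      assume "\<not> V.dependent (v ` {..?n})"
      then have "card (v ` {..?n}) \<le> card G"
        using V.independent_span_bound[OF G] v(1) span_sub by blast
      then show False using card_image[OF inj] by simp
    qed
    then obtain u where u: "\<exists>w\<in>v ` {..?n}. u w \<noteq> 0" "(\<Sum>w\<in>v ` {..?n}. (\<lambda>x. u w * w x)) = 0"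
      using V.dependent_finite[of "v ` {..?n}"] by auto
    define p where "p = (\<Sum>i\<le>?n. monom (u (v i)) i)"
    have z: "(\<Sum>i\<le>?n. u (v i) * v i x) = 0" for x
    proof -
      have "0 = (\<Sum>w\<in>v ` {..?n}. u w * w x)" using fun_cong[OF u(2), of x] by (simp add: sum_fun_apply)
      also have "\<dots> = (\<Sum>i\<le>?n. u (v i) * v i x)" using sum.reindex[OF inj] by simp
      finally show ?thesis by simp
    qed
    have "(\<lambda>x. poly p (b x)) = (\<Sum>i\<le>?n. (\<lambda>_. u (v i)) * (b ^ i - v i))"
    proof
      fix x
      show "poly p (b x) = (\<Sum>i\<le>?n. (\<lambda>_. u (v i)) * (b ^ i - v i)) x"
        using z[of x] by (simp add: p_def poly_sum poly_monom sum_fun_apply power_fun_apply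
            right_diff_distrib sum_subtractf)
    qed
    moreover have "(\<Sum>i\<le>?n. (\<lambda>_. u (v i)) * (b ^ i - v i)) \<in> I"
      by (intro ideal_sum[OF B(1) I] ideal_mult[OF B(1) I] constants_subset_member[OF B(2)] v(2))
    moreover obtain i where i: "i \<le> ?n" "u (v i) \<noteq> 0" using u(1) by auto
    have "coeff p i = u (v i)" using i(1) by (simp add: p_def coeff_sum coeff_monom sum.delta)
    then have "p \<noteq> 0" using i(2) by auto
    ultimately show ?thesis by metis
  qed
qed

lemma maximal_ideal_exists:
  fixes B :: "'r::comm_ring_1 set"
  assumes B: "is_subring B" and I: "is_ideal B I" "1 \<notin> I"
  obtains P where "is_ideal B P" "I \<subseteq> P" "1 \<notin> P"
    "\<And>P'. is_ideal B P' \<Longrightarrow> P \<subseteq> P' \<Longrightarrow> 1 \<notin> P' \<Longrightarrow> P' = P"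
proof -
  let ?S = "{P. is_ideal B P \<and> I \<subseteq> P \<and> 1 \<notin> P}"
  have "\<exists>P\<in>?S. \<forall>X\<in>?S. P \<subseteq> X \<longrightarrow> X = P"
  proof (rule subset_Zorn_nonempty)
    show "?S \<noteq> {}" using I by auto
  next
    fix C assume C: "C \<noteq> {}" "subset.chain ?S C"
    have sub: "\<And>P. P \<in> C \<Longrightarrow> is_ideal B P \<and> I \<subseteq> P \<and> 1 \<notin> P"
      and tot: "\<And>P Q. P \<in> C \<Longrightarrow> Q \<in> C \<Longrightarrow> P \<subseteq> Q \<or> Q \<subseteq> P"
      using C(2) unfolding subset_chain_def by blast+
    have "is_ideal B (\<Union>C)"
      unfolding is_ideal_def
    proof (intro conjI ballI)
      fix x y assume "x \<in> \<Union>C" "y \<in> \<Union>C"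
      then obtain P where "P \<in> C" "x \<in> P" "y \<in> P" using tot by blast
      then show "x + y \<in> \<Union>C" using sub unfolding is_ideal_def by blast
    qed (use sub C(1) in \<open>unfold is_ideal_def, blast+\<close>)
    then show "\<Union>C \<in> ?S" using sub C(1) by blast
  qed
  then obtain P where "P \<in> ?S" "\<forall>X\<in>?S. P \<subseteq> X \<longrightarrow> X = P" by blast
  then show thesis using that[of P] by blast
qed

lemma maximal_ideal_prime:
  fixes B :: "'r::comm_ring_1 set"
  assumes B: "is_subring B" and P: "is_ideal B P"
    and max: "\<And>P'. is_ideal B P' \<Longrightarrow> P \<subseteq> P' \<Longrightarrow> 1 \<notin> P' \<Longrightarrow> P' = P"
    and uv: "u \<in> B" "v \<in> B" "u * v \<in> P" "u \<notin> P"
  shows "v \<in> P"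
proof -
  define P' where "P' = {p + b * u |p b. p \<in> P \<and> b \<in> B}"
  have P': "is_ideal B P'"
    unfolding is_ideal_def
  proof (intro conjI ballI)
    show "P' \<subseteq> B"
      unfolding P'_def using uv ideal_subset[OF B P] by (auto intro!: subring_add[OF B] subring_mult[OF B])
    show "0 \<in> P'"
      unfolding P'_def using ideal_zero[OF B P] subring_zero[OF B] by force
  next
    fix x y assume "x \<in> P'" "y \<in> P'"
    then obtain p b p' b' where e: "x = p + b * u" "y = p' + b' * u" "p \<in> P" "b \<in> B" "p' \<in> P" "b' \<in> B"
      unfolding P'_def by blast
    have "x + y = (p + p') + (b + b') * u" by (simp add: e algebra_simps)
    then show "x + y \<in> P'"
      unfolding P'_def using e ideal_add[OF B P] subring_add[OF B] by blast
  next
    fix s x assume s: "s \<in> B" "x \<in> P'"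
    then obtain p b where e: "x = p + b * u" "p \<in> P" "b \<in> B" unfolding P'_def by blast
    have "s * x = s * p + (s * b) * u" by (simp add: e algebra_simps)
    then show "s * x \<in> P'"
      unfolding P'_def using e s ideal_mult[OF B P] subring_mult[OF B] by blast
  qed
  have "P \<subseteq> P'"
  proof
    fix p assume "p \<in> P"
    moreover have "p = p + 0 * u" by simp
    ultimately show "p \<in> P'" unfolding P'_def using subring_zero[OF B] by blast
  qed
  moreover have "u \<in> P'"
  proof -
    have "u = 0 + 1 * u" by simp
    then show ?thesis unfolding P'_def using subring_one[OF B] ideal_zero[OF B P] by blast
  qed
  ultimately have "1 \<in> P'" using max[OF P'] uv(4) by blast
  then obtain p b where e: "1 = p + b * u" "p \<in> P" "b \<in> B" unfolding P'_def by blast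
  have "v = v * (p + b * u)" by (simp flip: e(1))
  also have "\<dots> = v * p + b * (u * v)" by (simp add: algebra_simps)
  also have "\<dots> \<in> P"
    by (rule ideal_add[OF B P ideal_mult[OF B P uv(2) e(2)] ideal_mult[OF B P e(3) uv(3)]])
  finally show ?thesis .
qed

text \<open>
  Let \<open>P\<close> be a maximal ideal containing \<open>I\<close>. Every \<open>b \<in> B\<close> satisfies a nonzero polynomial modulo \<open>P\<close>; it
  splits into linear factors over \<open>'k\<close>, and \<open>P\<close> is prime, so \<open>b\<close> is congruent to a constant. Sending
  \<open>b\<close> to that constant is the homomorphism.
\<close>

lemma homomorphism_modulo_ideal:
  fixes B :: "('a \<Rightarrow> 'k::alg_closed_field) set"
  assumes B: "is_subring B" "constants \<subseteq> B" and I: "is_ideal B I" "1 \<notin> I" and G: "finite G"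
    and span: "\<And>c. c \<in> B \<Longrightarrow> \<exists>v\<in>rspan constants G. c - v \<in> I"
  shows "\<exists>\<phi>. (\<forall>c. \<phi> (\<lambda>_. c) = c) \<and>
    (\<forall>f\<in>B. \<forall>g\<in>B. \<phi> (f + g) = \<phi> f + \<phi> g \<and> \<phi> (f * g) = \<phi> f * \<phi> g) \<and> (\<forall>f\<in>I. \<phi> f = 0)"
proof -
  obtain P where P: "is_ideal B P" "I \<subseteq> P" "1 \<notin> P"
    and max: "\<And>P'. is_ideal B P' \<Longrightarrow> P \<subseteq> P' \<Longrightarrow> 1 \<notin> P' \<Longrightarrow> P' = P"
    using maximal_ideal_exists[OF B(1) I] by metis
  note cB = constants_subset_member[OF B(2)]
  have no_const: "c = 0" if "(\<lambda>_. c) \<in> P" for c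
  proof (rule ccontr)
    assume "c \<noteq> 0"
    have "(\<lambda>_. inverse c) * (\<lambda>_. c) \<in> P" by (rule ideal_mult[OF B(1) P(1) cB that])
    moreover have "(\<lambda>_. inverse c) * (\<lambda>_. c) = (1 :: 'a \<Rightarrow> 'k)" using \<open>c \<noteq> 0\<close> by (simp add: fun_eq_iff)
    ultimately show False using P(3) by simp
  qed
  have polyB: "(\<lambda>x. poly p (b x)) \<in> B" if "b \<in> B" for p b
  proof (induction p)
    case 0
    then show ?case using cB[of 0] by simp
  next
    case (pCons c p)
    have "(\<lambda>x. poly (pCons c p) (b x)) = (\<lambda>_. c) + b * (\<lambda>x. poly p (b x))" by (simp add: fun_eq_iff)
    then show ?case using pCons that cB by (auto intro: subring_add[OF B(1)] subring_mult[OF B(1)])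
  qed
  have root: "\<exists>c. b - (\<lambda>_. c) \<in> P" if b: "b \<in> B" and p: "p \<noteq> 0" "(\<lambda>x. poly p (b x)) \<in> P" for b p
    using p
  proof (induction "degree p" arbitrary: p)
    case 0
    then obtain c where "p = [:c:]" by (metis degree_eq_zeroE)
    then show ?case using 0 no_const[of c] by auto
  next
    case (Suc n)
    then obtain c where "poly p c = 0" using alg_closed_imp_poly_has_root[of p] by auto
    then obtain p' where p': "p = [:- c, 1:] * p'" by (auto simp: poly_eq_0_iff_dvd elim: dvdE)
    have "p' \<noteq> 0" using Suc p' by auto
    then have "degree p = 1 + degree p'" unfolding p' by (subst degree_mult_eq) auto
    moreover have "(b - (\<lambda>_. c)) * (\<lambda>x. poly p' (b x)) \<in> P"
    proof -
      have "(\<lambda>x. poly p (b x)) = (b - (\<lambda>_. c)) * (\<lambda>x. poly p' (b x))"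
        by (simp add: p' fun_eq_iff algebra_simps)
      then show ?thesis using Suc(4) by simp
    qed
    then have "b - (\<lambda>_. c) \<in> P \<or> (\<lambda>x. poly p' (b x)) \<in> P"
      using maximal_ideal_prime[OF B(1) P(1) max _ polyB[OF b]] subring_diff[OF B(1) b cB] by blast
    ultimately show ?case using Suc(1)[of p'] Suc(2) \<open>p' \<noteq> 0\<close> by auto
  qed
  have ex: "\<exists>c. b - (\<lambda>_. c) \<in> P" if "b \<in> B" for b
    using dependent_modulo_ideal[OF B I(1) G that span] root[OF that] P(2) by blast
  have unique: "c = d" if "b - (\<lambda>_. c) \<in> P" "b - (\<lambda>_. d) \<in> P" for b c d
  proof -
    have "(b - (\<lambda>_. d)) - (b - (\<lambda>_. c)) \<in> P" by (rule ideal_diff[OF B(1) P(1) that(2,1)])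
    moreover have "(b - (\<lambda>_. d)) - (b - (\<lambda>_. c)) = (\<lambda>_. c - d)" by (simp add: fun_eq_iff)
    ultimately show ?thesis using no_const[of "c - d"] by simp
  qed
  define \<phi> where "\<phi> b = (THE c. b - (\<lambda>_. c) \<in> P)" for b
  have \<phi>: "\<phi> b = c" if "b - (\<lambda>_. c) \<in> P" for b c
    unfolding \<phi>_def using that unique by blast
  have \<phi>P: "b - (\<lambda>_. \<phi> b) \<in> P" if "b \<in> B" for b
    using ex[OF that] \<phi> by blast
  show ?thesis
  proof (intro exI[of _ \<phi>] conjI allI ballI)
    show "\<phi> (\<lambda>_. c) = c" for c
      by (rule \<phi>) (use ideal_zero[OF B(1) P(1)] in \<open>simp add: zero_fun_def\<close>)
    show "\<phi> f = 0" if "f \<in> I" for f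
      by (rule \<phi>) (use that P(2) in \<open>auto simp flip: zero_fun_def\<close>)
  next
    fix f g assume fg: "f \<in> B" "g \<in> B"
    have "(f - (\<lambda>_. \<phi> f)) + (g - (\<lambda>_. \<phi> g)) \<in> P"
      using \<phi>P fg by (intro ideal_add[OF B(1) P(1)])
    moreover have "(f - (\<lambda>_. \<phi> f)) + (g - (\<lambda>_. \<phi> g)) = f + g - (\<lambda>_. \<phi> f + \<phi> g)"
      by (simp add: fun_eq_iff algebra_simps)
    moreover have "g * (f - (\<lambda>_. \<phi> f)) + (\<lambda>_. \<phi> f) * (g - (\<lambda>_. \<phi> g)) \<in> P"
      using \<phi>P fg cB by (intro ideal_add[OF B(1) P(1)] ideal_mult[OF B(1) P(1)])
    moreover have "g * (f - (\<lambda>_. \<phi> f)) + (\<lambda>_. \<phi> f) * (g - (\<lambda>_. \<phi> g)) = f * g - (\<lambda>_. \<phi> f * \<phi> g)"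
      by (simp add: fun_eq_iff algebra_simps)
    ultimately show "\<phi> (f + g) = \<phi> f + \<phi> g" "\<phi> (f * g) = \<phi> f * \<phi> g"
      using \<phi> by metis+
  qed
qed

section \<open>Affine groups\<close>

text \<open>
  A linear algebraic group \<open>H\<close> with coordinate ring \<open>B\<close>. Regular functions on \<open>H\<close> are extended to the
  whole type by composition with a retraction onto \<open>H\<close>: then they form a subring of the ring of all
  functions, with its zero and its one, and two of them are equal if they agree on \<open>H\<close>. The last
  assumption identifies the points of \<open>H\<close> with the characters of \<open>B\<close>.
\<close>

locale affine_group = group H for H :: "('a, 'm) monoid_scheme" (structure) +
  fixes B :: "('a \<Rightarrow> 'k::alg_closed_field) set" and retract :: "'a \<Rightarrow> 'a"
  assumes retract_def: "retract = (\<lambda>x. if x \<in> carrier H then x else \<one>)"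
    and regular_retract: "b \<in> B \<Longrightarrow> b (retract x) = b x"
    and regular_subring: "is_subring B"
    and regular_constants: "constants \<subseteq> B"
    and regular_generated: "\<exists>T. finite T \<and> T \<subseteq> B \<and> (\<forall>X. is_subring X \<longrightarrow> constants \<union> T \<subseteq> X \<longrightarrow> B \<subseteq> X)"
    and regular_mult: "b \<in> B \<Longrightarrow> \<exists>ps. set ps \<subseteq> B \<times> B \<and>
          (\<forall>x\<in>carrier H. \<forall>y\<in>carrier H. b (x \<otimes> y) = (\<Sum>p\<leftarrow>ps. fst p x * snd p y))"
    and regular_inv: "b \<in> B \<Longrightarrow> (\<lambda>x. b (inv (retract x))) \<in> B"
    and regular_points: "(\<And>c. \<phi> (\<lambda>_. c) = c) \<Longrightarrow>
          (\<And>f g. f \<in> B \<Longrightarrow> g \<in> B \<Longrightarrow> \<phi> (f + g) = \<phi> f + \<phi> g \<and> \<phi> (f * g) = \<phi> f * \<phi> g) \<Longrightarrow>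
          \<exists>!x. x \<in> carrier H \<and> (\<forall>f\<in>B. \<phi> f = f x)"
begin

lemma retract_closed [simp]: "retract x \<in> carrier H"
  and retract_id [simp]: "x \<in> carrier H \<Longrightarrow> retract x = x"
  by (auto simp: retract_def)

lemmas regular_const = constants_subset_member[OF regular_constants]

lemma regular_separate:
  assumes "x \<in> carrier H" "y \<in> carrier H" "\<And>b. b \<in> B \<Longrightarrow> b x = b y"
  shows "x = y"
  using regular_points[of "\<lambda>f. f x"] assms by auto

text \<open>
  Asking for \<open>b \<circ> \<mu> \<in> B\<close> makes \<open>\<mu>\<close> factor through the retraction, since regular functions separate
  points; so the identity morphism of \<open>H\<close> is represented by \<open>retract\<close>, and morphisms compose as
  functions.
\<close>

definition regular_map :: "('a \<Rightarrow> 'a) \<Rightarrow> bool" where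
  "regular_map \<mu> \<longleftrightarrow> (\<forall>x. \<mu> x \<in> carrier H) \<and> (\<forall>b\<in>B. b \<circ> \<mu> \<in> B)"

lemma regular_map_closed: "regular_map \<mu> \<Longrightarrow> \<mu> x \<in> carrier H"
  and regular_map_pullback: "regular_map \<mu> \<Longrightarrow> b \<in> B \<Longrightarrow> b \<circ> \<mu> \<in> B"
  by (auto simp: regular_map_def)

lemma regular_map_retract: "regular_map retract"
  unfolding regular_map_def
proof (intro conjI allI ballI)
  fix b assume "b \<in> B"
  then have "b \<circ> retract = b" by (simp add: fun_eq_iff regular_retract)
  then show "b \<circ> retract \<in> B" using \<open>b \<in> B\<close> by simp
qed simp

lemma regular_map_const: "a \<in> carrier H \<Longrightarrow> regular_map (\<lambda>_. a)"
  by (auto simp: regular_map_def comp_def regular_const)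

lemma regular_map_comp: "regular_map \<mu> \<Longrightarrow> regular_map \<nu> \<Longrightarrow> regular_map (\<mu> \<circ> \<nu>)"
  by (auto simp: regular_map_def comp_assoc[symmetric])

lemma regular_map_mult:
  assumes "regular_map \<mu>" "regular_map \<nu>"
  shows "regular_map (\<lambda>x. \<mu> x \<otimes> \<nu> x)"
  unfolding regular_map_def
proof (intro conjI allI ballI)
  fix b assume "b \<in> B"
  then obtain ps where ps: "set ps \<subseteq> B \<times> B"
    "\<forall>x\<in>carrier H. \<forall>y\<in>carrier H. b (x \<otimes> y) = (\<Sum>p\<leftarrow>ps. fst p x * snd p y)"
    using regular_mult[OF \<open>b \<in> B\<close>] by blast
  have "b \<circ> (\<lambda>x. \<mu> x \<otimes> \<nu> x) = (\<Sum>p\<leftarrow>ps. (fst p \<circ> \<mu>) * (snd p \<circ> \<nu>))"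
    using ps(2) assms by (simp add: fun_eq_iff regular_map_closed sum_list_fun_apply)
  also have "\<dots> \<in> B"
    using ps(1) assms
    by (intro subring_sum_list[OF regular_subring] subring_mult[OF regular_subring] regular_map_pullback)
      auto
  finally show "b \<circ> (\<lambda>x. \<mu> x \<otimes> \<nu> x) \<in> B" .
qed (use assms in \<open>simp add: regular_map_closed\<close>)

lemma regular_map_inv:
  assumes "regular_map \<mu>"
  shows "regular_map (\<lambda>x. inv (\<mu> x))"
proof -
  have "regular_map (\<lambda>x. inv (retract x))"
    using regular_inv by (auto simp: regular_map_def comp_def)
  then have "regular_map ((\<lambda>x. inv (retract x)) \<circ> \<mu>)" using assms by (rule regular_map_comp)
  then show ?thesis using assms by (simp add: comp_def regular_map_closed)
qed

lemma point_of_proper_ideal: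
  assumes "is_ideal B I" "1 \<notin> I" "finite G" "\<And>c. c \<in> B \<Longrightarrow> \<exists>v\<in>rspan constants G. c - v \<in> I"
  shows "\<exists>x\<in>carrier H. \<forall>b\<in>I. b x = 0"
proof -
  have "\<exists>\<phi>. (\<forall>c. \<phi> (\<lambda>_. c) = c) \<and>
    (\<forall>f\<in>B. \<forall>g\<in>B. \<phi> (f + g) = \<phi> f + \<phi> g \<and> \<phi> (f * g) = \<phi> f * \<phi> g) \<and> (\<forall>f\<in>I. \<phi> f = 0)"
    by (rule homomorphism_modulo_ideal[OF regular_subring regular_constants assms(1-3)]) (rule assms(4))
  then obtain \<phi> where \<phi>: "\<forall>c. \<phi> (\<lambda>_. c) = c"
    "\<forall>f\<in>B. \<forall>g\<in>B. \<phi> (f + g) = \<phi> f + \<phi> g \<and> \<phi> (f * g) = \<phi> f * \<phi> g" "\<forall>f\<in>I. \<phi> f = 0" by blast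
  have "\<exists>!x. x \<in> carrier H \<and> (\<forall>f\<in>B. \<phi> f = f x)"
    by (rule regular_points) (use \<phi> in auto)
  then obtain x where x: "x \<in> carrier H" "\<forall>f\<in>B. \<phi> f = f x" by blast
  have "b x = 0" if "b \<in> I" for b
  proof -
    have "b \<in> B" using ideal_subset[OF regular_subring assms(1)] that by blast
    then show ?thesis using x(2) \<phi>(3) that by metis
  qed
  then show ?thesis using x(1) by blast
qed

lemma pullback_is_subring: "is_subring ((\<lambda>b. b \<circ> L) ` B)"
  unfolding is_subring_def
proof (intro conjI ballI)
  have "1 = (1 :: 'a \<Rightarrow> 'k) \<circ> L" by (simp add: fun_eq_iff)
  then show "1 \<in> (\<lambda>b. b \<circ> L) ` B" using subring_one[OF regular_subring] by blast
next
  fix f g assume "f \<in> (\<lambda>b. b \<circ> L) ` B" "g \<in> (\<lambda>b. b \<circ> L) ` B"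
  then obtain b c where bc: "b \<in> B" "c \<in> B" "f = b \<circ> L" "g = c \<circ> L" by blast
  then have "f - g = (b - c) \<circ> L" "f * g = (b * c) \<circ> L" by (simp_all add: fun_eq_iff)
  then show "f - g \<in> (\<lambda>b. b \<circ> L) ` B" "f * g \<in> (\<lambda>b. b \<circ> L) ` B"
    using bc subring_diff[OF regular_subring] subring_mult[OF regular_subring] by blast+
qed

text \<open>
  Lying over for finite morphisms. Let \<open>m\<close> be the ideal of \<open>L\<^sup>*B\<close> of pulled back functions vanishing at
  \<open>y\<close>. If \<open>m\<close> generated the unit ideal of \<open>B\<close>, then Nakayama's lemma would give \<open>1 \<in> m\<close>, that is,
  \<open>b \<circ> L = 1\<close> with \<open>b y = 0\<close>, and \<open>1 - b\<close> would contradict the hypothesis on \<open>y\<close>. So \<open>m B\<close> is a proper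
  ideal of finite codimension, and it has a zero, which \<open>L\<close> maps to \<open>y\<close>.
\<close>

lemma finite_image_closed:
  assumes L: "regular_map L" and G: "finite G" "G \<subseteq> B"
    and span: "B \<subseteq> rspan ((\<lambda>b. b \<circ> L) ` B) G"
    and y: "y \<in> carrier H" "\<And>b. b \<in> B \<Longrightarrow> b \<circ> L = 0 \<Longrightarrow> b y = 0"
  shows "\<exists>x\<in>carrier H. L x = y"
proof -
  note B = regular_subring
  define R where "R = (\<lambda>b. b \<circ> L) ` B"
  define m where "m = (\<lambda>b. b \<circ> L) ` {b\<in>B. b y = 0}"
  have op: "(b + c) \<circ> L = (b \<circ> L) + (c \<circ> L)" "(b * c) \<circ> L = (b \<circ> L) * (c \<circ> L)" for b c :: "'a \<Rightarrow> 'k" by (simp_all add: fun_eq_iff)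
  have RB: "R \<subseteq> B" unfolding R_def using L by (auto intro: regular_map_pullback)
  have R: "is_subring R" unfolding R_def by (rule pullback_is_subring)
  have m: "is_ideal R m"
    unfolding is_ideal_def
  proof (intro conjI ballI)
    show "m \<subseteq> R" by (auto simp: m_def R_def)
    have "(0 :: 'a \<Rightarrow> 'k) = 0 \<circ> L" by (simp add: fun_eq_iff)
    then show "0 \<in> m" unfolding m_def using subring_zero[OF B] by force
  next
    fix f g assume "f \<in> m" "g \<in> m"
    then obtain b c where bc: "b \<in> B" "c \<in> B" "f = b \<circ> L" "g = c \<circ> L" "b y = 0" "c y = 0" by (auto simp: m_def)
    then have "b + c \<in> {b \<in> B. b y = 0}" by (auto intro: subring_add[OF B])
    then show "f + g \<in> m" unfolding m_def bc(3,4) op(1)[symmetric] by (rule imageI)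
  next
    fix f g assume "f \<in> R" "g \<in> m"
    then obtain b c where bc: "b \<in> B" "c \<in> B" "f = b \<circ> L" "g = c \<circ> L" "c y = 0" by (auto simp: m_def R_def)
    then have "b * c \<in> {b \<in> B. b y = 0}" by (auto intro: subring_mult[OF B])
    then show "f * g \<in> m" unfolding m_def bc(3,4) op(2)[symmetric] by (rule imageI)
  qed
  have mB: "m \<subseteq> B" using m RB by (auto simp: is_ideal_def)
  let ?I = "rspan B m"
  have I: "is_ideal B ?I" by (rule rspan_is_ideal[OF B mB])
  have "1 \<notin> ?I"
  proof
    assume one: "1 \<in> ?I"
    have "g \<in> rspan m G" if "g \<in> G" for g
    proof -
      have "rspan B m \<subseteq> {h. h * g \<in> rspan m G}"
      proof (rule rspan_least)
        fix s t assume st: "s \<in> B" "t \<in> m"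
        have "s * g \<in> rspan R G" using span st \<open>g \<in> G\<close> G(2) subring_mult[OF B] by (auto simp: R_def)
        moreover have "t * r \<in> m" if "r \<in> R" for r
          using ideal_mult[OF R m that st(2)] by (simp add: mult.commute)
        ultimately have "t * (s * g) \<in> rspan m G" using rspan_scale[of R t m] by blast
        then show "s * t \<in> {h. h * g \<in> rspan m G}" by (simp add: mult_ac)
      qed (auto simp: distrib_right intro: rspan.zero rspan_add)
      then show ?thesis using one by auto
    qed
    then obtain r where r: "r \<in> m" "\<forall>g\<in>G. (1 - r) * g = 0" using nakayama[OF R m G(1)] by blast
    have "(1 - r) * h = 0" if "h \<in> rspan R G" for h
      using that
    proof induction
      case (add s t x)
      have "(1 - r) * (s * t + x) = s * ((1 - r) * t) + (1 - r) * x" by (simp add: algebra_simps)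
      moreover have "(1 - r) * t = 0" using r add(2) by blast
      ultimately show ?case using add.IH by (simp only: mult_zero_right add_0)
    qed simp
    moreover have "1 \<in> rspan R G" using span subring_one[OF B] unfolding R_def by blast
    ultimately have "(1 - r) * 1 = 0" by blast
    then have r1: "r = 1" by simp
    obtain b where b: "b \<in> B" "r = b \<circ> L" "b y = 0" using r(1) by (auto simp: m_def)
    have "1 - b \<in> B" using b(1) by (intro subring_diff[OF B] subring_one[OF B])
    moreover have "(1 - b) \<circ> L = 0" using b(2) r1 by (simp add: fun_eq_iff)
    ultimately show False using y(2)[of "1 - b"] b(3) by simp
  qed
  moreover have "\<exists>v\<in>rspan constants G. c - v \<in> ?I" if "c \<in> B" for c
  proof -
    have "rspan R G \<subseteq> {c. \<exists>v\<in>rspan constants G. c - v \<in> ?I}"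
    proof (rule rspan_least)
      show "0 \<in> {c. \<exists>v\<in>rspan constants G. c - v \<in> ?I}"
        by (auto intro!: bexI[of _ 0] rspan.zero)
    next
      fix c d assume "c \<in> {c. \<exists>v\<in>rspan constants G. c - v \<in> ?I}" "d \<in> {c. \<exists>v\<in>rspan constants G. c - v \<in> ?I}"
      then obtain v w where vw: "v \<in> rspan constants G" "w \<in> rspan constants G" "c - v \<in> ?I" "d - w \<in> ?I" by blast
      have "c + d - (v + w) = (c - v) + (d - w)" by simp
      then have "c + d - (v + w) \<in> ?I" using vw(3,4) by (simp only: rspan_add)
      then show "c + d \<in> {c. \<exists>v\<in>rspan constants G. c - v \<in> ?I}" using rspan_add[OF vw(1,2)] by blast
    next
      fix s t assume st: "s \<in> R" "t \<in> G"
      then obtain b where b: "b \<in> B" "s = b \<circ> L" by (auto simp: R_def)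
      let ?b = "b - (\<lambda>_. b y)"
      have "?b \<in> {b \<in> B. b y = 0}" using b by (auto intro: subring_diff[OF B] regular_const)
      then have "?b \<circ> L \<in> m" unfolding m_def by (rule imageI)
      then have "t * (?b \<circ> L) \<in> ?I" using st(2) G(2) by (auto intro: rspan_gen)
      moreover have "s * t - (\<lambda>_. b y) * t = t * (?b \<circ> L)" by (simp add: b fun_eq_iff algebra_simps)
      moreover have "(\<lambda>_. b y) * t \<in> rspan constants G" using st(2) by (intro rspan_gen) (auto simp: constants_iff)
      ultimately show "s * t \<in> {c. \<exists>v\<in>rspan constants G. c - v \<in> ?I}" by (metis (mono_tags, lifting) mem_Collect_eq)
    qed
    then show ?thesis using span that by (auto simp: R_def)
  qed
  ultimately obtain x where x: "x \<in> carrier H" "\<forall>b\<in>?I. b x = 0"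
    using point_of_proper_ideal[OF I _ G(1)] by metis
  have "b (L x) = b y" if "b \<in> B" for b
  proof -
    let ?b = "b - (\<lambda>_. b y)"
    have "?b \<in> {b \<in> B. b y = 0}" using that by (auto intro: subring_diff[OF B] regular_const)
    then have "?b \<circ> L \<in> m" unfolding m_def by (rule imageI)
    then have "?b \<circ> L \<in> ?I" by (intro rspan_base subring_one[OF B])
    then have "(?b \<circ> L) x = 0" using x(2) by blast
    then show ?thesis by simp
  qed
  then have "L x = y" by (intro regular_separate regular_map_closed[OF L] y(1))
  then show ?thesis using x(1) by blast
qed

section \<open>The Lang map to first order\<close>

definition maximal_ideal_at_one :: "('a \<Rightarrow> 'k) set" (\<open>\<mm>\<close>) where
  "\<mm> = {b \<in> B. b \<one> = 0}"

abbreviation "mpow \<equiv> ideal_power B \<mm>"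

lemma maximal_ideal_at_one_is_ideal: "is_ideal B \<mm>"
  unfolding is_ideal_def maximal_ideal_at_one_def
  by (auto intro: subring_zero[OF regular_subring] subring_add[OF regular_subring] subring_mult[OF regular_subring])

lemma mult_maximal_ideal_at_one: "u \<in> \<mm> \<Longrightarrow> v \<in> \<mm> \<Longrightarrow> u * v \<in> mpow 2"
  using ideal_power_mult[OF regular_subring maximal_ideal_at_one_is_ideal, of u 1 v 1]
    ideal_power_1[OF regular_subring maximal_ideal_at_one_is_ideal] by (simp add: numeral_2_eq_2)

lemmas mpow_ideal = ideal_power_is_ideal[OF regular_subring maximal_ideal_at_one_is_ideal]
lemmas mpow_add = ideal_add[OF regular_subring mpow_ideal]
lemmas mpow_diff = ideal_diff[OF regular_subring mpow_ideal]
lemmas mpow_minus = ideal_minus[OF regular_subring mpow_ideal]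
lemmas mpow_zero = ideal_zero[OF regular_subring mpow_ideal]
lemmas mpow_mult = ideal_power_mult[OF regular_subring maximal_ideal_at_one_is_ideal]

lemma pullback_maximal_ideal_at_one:
  "regular_map \<mu> \<Longrightarrow> \<mu> \<one> = \<one> \<Longrightarrow> b \<in> \<mm> \<Longrightarrow> b \<circ> \<mu> \<in> \<mm>"
  by (auto simp: maximal_ideal_at_one_def regular_map_pullback)

text \<open>
  Modulo the square of the maximal ideal, comultiplication is additive: expand
  \<open>b (x \<otimes> y) = \<Sum>i. f\<^sub>i x * g\<^sub>i y\<close> around the identity; the linear terms are \<open>b x\<close> and \<open>b y\<close>, the constant
  term is \<open>b \<one> = 0\<close>, and the rest is a sum of products \<open>(f\<^sub>i x - f\<^sub>i \<one>) * (g\<^sub>i y - g\<^sub>i \<one>)\<close>.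
\<close>

lemma pullback_mult:
  assumes \<mu>: "regular_map \<mu>" "\<mu> \<one> = \<one>" and \<nu>: "regular_map \<nu>" "\<nu> \<one> = \<one>" and b: "b \<in> \<mm>"
  shows "(b \<circ> (\<lambda>x. \<mu> x \<otimes> \<nu> x)) - ((b \<circ> \<mu>) + (b \<circ> \<nu>)) \<in> mpow 2"
proof -
  have bB: "b \<in> B" "b \<one> = 0" using b by (auto simp: maximal_ideal_at_one_def)
  then obtain ps where ps: "set ps \<subseteq> B \<times> B"
    "\<forall>x\<in>carrier H. \<forall>y\<in>carrier H. b (x \<otimes> y) = (\<Sum>p\<leftarrow>ps. fst p x * snd p y)"
    using regular_mult[OF bB(1)] by blast
  let ?d = "\<lambda>p. ((fst p - (\<lambda>_. fst p \<one>)) \<circ> \<mu>) * ((snd p - (\<lambda>_. snd p \<one>)) \<circ> \<nu>)"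
  have "(b \<circ> (\<lambda>x. \<mu> x \<otimes> \<nu> x)) - ((b \<circ> \<mu>) + (b \<circ> \<nu>)) = (\<Sum>p\<leftarrow>ps. ?d p)"
  proof
    fix x
    have "\<mu> x \<in> carrier H" "\<nu> x \<in> carrier H" using \<mu> \<nu> by (auto simp: regular_map_closed)
    then have e: "b (\<mu> x \<otimes> \<nu> x) = (\<Sum>p\<leftarrow>ps. fst p (\<mu> x) * snd p (\<nu> x))"
      "b (\<mu> x) = (\<Sum>p\<leftarrow>ps. fst p (\<mu> x) * snd p \<one>)"
      "b (\<nu> x) = (\<Sum>p\<leftarrow>ps. fst p \<one> * snd p (\<nu> x))"
      "b \<one> = (\<Sum>p\<leftarrow>ps. fst p \<one> * snd p \<one>)"
      using ps(2)[rule_format, of "\<mu> x" "\<nu> x"] ps(2)[rule_format, of "\<mu> x" \<one>]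
        ps(2)[rule_format, of \<one> "\<nu> x"] ps(2)[rule_format, of \<one> \<one>] by simp_all
    have "b (\<mu> x \<otimes> \<nu> x) - (b (\<mu> x) + b (\<nu> x)) + b \<one> = (\<Sum>p\<leftarrow>ps. (fst p (\<mu> x) - fst p \<one>) * (snd p (\<nu> x) - snd p \<one>))"
      unfolding e by (induction ps) (simp_all add: algebra_simps)
    then show "((b \<circ> (\<lambda>x. \<mu> x \<otimes> \<nu> x)) - ((b \<circ> \<mu>) + (b \<circ> \<nu>))) x = (\<Sum>p\<leftarrow>ps. ?d p) x"
      using bB(2) by (simp add: sum_list_fun_apply)
  qed
  also have "\<dots> \<in> mpow 2"
  proof -
    have d: "?d p \<in> mpow 2" if "p \<in> set ps" for p
    proof (rule mult_maximal_ideal_at_one)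
      have "fst p \<in> B" "snd p \<in> B" using that ps(1) by auto
      then have "fst p - (\<lambda>_. fst p \<one>) \<in> \<mm>" "snd p - (\<lambda>_. snd p \<one>) \<in> \<mm>"
        by (auto simp: maximal_ideal_at_one_def intro: subring_diff[OF regular_subring] regular_const)
      then show "(fst p - (\<lambda>_. fst p \<one>)) \<circ> \<mu> \<in> \<mm>" "(snd p - (\<lambda>_. snd p \<one>)) \<circ> \<nu> \<in> \<mm>"
        using \<mu> \<nu> by (auto intro: pullback_maximal_ideal_at_one)
    qed
    have "(\<Sum>p\<leftarrow>qs. ?d p) \<in> mpow 2" if "set qs \<subseteq> set ps" for qs
      using that by (induction qs) (auto intro: mpow_zero mpow_add d)
    then show ?thesis by blast
  qed
  finally show ?thesis .
qed

lemma pullback_inv: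
  assumes \<mu>: "regular_map \<mu>" "\<mu> \<one> = \<one>" and b: "b \<in> \<mm>"
  shows "(b \<circ> (\<lambda>x. inv (\<mu> x))) + (b \<circ> \<mu>) \<in> mpow 2"
proof -
  have "(b \<circ> (\<lambda>x. \<mu> x \<otimes> inv (\<mu> x))) - ((b \<circ> \<mu>) + (b \<circ> (\<lambda>x. inv (\<mu> x)))) \<in> mpow 2"
    using \<mu> b by (intro pullback_mult) (auto intro: regular_map_inv)
  moreover have "b \<circ> (\<lambda>x. \<mu> x \<otimes> inv (\<mu> x)) = 0"
    using \<mu> b by (simp add: fun_eq_iff regular_map_closed maximal_ideal_at_one_def)
  ultimately have "- ((b \<circ> \<mu>) + (b \<circ> (\<lambda>x. inv (\<mu> x)))) \<in> mpow 2" by simp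
  from mpow_minus[OF this] show ?thesis by (simp add: add.commute)
qed

end

lemma (in group) inv_mult_cancel:
  "x \<in> carrier G \<Longrightarrow> y \<in> carrier G \<Longrightarrow> inv x \<otimes> (x \<otimes> y) = y"
  by (simp add: m_assoc[symmetric])

context affine_group
begin

definition regular_endo :: "('a \<Rightarrow> 'a) \<Rightarrow> bool" where
  "regular_endo E \<longleftrightarrow> E \<in> hom H H \<and> regular_map (E \<circ> retract)"

text \<open>
  The product \<open>y E(y) \<dots> E\<^sup>n\<^sup>-\<^sup>1(y)\<close>. Composing it with the Lang map of \<open>E\<close> gives, up to twisting by a
  constant, the Lang map of \<open>E ^ n\<close>; this reduces questions about \<open>E\<close> to its power that is a Frobenius
  morphism.
\<close>

primrec twisted_norm :: "('a \<Rightarrow> 'a) \<Rightarrow> nat \<Rightarrow> 'a \<Rightarrow> 'a" where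
  "twisted_norm E 0 y = \<one>"
| "twisted_norm E (Suc n) y = y \<otimes> E (twisted_norm E n y)"

context
  fixes E assumes E: "regular_endo E"
begin

lemma endo_closed: "x \<in> carrier H \<Longrightarrow> E x \<in> carrier H"
  and endo_mult: "x \<in> carrier H \<Longrightarrow> y \<in> carrier H \<Longrightarrow> E (x \<otimes> y) = E x \<otimes> E y"
  and endo_regular: "regular_map (E \<circ> retract)"
  using E by (auto simp: regular_endo_def hom_def)

lemma endo_one: "E \<one> = \<one>" and endo_inv: "x \<in> carrier H \<Longrightarrow> E (inv x) = inv (E x)"
proof -
  interpret group_hom H H E
    using E by unfold_locales (auto simp: regular_endo_def)
  show "E \<one> = \<one>" "x \<in> carrier H \<Longrightarrow> E (inv x) = inv (E x)" by simp_all
qed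

lemma endo_funpow_closed: "x \<in> carrier H \<Longrightarrow> (E ^^ n) x \<in> carrier H"
  by (induction n) (auto intro: endo_closed)

lemma endo_funpow: "regular_endo (E ^^ n)"
proof (induction n)
  case 0
  then show ?case using regular_map_retract by (auto simp: regular_endo_def hom_def comp_def)
next
  case (Suc n)
  have "regular_map ((E \<circ> retract) \<circ> ((E ^^ n) \<circ> retract))"
    using Suc by (intro regular_map_comp[OF endo_regular]) (simp add: regular_endo_def)
  moreover have "(E \<circ> retract) \<circ> ((E ^^ n) \<circ> retract) = (E ^^ Suc n) \<circ> retract"
    by (simp add: fun_eq_iff endo_funpow_closed)
  ultimately show ?case
    using Suc endo_closed endo_mult by (auto simp: regular_endo_def hom_def comp_def)
qed

lemma twisted_norm_closed: "y \<in> carrier H \<Longrightarrow> twisted_norm E n y \<in> carrier H"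
  by (induction n) (auto intro: endo_closed)

lemma twisted_norm_one: "twisted_norm E n \<one> = \<one>"
  by (induction n) (auto simp: endo_one)

lemma twisted_norm_regular: "regular_map (twisted_norm E n \<circ> retract)"
proof (induction n)
  case 0
  then show ?case using regular_map_const[of \<one>] by (simp add: comp_def)
next
  case (Suc n)
  have "regular_map (\<lambda>x. retract x \<otimes> ((E \<circ> retract) \<circ> (twisted_norm E n \<circ> retract)) x)"
    by (intro regular_map_mult regular_map_retract regular_map_comp endo_regular Suc)
  then show ?case by (simp add: comp_def twisted_norm_closed)
qed

text \<open>
  The product telescopes: the factor \<open>inv (E x)\<close> of each term cancels against the next one.
\<close>

lemma twisted_norm_lang:
  assumes "x \<in> carrier H" "a \<in> carrier H"
  shows "twisted_norm E n (x \<otimes> a \<otimes> inv (E x)) = x \<otimes> twisted_norm E n a \<otimes> inv ((E ^^ n) x)"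
proof (induction n)
  case 0
  then show ?case using assms by simp
next
  case (Suc n)
  have c: "E x \<in> carrier H" "E a \<in> carrier H" "twisted_norm E n a \<in> carrier H" "(E ^^ n) x \<in> carrier H"
    "E (twisted_norm E n a) \<in> carrier H" "E ((E ^^ n) x) \<in> carrier H"
    using assms by (auto intro: endo_closed twisted_norm_closed endo_funpow_closed)
  have "twisted_norm E (Suc n) (x \<otimes> a \<otimes> inv (E x))
      = x \<otimes> a \<otimes> inv (E x) \<otimes> (E x \<otimes> E (twisted_norm E n a) \<otimes> inv (E ((E ^^ n) x)))"
    using assms c by (simp add: Suc endo_mult endo_inv)
  also have "\<dots> = x \<otimes> (a \<otimes> E (twisted_norm E n a)) \<otimes> inv (E ((E ^^ n) x))"
    using assms c by (simp add: m_assoc inv_mult_cancel)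
  finally show ?case by simp
qed

lemma endo_conjugate:
  assumes "a \<in> carrier H"
  shows "regular_endo (\<lambda>x. a \<otimes> E x \<otimes> inv a)"
  unfolding regular_endo_def
proof
  show "(\<lambda>x. a \<otimes> E x \<otimes> inv a) \<in> hom H H"
  proof (rule homI)
    fix x y assume "x \<in> carrier H" "y \<in> carrier H"
    moreover from this have "E x \<in> carrier H" "E y \<in> carrier H" by (auto intro: endo_closed)
    ultimately show "a \<otimes> E (x \<otimes> y) \<otimes> inv a = a \<otimes> E x \<otimes> inv a \<otimes> (a \<otimes> E y \<otimes> inv a)"
      using assms by (simp add: endo_mult m_assoc inv_solve_left)
  qed (use assms in \<open>auto intro: endo_closed\<close>)
  have "regular_map (\<lambda>x. (\<lambda>_. a) x \<otimes> (E \<circ> retract) x \<otimes> (\<lambda>_. inv a) x)"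
    using assms by (intro regular_map_mult endo_regular regular_map_const) auto
  then show "regular_map ((\<lambda>x. a \<otimes> E x \<otimes> inv a) \<circ> retract)" by (simp add: comp_def)
qed

lemma endo_conjugate_funpow:
  assumes "a \<in> carrier H" "x \<in> carrier H"
  shows "((\<lambda>x. a \<otimes> E x \<otimes> inv a) ^^ n) x = twisted_norm E n a \<otimes> (E ^^ n) x \<otimes> inv (twisted_norm E n a)"
proof (induction n)
  case 0
  then show ?case using assms by simp
next
  case (Suc n)
  have c: "E a \<in> carrier H" "twisted_norm E n a \<in> carrier H" "(E ^^ n) x \<in> carrier H"
    "E (twisted_norm E n a) \<in> carrier H" "E ((E ^^ n) x) \<in> carrier H"
    using assms by (auto intro: endo_closed twisted_norm_closed endo_funpow_closed)
  show ?case
    using assms c by (simp add: Suc endo_mult endo_inv inv_mult_group m_assoc)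
qed

text \<open>
  On the cotangent space the norm is \<open>1 + E\<^sup>* + \<dots> + E\<^sup>*\<^sup>n\<^sup>-\<^sup>1\<close>, so its product with \<open>1 - E\<^sup>*\<close> telescopes to
  \<open>1 - E\<^sup>*\<^sup>n\<close>. Stating only the product avoids the sum.
\<close>

lemma pullback_twisted_norm:
  assumes "b \<in> \<mm>"
  shows "((b \<circ> (twisted_norm E n \<circ> retract)) - ((b \<circ> (E \<circ> retract)) \<circ> (twisted_norm E n \<circ> retract)))
     - (b - (b \<circ> ((E ^^ n) \<circ> retract))) \<in> mpow 2"
  using assms
proof (induction n arbitrary: b)
  case 0
  have "b \<circ> retract = b" using 0 by (auto simp: fun_eq_iff maximal_ideal_at_one_def regular_retract)
  moreover have "(b \<circ> (twisted_norm E 0 \<circ> retract)) = 0" "((b \<circ> (E \<circ> retract)) \<circ> (twisted_norm E 0 \<circ> retract)) = 0"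
    using 0 by (auto simp: fun_eq_iff maximal_ideal_at_one_def endo_one)
  ultimately show ?case using mpow_zero[of 2] by (simp only: funpow.simps id_comp diff_self)
next
  case (Suc n)
  let ?E = "E \<circ> retract"
  let ?N = "\<lambda>n. twisted_norm E n \<circ> retract"
  have E1: "?E \<one> = \<one>" by (simp add: endo_one)
  have N1: "?N n \<one> = \<one>" by (simp add: twisted_norm_one)
  have step: "(c \<circ> ?N (Suc n)) - (c + (c \<circ> ?E \<circ> ?N n)) \<in> mpow 2" if c: "c \<in> \<mm>" for c
  proof -
    have "(c \<circ> (\<lambda>x. retract x \<otimes> (?E \<circ> ?N n) x)) - ((c \<circ> retract) + (c \<circ> (?E \<circ> ?N n))) \<in> mpow 2"
      using c N1 E1 by (intro pullback_mult regular_map_retract regular_map_comp endo_regular twisted_norm_regular) auto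
    moreover have "c \<circ> retract = c" using c by (auto simp: fun_eq_iff maximal_ideal_at_one_def regular_retract)
    moreover have "(\<lambda>x. retract x \<otimes> (?E \<circ> ?N n) x) = ?N (Suc n)"
      by (simp add: fun_eq_iff twisted_norm_closed)
    ultimately show ?thesis by (simp only: comp_assoc)
  qed
  \<comment> \<open>The inductive step uses the hypothesis for \<open>b \<circ> E\<close>, to which the extra factor of the norm is shifted.\<close>
  define c where "c = b \<circ> ?E"
  have c: "c \<in> \<mm>" unfolding c_def using Suc.prems E1 by (intro pullback_maximal_ideal_at_one endo_regular)
  have i: "((c \<circ> ?N n) - (c \<circ> ?E \<circ> ?N n)) - (c - (c \<circ> ((E ^^ n) \<circ> retract))) \<in> mpow 2"
    by (rule Suc.IH[OF c])
  have e: "c \<circ> ((E ^^ n) \<circ> retract) = b \<circ> ((E ^^ Suc n) \<circ> retract)"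
    by (simp add: c_def fun_eq_iff endo_funpow_closed)
  have s1: "(b \<circ> ?N (Suc n)) - (b + (c \<circ> ?N n)) \<in> mpow 2" using step[OF Suc.prems] by (simp only: c_def)
  have s2: "(c \<circ> ?N (Suc n)) - (c + (c \<circ> ?E \<circ> ?N n)) \<in> mpow 2" by (rule step[OF c])
  have "((b \<circ> ?N (Suc n)) - (c \<circ> ?N (Suc n))) - (b - (c \<circ> ((E ^^ n) \<circ> retract)))
    = (((b \<circ> ?N (Suc n)) - (b + (c \<circ> ?N n))) - ((c \<circ> ?N (Suc n)) - (c + (c \<circ> ?E \<circ> ?N n))))
      + (((c \<circ> ?N n) - (c \<circ> ?E \<circ> ?N n)) - (c - (c \<circ> ((E ^^ n) \<circ> retract))))"
    by (simp only: algebra_simps)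
  also have "\<dots> \<in> mpow 2" by (intro mpow_add mpow_diff s1 s2 i)
  finally show ?case unfolding e unfolding c_def .
qed

lemma pullback_lang_norm:
  assumes b: "b \<in> \<mm>"
  shows "(b \<circ> ((\<lambda>x. retract x \<otimes> inv (E (retract x))) \<circ> (twisted_norm E n \<circ> retract)))
     - (b - (b \<circ> ((E ^^ n) \<circ> retract))) \<in> mpow 2"
proof -
  let ?E = "E \<circ> retract"
  let ?N = "twisted_norm E n \<circ> retract"
  have EN: "regular_map (?E \<circ> ?N)" "(?E \<circ> ?N) \<one> = \<one>"
    by (rule regular_map_comp[OF endo_regular twisted_norm_regular]) (simp add: twisted_norm_one endo_one)
  have N: "regular_map ?N" "?N \<one> = \<one>" using twisted_norm_regular by (auto simp: twisted_norm_one)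
  have l: "(\<lambda>x. retract x \<otimes> inv (E (retract x))) \<circ> ?N = (\<lambda>x. ?N x \<otimes> inv ((?E \<circ> ?N) x))"
    by (simp add: fun_eq_iff twisted_norm_closed)
  have 1: "(b \<circ> (\<lambda>x. ?N x \<otimes> inv ((?E \<circ> ?N) x))) - ((b \<circ> ?N) + (b \<circ> (\<lambda>x. inv ((?E \<circ> ?N) x)))) \<in> mpow 2"
    by (rule pullback_mult[OF N regular_map_inv[OF EN(1)] _ b]) (simp only: EN(2) inv_one)
  have 2: "(b \<circ> (\<lambda>x. inv ((?E \<circ> ?N) x))) + (b \<circ> (?E \<circ> ?N)) \<in> mpow 2"
    by (rule pullback_inv[OF EN b])
  have 3: "((b \<circ> ?N) - (b \<circ> (?E \<circ> ?N))) - (b - (b \<circ> ((E ^^ n) \<circ> retract))) \<in> mpow 2"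
    using pullback_twisted_norm[OF b, of n] by (simp only: comp_assoc)
  have "(b \<circ> (\<lambda>x. ?N x \<otimes> inv ((?E \<circ> ?N) x))) - (b - (b \<circ> ((E ^^ n) \<circ> retract)))
    = ((b \<circ> (\<lambda>x. ?N x \<otimes> inv ((?E \<circ> ?N) x))) - ((b \<circ> ?N) + (b \<circ> (\<lambda>x. inv ((?E \<circ> ?N) x)))))
      + ((b \<circ> (\<lambda>x. inv ((?E \<circ> ?N) x))) + (b \<circ> (?E \<circ> ?N)))
      + (((b \<circ> ?N) - (b \<circ> (?E \<circ> ?N))) - (b - (b \<circ> ((E ^^ n) \<circ> retract))))"
    by (simp only: algebra_simps)
  also have "\<dots> \<in> mpow 2" by (intro mpow_add 1 2 3)
  finally show ?thesis by (simp only: l)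
qed

end

text \<open>
  By multiplicativity, a morphism inducing the identity on the cotangent space induces the identity
  on each quotient of successive powers of the maximal ideal.
\<close>

lemma pullback_unipotent:
  assumes \<psi>: "regular_map \<psi>" "\<psi> \<one> = \<one>" and cong: "\<And>b. b \<in> \<mm> \<Longrightarrow> (b \<circ> \<psi>) - b \<in> mpow 2"
    and b: "b \<in> mpow j"
  shows "(b \<circ> \<psi>) - b \<in> mpow (Suc j)"
  using b
proof (induction j arbitrary: b)
  case 0
  then have "b \<circ> \<psi> \<in> B" "b \<in> B" using \<psi> by (auto intro: regular_map_pullback)
  then have "(b \<circ> \<psi>) - b \<in> \<mm>"
    using \<psi>(2) by (auto simp: maximal_ideal_at_one_def intro: subring_diff[OF regular_subring])
  then show ?case using ideal_power_1[OF regular_subring maximal_ideal_at_one_is_ideal] by (simp only: One_nat_def)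
next
  case (Suc j)
  have "rspan \<mm> (mpow j) \<subseteq> {b. (b \<circ> \<psi>) - b \<in> mpow (Suc (Suc j))}"
  proof (rule rspan_least)
    have "((0 :: 'a \<Rightarrow> 'k) \<circ> \<psi>) - 0 = 0" by (simp add: fun_eq_iff)
    then show "0 \<in> {b. (b \<circ> \<psi>) - b \<in> mpow (Suc (Suc j))}" using mpow_zero by (simp only: mem_Collect_eq)
  next
    fix u v assume "u \<in> {b. (b \<circ> \<psi>) - b \<in> mpow (Suc (Suc j))}" "v \<in> {b. (b \<circ> \<psi>) - b \<in> mpow (Suc (Suc j))}"
    moreover have "((u + v) \<circ> \<psi>) - (u + v) = ((u \<circ> \<psi>) - u) + ((v \<circ> \<psi>) - v)" by (simp add: fun_eq_iff)
    ultimately show "u + v \<in> {b. (b \<circ> \<psi>) - b \<in> mpow (Suc (Suc j))}"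
      using mpow_add by (simp only: mem_Collect_eq)
  next
    fix u v assume u: "u \<in> \<mm>" and v: "v \<in> mpow j"
    have v': "(v \<circ> \<psi>) - v \<in> mpow (Suc j)" by (rule Suc.IH[OF v])
    then have "(v \<circ> \<psi>) - v \<in> mpow j" using ideal_power_Suc_subset[OF regular_subring maximal_ideal_at_one_is_ideal] by blast
    from mpow_add[OF this v] have v\<psi>: "v \<circ> \<psi> \<in> mpow j" by simp
    have "((u * v) \<circ> \<psi>) - (u * v) = ((u \<circ> \<psi>) - u) * (v \<circ> \<psi>) + u * ((v \<circ> \<psi>) - v)"
      by (simp add: fun_eq_iff algebra_simps)
    also have "\<dots> \<in> mpow (Suc (Suc j))"
    proof (rule mpow_add)
      show "((u \<circ> \<psi>) - u) * (v \<circ> \<psi>) \<in> mpow (Suc (Suc j))"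
        using mpow_mult[OF cong[OF u] v\<psi>] by simp
      show "u * ((v \<circ> \<psi>) - v) \<in> mpow (Suc (Suc j))"
        using mpow_mult[of u 1 "(v \<circ> \<psi>) - v" "Suc j"] u v' ideal_power_1[OF regular_subring maximal_ideal_at_one_is_ideal] by simp
    qed
    finally show "u * v \<in> {b. (b \<circ> \<psi>) - b \<in> mpow (Suc (Suc j))}" by simp
  qed
  then show ?case using Suc.prems unfolding ideal_power.simps(2)[of B \<mm> j] by blast
qed

lemma regular_noetherian: "noetherian B"
proof -
  obtain T where "finite T" "T \<subseteq> B" "\<forall>X. is_subring X \<longrightarrow> constants \<union> T \<subseteq> X \<longrightarrow> B \<subseteq> X"
    using regular_generated by blast
  then show ?thesis
    using regular_constants
    by (intro noetherian_finitely_generated[OF is_subring_constants noetherian_constants _ regular_subring, of T]) auto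
qed

text \<open>
  Krull's intersection theorem gives for each single function in \<open>J\<close> a factor \<open>1 - e\<close>, with value 1 at
  the identity, that annihilates it. As the ideal spanned by \<open>J\<close> is finitely generated, one product
  of such factors works for all of \<open>J\<close>.
\<close>

lemma vanishing_near_one:
  assumes J: "J \<subseteq> B" and powers: "\<And>b j. b \<in> J \<Longrightarrow> b \<in> mpow j"
  shows "\<exists>h\<in>B. h \<one> = 1 \<and> (\<forall>b\<in>J. h * b = 0)"
proof -
  note B = regular_subring
  obtain T where T: "finite T" "T \<subseteq> J" "J \<subseteq> rspan B T"
    using noetherian_generators[OF regular_noetherian J] by blast
  have "\<forall>b\<in>T. \<exists>e\<in>\<mm>. b = e * b"
    using krull_intersection[OF B regular_noetherian maximal_ideal_at_one_is_ideal] powers T(2) by blast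
  then obtain e where e: "\<And>b. b \<in> T \<Longrightarrow> e b \<in> \<mm> \<and> b = e b * b" by metis
  define h where "h = (\<Prod>b\<in>T. 1 - e b)"
  have eB: "1 - e b \<in> B \<and> (1 - e b) \<one> = 1" if "b \<in> T" for b
    using e[OF that] by (auto simp: maximal_ideal_at_one_def intro: subring_diff[OF B] subring_one[OF B])
  have "(\<Prod>b\<in>S. 1 - e b) \<in> B \<and> (\<Prod>b\<in>S. 1 - e b) \<one> = 1" if "finite S" "S \<subseteq> T" for S
    using that
  proof induction
    case (insert b S)
    then have "1 - e b \<in> B" "(1 - e b) \<one> = 1" "(\<Prod>b\<in>S. 1 - e b) \<in> B" "(\<Prod>b\<in>S. 1 - e b) \<one> = 1"
      using eB[of b] by blast+
    then show ?case
      unfolding prod.insert[OF insert(1,2)]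
      by (intro conjI subring_mult[OF B]) (simp_all only: times_fun_apply mult_1)
  qed (auto intro: subring_one[OF B])
  then have h: "h \<in> B" "h \<one> = 1" using T(1) by (auto simp: h_def)
  have hT: "h * b = 0" if "b \<in> T" for b
  proof -
    have "h = (\<Prod>b\<in>T - {b}. 1 - e b) * (1 - e b)"
      unfolding h_def using T(1) that by (simp add: prod.remove mult.commute)
    moreover have "(1 - e b) * b = 0"
    proof -
      have "(1 - e b) * b = b - e b * b" by (simp only: left_diff_distrib mult_1)
      then show ?thesis using e[OF that] by (metis cancel_comm_monoid_add_class.diff_cancel)
    qed
    ultimately show ?thesis by (simp only: mult.assoc mult_zero_right)
  qed
  have "h * b = 0" if "b \<in> rspan B T" for b
    using that
  proof induction
    case (add s t x)
    have "h * (s * t + x) = s * (h * t) + h * x" by (simp only: algebra_simps)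
    then show ?case using hT[OF add(2)] add.IH by (simp only: mult_zero_right add_0)
  qed (rule mult_zero_right)
  then show ?thesis using h T(3) by blast
qed

end

section \<open>Finiteness of the Lang map\<close>

text \<open>
  Products of at most \<open>n\<close> elements of \<open>T\<close>; multisets make them independent of the order of the
  factors. The span of these words is the part of degree at most \<open>n\<close> in the algebra generated by \<open>T\<close>.
\<close>

definition words :: "('r::comm_ring_1) set \<Rightarrow> nat \<Rightarrow> 'r set" where
  "words T n = prod_mset ` {M. set_mset M \<subseteq> T \<and> size M \<le> n}"

lemma words_finite:
  assumes "finite T"
  shows "finite (words T n)"
proof -
  have "words T n \<subseteq> (\<lambda>l. prod_mset (mset l)) ` {l. set l \<subseteq> T \<and> length l \<le> n}"
  proof
    fix x assume "x \<in> words T n"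
    then obtain M where M: "set_mset M \<subseteq> T" "size M \<le> n" "x = prod_mset M" by (auto simp: words_def)
    obtain l where "mset l = M" using ex_mset by blast
    then show "x \<in> (\<lambda>l. prod_mset (mset l)) ` {l. set l \<subseteq> T \<and> length l \<le> n}"
      using M by (intro image_eqI[of _ _ l]) auto
  qed
  then show ?thesis using finite_lists_length_le[OF assms, of n] by (meson finite_imageI finite_subset)
qed

lemma words_mono: "m \<le> n \<Longrightarrow> words T m \<subseteq> words T n"
  by (auto simp: words_def)

lemma words_mult: "x \<in> words T m \<Longrightarrow> y \<in> words T n \<Longrightarrow> x * y \<in> words T (m + n)"
proof -
  assume "x \<in> words T m" "y \<in> words T n"
  then obtain M N where "set_mset M \<subseteq> T" "size M \<le> m" "x = prod_mset M" "set_mset N \<subseteq> T" "size N \<le> n" "y = prod_mset N"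
    by (auto simp: words_def)
  then show ?thesis unfolding words_def by (intro image_eqI[of _ _ "M + N"]) auto
qed

lemma rspan_mult:
  assumes "is_subring S" "x \<in> rspan S T" "y \<in> rspan S T'" "\<And>t t'. t \<in> T \<Longrightarrow> t' \<in> T' \<Longrightarrow> t * t' \<in> T''"
  shows "x * y \<in> rspan S T''"
proof -
  have "rspan S T \<subseteq> {x. x * y \<in> rspan S T''}"
  proof (rule rspan_least)
    fix s t assume st: "s \<in> S" "t \<in> T"
    have "rspan S T' \<subseteq> {y. s * t * y \<in> rspan S T''}"
    proof (rule rspan_least)
      fix s' t' assume st': "s' \<in> S" "t' \<in> T'"
      have "(s * s') * (t * t') \<in> rspan S T''"
        using st st' assms(4) by (intro rspan_gen subring_mult[OF assms(1)])
      then show "s' * t' \<in> {y. s * t * y \<in> rspan S T''}" by (simp add: mult_ac)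
    qed (auto simp: distrib_left intro: rspan.zero rspan_add)
    then show "s * t \<in> {x. x * y \<in> rspan S T''}" using assms(3) by blast
  qed (auto simp: distrib_right intro: rspan.zero rspan_add)
  then show ?thesis using assms(2) by blast
qed

lemma generated_words:
  assumes K: "is_subring K" and gen: "\<And>X. is_subring X \<Longrightarrow> K \<union> T \<subseteq> X \<Longrightarrow> B \<subseteq> X" and b: "b \<in> B"
  shows "\<exists>n. b \<in> rspan K (words T n)"
proof -
  let ?X = "\<Union>n. rspan K (words T n)"
  have mono: "rspan K (words T m) \<subseteq> rspan K (words T n)" if "m \<le> n" for m n
    using words_mono[OF that] by (intro rspan_mono) auto
  have one: "1 \<in> words T 0" unfolding words_def by (intro image_eqI[of _ _ "{#}"]) auto
  have "is_subring ?X"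
    unfolding is_subring_def
  proof (intro conjI ballI)
    show "1 \<in> ?X" using rspan_base[OF subring_one[OF K] one] by blast
  next
    fix x y assume "x \<in> ?X" "y \<in> ?X"
    then obtain m n where mn: "x \<in> rspan K (words T m)" "y \<in> rspan K (words T n)" by blast
    have "- 1 * y \<in> rspan K (words T n)"
      by (rule rspan_scale[OF _ mn(2)]) (auto intro: subring_minus[OF K])
    then have "x + - 1 * y \<in> rspan K (words T (m + n))"
      using mn(1) mono[of m "m + n"] mono[of n "m + n"] by (intro rspan_add) auto
    then show "x - y \<in> ?X" by auto
    show "x * y \<in> ?X" using rspan_mult[OF K mn words_mult] by blast
  qed
  moreover have "K \<subseteq> ?X"
    using rspan_gen[OF _ one, of _ K] by force
  moreover have "T \<subseteq> ?X"
  proof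
    fix t assume "t \<in> T"
    then have "t \<in> words T 1" unfolding words_def by (intro image_eqI[of _ _ "{#t#}"]) auto
    then show "t \<in> ?X" using rspan_base[OF subring_one[OF K]] by blast
  qed
  ultimately show ?thesis using gen[of ?X] b by blast
qed

text \<open>
  A word of more than \<open>card T * Q\<close> letters contains some letter \<open>t\<close> at least \<open>Q\<close> times; replacing \<open>t ^ Q\<close>
  by a combination of words of at most \<open>s < Q\<close> letters makes it shorter.
\<close>

lemma finite_module_of_powers:
  fixes B :: "'r::comm_ring_1 set"
  assumes K: "is_subring K" "K \<subseteq> R" and R: "is_subring R"
    and T: "finite T" and gen: "\<And>X. is_subring X \<Longrightarrow> K \<union> T \<subseteq> X \<Longrightarrow> B \<subseteq> X"
    and power: "\<And>t. t \<in> T \<Longrightarrow> t ^ Q \<in> rspan R (words T s)" and sQ: "s < Q"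
  shows "B \<subseteq> rspan R (words T (card T * Q))"
proof -
  let ?D = "card T * Q"
  have word: "prod_mset M \<in> rspan R (words T ?D)" if "set_mset M \<subseteq> T" for M
    using that
  proof (induction "size M" arbitrary: M rule: less_induct)
    case less
    show ?case
    proof (cases "size M \<le> ?D")
      case True
      then have "prod_mset M \<in> words T ?D" using less.prems by (auto simp: words_def)
      then show ?thesis by (rule rspan_base[OF subring_one[OF R]])
    next
      case False
      have "\<exists>t\<in>T. Q \<le> count M t"
      proof (rule ccontr)
        assume "\<not> ?thesis"
        then have "(\<Sum>t\<in>T. count M t) \<le> (\<Sum>t\<in>T. Q)" by (intro sum_mono) auto
        moreover have "size M = (\<Sum>t\<in>T. count M t)"
          unfolding size_multiset_overloaded_eq using less.prems T
          by (intro sum.mono_neutral_left) (auto simp: not_in_iff)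
        ultimately show False using False by simp
      qed
      then obtain t where t: "t \<in> T" "Q \<le> count M t" by blast
      define N where "N = M - replicate_mset Q t"
      have M: "M = replicate_mset Q t + N"
        using t(2) by (simp add: N_def count_le_replicate_mset_subset_eq)
      have N: "set_mset N \<subseteq> T" "size M = Q + size N"
        using less.prems unfolding M by auto
      have "prod_mset N \<in> words T (size N)" using N(1) by (auto simp: words_def)
      then have "prod_mset N \<in> rspan R (words T (size N))" by (rule rspan_base[OF subring_one[OF R]])
      from rspan_mult[OF R power[OF t(1)] this words_mult]
      have "t ^ Q * prod_mset N \<in> rspan R (words T (s + size N))" .
      moreover have "words T (s + size N) \<subseteq> rspan R (words T ?D)"
      proof
        fix x assume "x \<in> words T (s + size N)"
        then obtain M' where "set_mset M' \<subseteq> T" "size M' \<le> s + size N" "x = prod_mset M'" by (auto simp: words_def)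
        then show "x \<in> rspan R (words T ?D)" using less.hyps[of M'] N(2) sQ by auto
      qed
      then have "rspan R (words T (s + size N)) \<subseteq> rspan R (words T ?D)" by (rule rspan_trans[OF R])
      ultimately show ?thesis by (auto simp: M)
    qed
  qed
  show ?thesis
  proof
    fix b assume "b \<in> B"
    then obtain n where "b \<in> rspan K (words T n)" using generated_words[OF K(1) gen] by blast
    moreover have "rspan K (words T n) \<subseteq> rspan R (words T n)" using K(2) by (intro rspan_mono) auto
    moreover have "rspan R (words T n) \<subseteq> rspan R (words T ?D)"
      by (rule rspan_trans[OF R]) (use word in \<open>auto simp: words_def\<close>)
    ultimately show "b \<in> rspan R (words T ?D)" by blast
  qed
qed

text \<open>
  \<open>A\<^sub>0\<close> plays the role of the \<open>\<bbbF>\<^sub>q\<close>-structure: it spans \<open>B\<close> over \<open>'k\<close>, and the comorphism of \<open>F ^ M\<close> takes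
  \<open>q\<close>-th powers on it.
\<close>

locale affine_group_steinberg = affine_group H B retract
  for H :: "('a, 'm) monoid_scheme" (structure) and B :: "('a \<Rightarrow> 'k::alg_closed_field) set" and retract +
  fixes F :: "'a \<Rightarrow> 'a" and M q e :: nat and A\<^sub>0 :: "('a \<Rightarrow> 'k) set"
  assumes F: "regular_endo F"
    and A\<^sub>0: "A\<^sub>0 \<subseteq> B" "B \<subseteq> rspan constants A\<^sub>0"
    and frobenius: "t \<in> A\<^sub>0 \<Longrightarrow> x \<in> carrier H \<Longrightarrow> t ((F ^^ M) x) = t x ^ q"
    and q: "prime CHAR('k)" "q = CHAR('k) ^ e" "0 < e"
begin

lemma q_ge_2: "2 \<le> q"
proof -
  have "2 \<le> CHAR('k)" using prime_ge_2_nat[OF q(1)] .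
  also have "\<dots> \<le> q" using q \<open>2 \<le> CHAR('k)\<close> power_increasing[of 1 e "CHAR('k)"] by simp
  finally show ?thesis .
qed

lemma diff_power_q: "(x - y) ^ q = x ^ q - y ^ q" for x y :: 'k
proof -
  have "((x - y) + y) ^ q = (x - y) ^ q + y ^ q" by (rule freshmans_dream'[OF q(1,2)])
  then show ?thesis by simp
qed

lemma frobenius_iterate:
  assumes "t \<in> A\<^sub>0" "x \<in> carrier H"
  shows "t ((F ^^ (M * j)) x) = t x ^ (q ^ j)"
proof (induction j)
  case (Suc j)
  have "t ((F ^^ (M * Suc j)) x) = t ((F ^^ M) ((F ^^ (M * j)) x))" by (simp add: funpow_add)
  also have "\<dots> = (t x ^ (q ^ j)) ^ q"
    using assms Suc by (simp add: frobenius endo_funpow_closed[OF F])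
  finally show ?case by (simp add: mult.commute flip: power_mult)
qed simp

lemma generators_in_structure:
  obtains T where "finite T" "T \<subseteq> A\<^sub>0" "\<And>X. is_subring X \<Longrightarrow> constants \<union> T \<subseteq> X \<Longrightarrow> B \<subseteq> X"
proof -
  obtain T0 where T0: "finite T0" "T0 \<subseteq> B" "\<forall>X. is_subring X \<longrightarrow> constants \<union> T0 \<subseteq> X \<longrightarrow> B \<subseteq> X"
    using regular_generated by blast
  obtain T where T: "finite T" "T \<subseteq> A\<^sub>0" "T0 \<subseteq> rspan constants T"
    using rspan_finite_subset_support[OF T0(1) _ is_subring_constants] T0(2) A\<^sub>0(2) by (metis subset_trans)
  show thesis
  proof (rule that[OF T(1,2)])
    fix X :: "('a \<Rightarrow> 'k) set" assume X: "is_subring X" "constants \<union> T \<subseteq> X"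
    then have "rspan constants T \<subseteq> X"
      by (intro rspan_least) (auto intro: subring_zero subring_add subring_mult)
    then show "B \<subseteq> X" using T0(3) T(3) X by blast
  qed
qed

definition lang_map :: "'a \<Rightarrow> 'a \<Rightarrow> 'a" where
  "lang_map a x = retract x \<otimes> a \<otimes> inv (F (retract x))"

lemma lang_map_regular:
  assumes "a \<in> carrier H"
  shows "regular_map (lang_map a)"
proof -
  have "regular_map (\<lambda>x. retract x \<otimes> (\<lambda>_. a) x \<otimes> inv ((F \<circ> retract) x))"
    using assms by (intro regular_map_mult regular_map_retract regular_map_const regular_map_inv endo_regular[OF F])
  then show ?thesis by (simp add: lang_map_def[abs_def])
qed

text \<open>
  The finite set \<open>S\<close> of coefficient functions depends on \<open>b\<close> only, neither on \<open>L\<close> nor on the translating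
  elements: it consists of the middle factors in an expansion of \<open>b (u \<otimes> x \<otimes> v)\<close>. This uniformity makes
  it possible to choose the exponent of Frobenius after the degrees of the elements of \<open>S\<close>.
\<close>

lemma translate_in_finite_module:
  assumes b: "b \<in> B"
  shows "\<exists>S. finite S \<and> S \<subseteq> B \<and> (\<forall>L \<mu> v. regular_map L \<longrightarrow> regular_map \<mu> \<longrightarrow> v \<in> carrier H \<longrightarrow>
     (\<lambda>x. b (\<mu> (L x) \<otimes> retract x \<otimes> v)) \<in> rspan ((\<lambda>c. c \<circ> L) ` B) S)"
proof -
  obtain ps where ps: "set ps \<subseteq> B \<times> B"
    "\<forall>x\<in>carrier H. \<forall>y\<in>carrier H. b (x \<otimes> y) = (\<Sum>p\<leftarrow>ps. fst p x * snd p y)"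
    using regular_mult[OF b] by blast
  have "\<forall>p\<in>set ps. \<exists>rs. set rs \<subseteq> B \<times> B \<and>
    (\<forall>x\<in>carrier H. \<forall>y\<in>carrier H. fst p (x \<otimes> y) = (\<Sum>r\<leftarrow>rs. fst r x * snd r y))"
    using ps(1) by (intro ballI regular_mult) auto
  from bchoice[OF this] obtain rs where "\<forall>p\<in>set ps. set (rs p) \<subseteq> B \<times> B \<and>
    (\<forall>x\<in>carrier H. \<forall>y\<in>carrier H. fst p (x \<otimes> y) = (\<Sum>r\<leftarrow>rs p. fst r x * snd r y))" ..
  then have rs: "\<And>p. p \<in> set ps \<Longrightarrow> set (rs p) \<subseteq> B \<times> B"
    "\<And>p x y. p \<in> set ps \<Longrightarrow> x \<in> carrier H \<Longrightarrow> y \<in> carrier H \<Longrightarrow> fst p (x \<otimes> y) = (\<Sum>r\<leftarrow>rs p. fst r x * snd r y)"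
    by blast+
  define S where "S = (\<Union>p\<in>set ps. snd ` set (rs p))"
  show ?thesis
  proof (intro exI[of _ S] conjI allI impI)
    show "finite S" by (auto simp: S_def)
    show "S \<subseteq> B" unfolding S_def using rs(1) by fastforce
  next
    fix L \<mu> v assume L: "regular_map L" and \<mu>: "regular_map \<mu>" and v: "v \<in> carrier H"
    let ?R = "(\<lambda>c. c \<circ> L) ` B"
    have "(\<lambda>x. b (\<mu> (L x) \<otimes> retract x \<otimes> v))
      = (\<Sum>p\<leftarrow>ps. \<Sum>r\<leftarrow>rs p. (((\<lambda>_. snd p v) * (fst r \<circ> \<mu>)) \<circ> L) * snd r)"
    proof
      fix x
      have c: "\<mu> (L x) \<in> carrier H" using \<mu> by (rule regular_map_closed)
      have "b (\<mu> (L x) \<otimes> retract x \<otimes> v) = (\<Sum>p\<leftarrow>ps. fst p (\<mu> (L x) \<otimes> retract x) * snd p v)"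
        using ps(2) c v by simp
      also have "\<dots> = (\<Sum>p\<leftarrow>ps. (\<Sum>r\<leftarrow>rs p. fst r (\<mu> (L x)) * snd r (retract x)) * snd p v)"
        using rs(2) c by (intro arg_cong[where f = sum_list] map_cong) auto
      also have "\<dots> = (\<Sum>p\<leftarrow>ps. \<Sum>r\<leftarrow>rs p. snd p v * fst r (\<mu> (L x)) * snd r x)"
      proof (intro arg_cong[where f = sum_list] map_cong refl)
        fix p assume "p \<in> set ps"
        have "(\<Sum>r\<leftarrow>rs p. fst r (\<mu> (L x)) * snd r (retract x)) * snd p v
            = (\<Sum>r\<leftarrow>rs p. snd p v * fst r (\<mu> (L x)) * snd r (retract x))"
          by (simp add: sum_list_const_mult mult_ac)
        also have "\<dots> = (\<Sum>r\<leftarrow>rs p. snd p v * fst r (\<mu> (L x)) * snd r x)"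
          using rs(1)[OF \<open>p \<in> set ps\<close>]
          by (intro arg_cong[where f = sum_list] map_cong) (auto simp: regular_retract)
        finally show "(\<Sum>r\<leftarrow>rs p. fst r (\<mu> (L x)) * snd r (retract x)) * snd p v
            = (\<Sum>r\<leftarrow>rs p. snd p v * fst r (\<mu> (L x)) * snd r x)" .
      qed
      finally show "b (\<mu> (L x) \<otimes> retract x \<otimes> v)
        = (\<Sum>p\<leftarrow>ps. \<Sum>r\<leftarrow>rs p. (((\<lambda>_. snd p v) * (fst r \<circ> \<mu>)) \<circ> L) * snd r) x"
        by (simp add: sum_list_fun_apply)
    qed
    also have "\<dots> \<in> rspan ?R S"
    proof -
      have sl: "(\<Sum>i\<leftarrow>xs. f i) \<in> rspan ?R S" if "\<And>i. i \<in> set xs \<Longrightarrow> f i \<in> rspan ?R S"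
        for f :: "(('a \<Rightarrow> 'k) \<times> ('a \<Rightarrow> 'k)) \<Rightarrow> ('a \<Rightarrow> 'k)" and xs
        using that by (induction xs) (auto intro: rspan.zero rspan_add)
      show ?thesis
      proof (intro sl rspan_gen imageI subring_mult[OF regular_subring] regular_const regular_map_pullback[OF \<mu>])
        fix p r assume "p \<in> set ps" "r \<in> set (rs p)"
        moreover from this have "r \<in> B \<times> B" using rs(1)[of p] by blast
        ultimately show "fst r \<in> B" "snd r \<in> S" by (auto simp: S_def)
      qed
    qed
    finally show "(\<lambda>x. b (\<mu> (L x) \<otimes> retract x \<otimes> v)) \<in> rspan ?R S" .
  qed
qed

end

context affine_group_steinberg
begin

lemma lang_map_finite:
  assumes a: "a \<in> carrier H"
  shows "\<exists>G. finite G \<and> G \<subseteq> B \<and> B \<subseteq> rspan ((\<lambda>b. b \<circ> lang_map a) ` B) G"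
proof -
  note B = regular_subring
  let ?R = "(\<lambda>b. b \<circ> lang_map a) ` B"
  note L = lang_map_regular[OF a]
  obtain T where T: "finite T" "T \<subseteq> A\<^sub>0" and gen: "\<And>X. is_subring X \<Longrightarrow> constants \<union> T \<subseteq> X \<Longrightarrow> B \<subseteq> X"
    using generators_in_structure by metis
  have TB: "T \<subseteq> B" using T(2) A\<^sub>0(1) by blast
  have "\<forall>t\<in>T. \<exists>S. finite S \<and> S \<subseteq> B \<and> (\<forall>L \<mu> v. regular_map L \<longrightarrow> regular_map \<mu> \<longrightarrow> v \<in> carrier H \<longrightarrow>
     (\<lambda>x. t (\<mu> (L x) \<otimes> retract x \<otimes> v)) \<in> rspan ((\<lambda>c. c \<circ> L) ` B) S)"
    using translate_in_finite_module TB by blast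
  from bchoice[OF this] obtain S where S: "\<forall>t\<in>T. finite (S t) \<and> S t \<subseteq> B \<and> (\<forall>L \<mu> v. regular_map L \<longrightarrow> regular_map \<mu> \<longrightarrow> v \<in> carrier H \<longrightarrow>
     (\<lambda>x. t (\<mu> (L x) \<otimes> retract x \<otimes> v)) \<in> rspan ((\<lambda>c. c \<circ> L) ` B) (S t))" ..
  let ?S = "\<Union>t\<in>T. S t"
  have "\<forall>b\<in>?S. \<exists>n. b \<in> rspan constants (words T n)"
    using S generated_words[OF is_subring_constants gen] by blast
  from bchoice[OF this] obtain N where N: "\<forall>b\<in>?S. b \<in> rspan constants (words T (N b))" ..
  have fin: "finite ?S" using S T(1) by blast
  define s where "s = Max (insert 0 (N ` ?S))"
  have s: "N b \<le> s" if "b \<in> ?S" for b unfolding s_def using fin that by (intro Max_ge) auto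
  have cR: "constants \<subseteq> ?R"
  proof
    fix c :: "'a \<Rightarrow> 'k" assume "c \<in> constants"
    then have "c \<in> B" "c = c \<circ> lang_map a" using regular_constants by (auto simp: constants_iff fun_eq_iff)
    then show "c \<in> ?R" by blast
  qed
  have Ss: "?S \<subseteq> rspan ?R (words T s)"
  proof
    fix b assume b: "b \<in> ?S"
    have "rspan constants (words T (N b)) \<subseteq> rspan ?R (words T s)"
      using cR words_mono[OF s[OF b]] by (intro rspan_mono) auto
    then show "b \<in> rspan ?R (words T s)" using N b by blast
  qed
  \<comment> \<open>As the exponent \<open>q ^ s\<close> exceeds the degree \<open>s\<close>, the relation for \<open>t ^ (q ^ s)\<close> lowers degrees.\<close>
  have sq: "s < q ^ s"
  proof -
    have "s < 2 ^ s" by (rule less_exp)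
    also have "\<dots> \<le> q ^ s" using q_ge_2 by (intro power_mono) auto
    finally show ?thesis .
  qed
  have power: "t ^ (q ^ s) \<in> rspan ?R (words T s)" if t: "t \<in> T" for t
  proof -
    let ?n = "M * s"
    let ?\<mu> = "\<lambda>y. inv ((twisted_norm F ?n \<circ> retract) y)"
    have \<mu>: "regular_map ?\<mu>" by (rule regular_map_inv[OF twisted_norm_regular[OF F]])
    have v: "twisted_norm F ?n a \<in> carrier H" by (rule twisted_norm_closed[OF F a])
    have "(t ^ (q ^ s)) x = t (?\<mu> (lang_map a x) \<otimes> retract x \<otimes> twisted_norm F ?n a)" for x
    proof -
      let ?w = "(F ^^ ?n) (retract x)"
      have w: "?w \<in> carrier H" by (rule endo_funpow_closed[OF F]) simp
      have "(t ^ (q ^ s)) x = t (retract x) ^ (q ^ s)"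
        using t TB by (auto simp: power_fun_apply regular_retract)
      also have "\<dots> = t ?w" using t T(2) by (simp add: frobenius_iterate subsetD)
      also have "?w = ?\<mu> (lang_map a x) \<otimes> retract x \<otimes> twisted_norm F ?n a"
      proof -
        have "lang_map a x \<in> carrier H" by (rule regular_map_closed[OF L])
        then have "(twisted_norm F ?n \<circ> retract) (lang_map a x) = twisted_norm F ?n (retract x \<otimes> a \<otimes> inv (F (retract x)))"
          by (simp add: lang_map_def)
        also have "\<dots> = retract x \<otimes> twisted_norm F ?n a \<otimes> inv ?w"
          by (rule twisted_norm_lang[OF F _ a]) simp
        finally have "?\<mu> (lang_map a x) = ?w \<otimes> inv (twisted_norm F ?n a) \<otimes> inv (retract x)"
          using v w by (simp add: inv_mult_group m_assoc)
        then show ?thesis using v w by (simp add: m_assoc inv_mult_cancel)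
      qed
      finally show ?thesis .
    qed
    then have e: "t ^ (q ^ s) = (\<lambda>x. t (?\<mu> (lang_map a x) \<otimes> retract x \<otimes> twisted_norm F ?n a))" by (rule ext)
    have "t ^ (q ^ s) \<in> rspan ?R (S t)" unfolding e using S[rule_format, OF t] L \<mu> v by blast
    moreover have "rspan ?R (S t) \<subseteq> rspan ?R (words T s)"
      using Ss t by (intro rspan_trans[OF pullback_is_subring]) auto
    ultimately show ?thesis by blast
  qed
  have "B \<subseteq> rspan ?R (words T (card T * q ^ s))"
    by (rule finite_module_of_powers[OF is_subring_constants cR pullback_is_subring T(1) gen power sq])
  moreover have "words T n \<subseteq> B" for n
    unfolding words_def using TB by (auto intro!: subring_prod_mset[OF B])
  ultimately show ?thesis
    by (intro exI[of _ "words T (card T * q ^ s)"] conjI words_finite[OF T(1)])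
qed

lemma lang_map_closed_image:
  assumes "a \<in> carrier H" "y \<in> carrier H" "\<And>b. b \<in> B \<Longrightarrow> b \<circ> lang_map a = 0 \<Longrightarrow> b y = 0"
  shows "\<exists>x\<in>carrier H. lang_map a x = y"
proof -
  obtain G where G: "finite G" "G \<subseteq> B" "B \<subseteq> rspan ((\<lambda>b. b \<circ> lang_map a) ` B) G"
    using lang_map_finite[OF assms(1)] by blast
  show ?thesis
    by (rule finite_image_closed[OF lang_map_regular[OF assms(1)] G assms(2)]) (rule assms(3))
qed

text \<open>
  For \<open>t \<in> A\<^sub>0\<close> the value \<open>t \<one>\<close> equals its \<open>q\<close>-th power, so \<open>t - t \<one>\<close> is pulled back to
  \<open>t ^ q - (t \<one>) ^ q = (t - t \<one>) ^ q\<close>, where \<open>q \<ge> 2\<close>; the general case is linear in \<open>t\<close>.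
\<close>

lemma frobenius_pullback_square:
  assumes b: "b \<in> \<mm>"
  shows "b \<circ> ((F ^^ M) \<circ> retract) \<in> mpow 2"
proof -
  let ?\<Phi> = "(F ^^ M) \<circ> retract"
  have "(b \<circ> ?\<Phi>) - (\<lambda>_. b \<one>) \<in> mpow 2" if "b \<in> rspan constants A\<^sub>0" for b
    using that
  proof induction
    case zero
    have "((0 :: 'a \<Rightarrow> 'k) \<circ> ?\<Phi>) - (\<lambda>_. 0 \<one>) = 0" by (simp add: fun_eq_iff)
    then show ?case using mpow_zero by (simp only:)
  next
    case (add s t x)
    then obtain c where c: "s = (\<lambda>_. c)" by (auto simp: constants_iff)
    have tB: "t \<in> B" using add(2) A\<^sub>0(1) by blast
    have "t - (\<lambda>_. t \<one>) \<in> \<mm>"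
      using tB by (auto simp: maximal_ideal_at_one_def intro: subring_diff[OF regular_subring] regular_const)
    then have "(t - (\<lambda>_. t \<one>)) ^ q \<in> mpow q" by (rule ideal_power_power[OF regular_subring maximal_ideal_at_one_is_ideal])
    then have t2: "(t - (\<lambda>_. t \<one>)) ^ q \<in> mpow 2"
      using ideal_power_mono[OF regular_subring maximal_ideal_at_one_is_ideal q_ge_2] by blast
    have one: "t \<one> = t \<one> ^ q" using frobenius[OF add(2), of \<one>] endo_one[OF endo_funpow[OF F, of M]] by simp
    have "((s * t + x) \<circ> ?\<Phi>) - (\<lambda>_. (s * t + x) \<one>) = s * (t - (\<lambda>_. t \<one>)) ^ q + ((x \<circ> ?\<Phi>) - (\<lambda>_. x \<one>))"
    proof
      fix y
      have "t ((F ^^ M) (retract y)) = t y ^ q" using frobenius[OF add(2), of "retract y"] regular_retract[OF tB] by simp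
      then show "(((s * t + x) \<circ> ?\<Phi>) - (\<lambda>_. (s * t + x) \<one>)) y = (s * (t - (\<lambda>_. t \<one>)) ^ q + ((x \<circ> ?\<Phi>) - (\<lambda>_. x \<one>))) y"
        using one by (simp add: c power_fun_apply diff_power_q algebra_simps)
    qed
    moreover have "s * (t - (\<lambda>_. t \<one>)) ^ q \<in> mpow 2"
      unfolding c by (rule ideal_mult[OF regular_subring mpow_ideal regular_const t2])
    ultimately show ?case using mpow_add add.IH by (simp only:)
  qed
  moreover have "b \<in> B" "b \<one> = 0" using b by (auto simp: maximal_ideal_at_one_def)
  ultimately have "(b \<circ> ?\<Phi>) - (\<lambda>_. 0) \<in> mpow 2" using A\<^sub>0(2) by (metis subsetD)
  moreover have "(b \<circ> ?\<Phi>) - (\<lambda>_. 0) = b \<circ> ?\<Phi>" by (simp add: fun_eq_iff)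
  ultimately show ?thesis by (simp only:)
qed

text \<open>
  Translating \<open>a\<close> to the identity replaces \<open>F\<close> by \<open>E(x) = a F(x) a\<^sup>-\<^sup>1\<close> and \<open>L\<close> by \<open>x \<mapsto> x E(x)\<^sup>-\<^sup>1\<close>. The
  composite \<open>\<psi>\<close> of this map with the norm of \<open>E\<close> is the identity on the cotangent space, because
  \<open>E ^ M\<close> is \<open>F ^ M\<close> followed by a conjugation. So a function killed by \<open>L\<^sup>*\<close> is killed by \<open>\<psi>\<^sup>*\<close> and
  lies in all powers of the maximal ideal. Near \<open>a\<close> all functions vanishing on the image are therefore
  zero, and the image is closed.
\<close>

lemma lang_image_neighbourhood:
  assumes a: "a \<in> carrier H"
  shows "\<exists>h\<in>B. h a \<noteq> 0 \<and> (\<forall>x\<in>carrier H. h x \<noteq> 0 \<longrightarrow> (\<exists>z\<in>carrier H. lang_map a z = x))"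
proof -
  define E where "E = (\<lambda>x. a \<otimes> F x \<otimes> inv a)"
  have E: "regular_endo E" unfolding E_def by (rule endo_conjugate[OF F a])
  define L where "L = (\<lambda>x. retract x \<otimes> inv (E (retract x)))"
  have Lr: "regular_map L"
  proof -
    have "regular_map (\<lambda>x. retract x \<otimes> inv ((E \<circ> retract) x))"
      by (intro regular_map_mult regular_map_retract regular_map_inv endo_regular[OF E])
    then show ?thesis by (simp add: L_def)
  qed
  have La: "L x \<otimes> a = lang_map a x" for x
  proof -
    have "F (retract x) \<in> carrier H" by (rule endo_closed[OF F]) simp
    then show ?thesis using a by (simp add: L_def E_def lang_map_def inv_mult_group m_assoc)
  qed
  define K where "K = twisted_norm E M \<circ> retract"
  have K: "regular_map K" "K \<one> = \<one>"
    unfolding K_def by (rule twisted_norm_regular[OF E]) (simp add: twisted_norm_one[OF E])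
  have L1: "L \<one> = \<one>" by (simp add: L_def endo_one[OF E])
  have E2: "b \<circ> ((E ^^ M) \<circ> retract) \<in> mpow 2" if b: "b \<in> \<mm>" for b
  proof -
    define z where "z = twisted_norm F M a"
    have z: "z \<in> carrier H" unfolding z_def by (rule twisted_norm_closed[OF F a])
    define c where "c = (\<lambda>x. z \<otimes> retract x \<otimes> inv z)"
    have "regular_map (\<lambda>x. (\<lambda>_. z) x \<otimes> retract x \<otimes> (\<lambda>_. inv z) x)"
      using z by (intro regular_map_mult regular_map_const regular_map_retract) auto
    then have c: "regular_map c" by (simp add: c_def)
    have "b \<circ> c \<in> \<mm>" using z by (intro pullback_maximal_ideal_at_one[OF c _ b]) (simp add: c_def)
    then have "(b \<circ> c) \<circ> ((F ^^ M) \<circ> retract) \<in> mpow 2" by (rule frobenius_pullback_square)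
    moreover have "(b \<circ> c) \<circ> ((F ^^ M) \<circ> retract) = b \<circ> ((E ^^ M) \<circ> retract)"
      using endo_conjugate_funpow[OF F a] endo_funpow_closed[OF F]
      by (simp add: fun_eq_iff E_def c_def z_def)
    ultimately show ?thesis by (simp only:)
  qed
  define \<psi> where "\<psi> = L \<circ> K"
  have \<psi>: "regular_map \<psi>" "\<psi> \<one> = \<one>"
    unfolding \<psi>_def using K L1 by (auto intro: regular_map_comp[OF Lr])
  have cong: "(b \<circ> \<psi>) - b \<in> mpow 2" if b: "b \<in> \<mm>" for b
  proof -
    have "(b \<circ> \<psi>) - (b - (b \<circ> ((E ^^ M) \<circ> retract))) \<in> mpow 2"
      using pullback_lang_norm[OF E b, of M] unfolding \<psi>_def L_def K_def .
    from mpow_diff[OF this E2[OF b]] show ?thesis by (simp add: algebra_simps)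
  qed
  define J where "J = {b \<in> B. b \<circ> L = 0}"
  have J: "b \<in> mpow j" if "b \<in> J" for b j
  proof (induction j)
    case 0
    then show ?case using that by (simp add: J_def)
  next
    case (Suc j)
    have "b \<circ> \<psi> = (b \<circ> L) \<circ> K" by (simp add: \<psi>_def comp_assoc)
    also have "\<dots> = 0" using that by (simp add: J_def fun_eq_iff)
    finally have z: "b \<circ> \<psi> = 0" .
    have "0 - b \<in> mpow (Suc j)" using pullback_unipotent[OF \<psi> cong Suc] unfolding z .
    then have "- (0 - b) \<in> mpow (Suc j)" by (rule mpow_minus)
    moreover have "- (0 - b) = b" by (simp add: fun_eq_iff)
    ultimately show ?case by (simp only:)
  qed
  obtain h where h: "h \<in> B" "h \<one> = 1" "\<forall>b\<in>J. h * b = 0"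
    using vanishing_near_one[of J] J by (auto simp: J_def)
  define \<tau> where "\<tau> = (\<lambda>x. retract x \<otimes> inv a)"
  have \<tau>: "regular_map \<tau>"
  proof -
    have "regular_map (\<lambda>x. retract x \<otimes> (\<lambda>_. inv a) x)"
      using a by (intro regular_map_mult regular_map_const regular_map_retract) auto
    then show ?thesis by (simp add: \<tau>_def)
  qed
  define \<rho> where "\<rho> = (\<lambda>x. retract x \<otimes> a)"
  have \<rho>: "regular_map \<rho>"
  proof -
    have "regular_map (\<lambda>x. retract x \<otimes> (\<lambda>_. a) x)"
      using a by (intro regular_map_mult regular_map_const regular_map_retract) auto
    then show ?thesis by (simp add: \<rho>_def)
  qed
  show ?thesis
  proof (intro bexI[of _ "h \<circ> \<tau>"] conjI ballI impI)
    show "h \<circ> \<tau> \<in> B" by (rule regular_map_pullback[OF \<tau> h(1)])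
    show "(h \<circ> \<tau>) a \<noteq> 0" using h(2) a by (simp add: \<tau>_def)
  next
    fix x assume x: "x \<in> carrier H" "(h \<circ> \<tau>) x \<noteq> 0"
    show "\<exists>z\<in>carrier H. lang_map a z = x"
    proof (rule lang_map_closed_image[OF a x(1)])
      fix b assume b: "b \<in> B" "b \<circ> lang_map a = 0"
      have "(b \<circ> \<rho>) \<circ> L = b \<circ> lang_map a"
        using regular_map_closed[OF Lr] by (simp add: fun_eq_iff \<rho>_def La)
      then have "b \<circ> \<rho> \<in> J" using b regular_map_pullback[OF \<rho>] by (simp add: J_def)
      then have "(h * (b \<circ> \<rho>)) (\<tau> x) = 0" using h(3) by simp
      moreover have "\<rho> (\<tau> x) = x" using a x(1) by (simp add: \<rho>_def \<tau>_def m_assoc)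
      ultimately show "b x = 0" using x(2) by simp
    qed
  qed
qed

text \<open>
  The images of the maps \<open>lang_map a\<close> are the orbits of an action of \<open>H\<close> on itself. Each contains a
  neighbourhood of each of its points, so each is open, and as a complement of other orbits closed.
  Connectedness is phrased with principal open sets.
\<close>

theorem lang_steinberg:
  assumes connected: "\<And>U. U \<subseteq> carrier H \<Longrightarrow>
      (\<And>x. x \<in> U \<Longrightarrow> \<exists>h\<in>B. h x \<noteq> 0 \<and> {y \<in> carrier H. h y \<noteq> 0} \<subseteq> U) \<Longrightarrow>
      (\<And>x. x \<in> carrier H - U \<Longrightarrow> \<exists>h\<in>B. h x \<noteq> 0 \<and> {y \<in> carrier H. h y \<noteq> 0} \<subseteq> carrier H - U) \<Longrightarrow>
      U = {} \<or> U = carrier H"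
    and d: "d \<in> carrier H"
  shows "\<exists>x\<in>carrier H. x \<otimes> inv (F x) = d"
proof -
  define orb where "orb = (\<lambda>a. lang_map a ` carrier H)"
  have closed: "lang_map a x \<in> carrier H" if "a \<in> carrier H" for a x
    by (rule regular_map_closed[OF lang_map_regular[OF that]])
  have act: "lang_map (lang_map a x) y = lang_map a (y \<otimes> x)"
    if "a \<in> carrier H" "x \<in> carrier H" "y \<in> carrier H" for a x y
    using that endo_closed[OF F] by (simp add: lang_map_def endo_mult[OF F] inv_mult_group m_assoc)
  have one: "lang_map a \<one> = a" if "a \<in> carrier H" for a
    using that by (simp add: lang_map_def endo_one[OF F])
  have orb_sym: "a \<in> orb y" if ay: "a \<in> carrier H" "y \<in> orb a" for a y
  proof -
    obtain x where x: "x \<in> carrier H" "y = lang_map a x" using ay(2) unfolding orb_def by blast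
    then have "lang_map y (inv x) = a" using act[of a x "inv x"] ay one by simp
    then show ?thesis unfolding orb_def using x by force
  qed
  have orb_trans: "orb y \<subseteq> orb a" if ay: "a \<in> carrier H" "y \<in> orb a" for a y
  proof -
    obtain x where x: "x \<in> carrier H" "y = lang_map a x" using ay(2) unfolding orb_def by blast
    show ?thesis unfolding orb_def x(2) using act[OF ay(1) x(1)] x(1) by (auto intro!: image_eqI)
  qed
  have nbhd: "\<exists>h\<in>B. h a \<noteq> 0 \<and> {y \<in> carrier H. h y \<noteq> 0} \<subseteq> orb a" if "a \<in> carrier H" for a
    using lang_image_neighbourhood[OF that] unfolding orb_def by blast
  have sub: "orb a \<subseteq> carrier H" if "a \<in> carrier H" for a
    using closed[OF that] by (auto simp: orb_def)
  have "orb \<one> = {} \<or> orb \<one> = carrier H"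
  proof (rule connected)
    show "orb \<one> \<subseteq> carrier H" by (rule sub) simp
  next
    fix x assume x: "x \<in> orb \<one>"
    then have "x \<in> carrier H" using sub[of \<one>] by auto
    then show "\<exists>h\<in>B. h x \<noteq> 0 \<and> {y \<in> carrier H. h y \<noteq> 0} \<subseteq> orb \<one>"
      using nbhd[of x] orb_trans[OF one_closed x] by blast
  next
    fix x assume x: "x \<in> carrier H - orb \<one>"
    have "orb x \<subseteq> carrier H - orb \<one>"
    proof
      fix y assume y: "y \<in> orb x"
      then have yH: "y \<in> carrier H" using sub[of x] x by blast
      have "y \<notin> orb \<one>"
      proof
        assume "y \<in> orb \<one>"
        then show False using orb_sym[of x y] y x orb_trans[OF one_closed] by blast
      qed
      then show "y \<in> carrier H - orb \<one>" using yH by blast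
    qed
    then show "\<exists>h\<in>B. h x \<noteq> 0 \<and> {y \<in> carrier H. h y \<noteq> 0} \<subseteq> carrier H - orb \<one>"
      using nbhd[of x] x by blast
  qed
  moreover have "\<one> \<in> orb \<one>" unfolding orb_def using one[of \<one>] by force
  ultimately have "d \<in> orb \<one>" using d by blast
  then obtain x where "x \<in> carrier H" "d = lang_map \<one> x" by (auto simp: orb_def)
  then show ?thesis by (intro bexI[of _ x]) (auto simp: lang_map_def)
qed

end

section \<open>The Zariski topology of a linear algebraic group\<close>

lemma fun_subalgebraD:
  assumes "fun_subalgebra S X A"
  shows "f \<in> A \<Longrightarrow> f \<in> extensional X" "c \<in> S \<Longrightarrow> (\<lambda>x\<in>X. c) \<in> A"
    "f \<in> A \<Longrightarrow> g \<in> A \<Longrightarrow> (\<lambda>x\<in>X. f x + g x) \<in> A" "f \<in> A \<Longrightarrow> g \<in> A \<Longrightarrow> (\<lambda>x\<in>X. f x * g x) \<in> A"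
  using assms by (auto simp: fun_subalgebra_def)

text \<open>
  The finite sums of products of a function of \<open>x\<close> and a function of \<open>y\<close> form a subalgebra containing
  the generators of the coordinate ring of the product. Lists of pairs represent such sums, so that
  addition is concatenation.
\<close>

lemma prod_regular_expansion:
  fixes A :: "('a \<Rightarrow> 'k::field) set" and C :: "('b \<Rightarrow> 'k) set"
  assumes A: "fun_subalgebra UNIV X A" and C: "fun_subalgebra UNIV Y C"
    and h: "h \<in> prod_regular X A Y C"
  shows "\<exists>ps. set ps \<subseteq> A \<times> C \<and> (\<forall>x\<in>X. \<forall>y\<in>Y. h (x, y) = (\<Sum>p\<leftarrow>ps. fst p x * snd p y))"
proof -
  define expands where "expands h ps \<longleftrightarrow> set ps \<subseteq> A \<times> C \<and>
    (\<forall>x\<in>X. \<forall>y\<in>Y. h (x, y) = (\<Sum>p\<leftarrow>ps. fst p x * snd p y))" for h :: "'a \<times> 'b \<Rightarrow> 'k" and ps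
  note Ad = fun_subalgebraD[OF A] and Cd = fun_subalgebraD[OF C]
  let ?t = "{h \<in> extensional (X \<times> Y). \<exists>ps. expands h ps}"
  have add: "expands (\<lambda>z\<in>X \<times> Y. f z + g z) (ps @ qs)" if "expands f ps" "expands g qs" for f g ps qs
    using that by (auto simp: expands_def)
  have mult: "\<exists>rs. expands (\<lambda>z\<in>X \<times> Y. f z * g z) rs" if f: "expands f ps" and g: "expands g qs" for f g ps qs
    using f
  proof (induction ps arbitrary: f)
    case Nil
    then show ?case by (intro exI[of _ "[]"]) (auto simp: expands_def)
  next
    case (Cons p ps)
    define f' where "f' = (\<lambda>(x, y). \<Sum>p\<leftarrow>ps. fst p x * snd p y)"
    have "expands f' ps" using Cons.prems by (auto simp: expands_def f'_def)
    then obtain rs where rs: "expands (\<lambda>z\<in>X \<times> Y. f' z * g z) rs" using Cons.IH by blast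
    define ss where "ss = map (\<lambda>q. (\<lambda>x\<in>X. fst p x * fst q x, \<lambda>y\<in>Y. snd p y * snd q y)) qs"
    have "set ss \<subseteq> A \<times> C"
      using Cons.prems g by (fastforce simp: ss_def expands_def intro: Ad(4) Cd(4))
    moreover have "fst p x * snd p y * g (x, y) = (\<Sum>r\<leftarrow>ss. fst r x * snd r y)" if "x \<in> X" "y \<in> Y" for x y
    proof -
      have "g (x, y) = (\<Sum>q\<leftarrow>qs. fst q x * snd q y)" using g that by (auto simp: expands_def)
      then have "fst p x * snd p y * g (x, y) = (\<Sum>q\<leftarrow>qs. fst p x * snd p y * (fst q x * snd q y))"
        by (simp add: sum_list_const_mult)
      then show ?thesis using that by (simp add: ss_def comp_def mult_ac)
    qed
    ultimately have "expands (\<lambda>z\<in>X \<times> Y. f z * g z) (ss @ rs)"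
      using rs Cons.prems by (auto simp: expands_def f'_def distrib_right)
    then show ?case by blast
  qed
  have "fun_subalgebra UNIV (X \<times> Y) ?t"
    unfolding fun_subalgebra_def
  proof (intro conjI ballI)
    fix c :: 'k
    have "expands (\<lambda>z\<in>X \<times> Y. c) [(\<lambda>x\<in>X. c, \<lambda>y\<in>Y. 1)]"
      using Ad(2) Cd(2) by (auto simp: expands_def)
    then show "(\<lambda>z\<in>X \<times> Y. c) \<in> ?t" by auto
  next
    fix f g assume "f \<in> ?t" "g \<in> ?t"
    then show "(\<lambda>z\<in>X \<times> Y. f z + g z) \<in> ?t" "(\<lambda>z\<in>X \<times> Y. f z * g z) \<in> ?t"
      using add mult by (simp_all, blast+)
  qed auto
  moreover have "(\<lambda>f. \<lambda>z\<in>X \<times> Y. f (fst z)) ` A \<union> (\<lambda>g. \<lambda>z\<in>X \<times> Y. g (snd z)) ` C \<subseteq> ?t"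
  proof -
    have "expands (\<lambda>z\<in>X \<times> Y. f (fst z)) [(f, \<lambda>y\<in>Y. 1)]" if "f \<in> A" for f
      using Cd(2) that by (auto simp: expands_def)
    moreover have "expands (\<lambda>z\<in>X \<times> Y. g (snd z)) [(\<lambda>x\<in>X. 1, g)]" if "g \<in> C" for g
      using Ad(2) that by (auto simp: expands_def)
    ultimately show ?thesis by (auto simp del: restrict_apply split_paired_Ex)
  qed
  ultimately have "prod_regular X A Y C \<subseteq> ?t"
    unfolding prod_regular_def by (intro hull_minimal)
  then show ?thesis using h by (auto simp: expands_def)
qed

context
  fixes G :: "('a, 'k::alg_closed_field) alg_group" (structure)
  assumes lag: "linear_algebraic_group G"
begin

lemma lag_group: "group G"
  and lag_variety: "affine_variety (carrier G) (regular G)"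
  and lag_subalgebra: "fun_subalgebra UNIV (carrier G) (regular G)"
  and lag_inv: "variety_morphism (carrier G) (regular G) (carrier G) (regular G) (\<lambda>x. inv x)"
  using lag unfolding linear_algebraic_group_def affine_variety_def finitely_generated_algebra_def by blast+

interpretation group G by (rule lag_group)

lemma lag_mult:
  assumes "f \<in> regular G"
  shows "\<exists>ps. set ps \<subseteq> regular G \<times> regular G \<and>
    (\<forall>x\<in>carrier G. \<forall>y\<in>carrier G. f (x \<otimes> y) = (\<Sum>p\<leftarrow>ps. fst p x * snd p y))"
proof -
  have "compose (carrier G \<times> carrier G) f (\<lambda>(x, y). x \<otimes> y)
      \<in> prod_regular (carrier G) (regular G) (carrier G) (regular G)"
    using lag assms unfolding linear_algebraic_group_def variety_morphism_def by blast
  from prod_regular_expansion[OF lag_subalgebra lag_subalgebra this]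
  show ?thesis by (simp add: compose_def)
qed

lemma lag_separate:
  assumes "x \<in> carrier G" "y \<in> carrier G" "\<And>f. f \<in> regular G \<Longrightarrow> f x = f y"
  shows "x = y"
proof -
  have "algebra_hom (carrier G) (regular G) (\<lambda>f. f x)" using assms(1) by (auto simp: algebra_hom_def)
  then have "\<exists>!z. z \<in> carrier G \<and> (\<forall>f\<in>regular G. f x = f z)"
    using lag_variety unfolding affine_variety_def by blast
  then show ?thesis using assms by blast
qed

lemma regular_sum_list:
  assumes "\<And>p. p \<in> set ps \<Longrightarrow> f p \<in> regular G"
  shows "(\<lambda>x\<in>carrier G. \<Sum>p\<leftarrow>ps. f p x) \<in> regular G"
  using assms
proof (induction ps)
  case Nil
  show ?case using fun_subalgebraD(2)[OF lag_subalgebra, of 0] by (simp only: list.map sum_list.Nil UNIV_I)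
next
  case (Cons p ps)
  then have "(\<lambda>x\<in>carrier G. f p x + (\<lambda>x\<in>carrier G. \<Sum>p\<leftarrow>ps. f p x) x) \<in> regular G"
    by (intro fun_subalgebraD(3)[OF lag_subalgebra]) auto
  moreover have "(\<lambda>x\<in>carrier G. f p x + (\<lambda>x\<in>carrier G. \<Sum>p\<leftarrow>ps. f p x) x) = (\<lambda>x\<in>carrier G. \<Sum>p\<leftarrow>p # ps. f p x)"
    by (auto simp: fun_eq_iff)
  ultimately show ?case by (simp only:)
qed

lemma regular_scale:
  assumes "f \<in> regular G"
  shows "(\<lambda>x\<in>carrier G. c * f x) \<in> regular G"
proof -
  have "(\<lambda>x\<in>carrier G. (\<lambda>x\<in>carrier G. c) x * f x) \<in> regular G"
    using assms fun_subalgebraD(2,4)[OF lag_subalgebra] by blast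
  moreover have "(\<lambda>x\<in>carrier G. (\<lambda>x\<in>carrier G. c) x * f x) = (\<lambda>x\<in>carrier G. c * f x)"
    by (auto simp: fun_eq_iff)
  ultimately show ?thesis by simp
qed

lemma left_translation_morphism:
  assumes "c \<in> carrier G"
  shows "variety_morphism (carrier G) (regular G) (carrier G) (regular G) (\<lambda>x. c \<otimes> x)"
  unfolding variety_morphism_def
proof (intro conjI ballI)
  fix f assume "f \<in> regular G"
  then obtain ps where ps: "set ps \<subseteq> regular G \<times> regular G"
    "\<forall>x\<in>carrier G. \<forall>y\<in>carrier G. f (x \<otimes> y) = (\<Sum>p\<leftarrow>ps. fst p x * snd p y)" using lag_mult by blast
  have "(\<lambda>x\<in>carrier G. \<Sum>p\<leftarrow>ps. (\<lambda>x\<in>carrier G. fst p c * snd p x) x) \<in> regular G"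
    using ps(1) by (intro regular_sum_list regular_scale) auto
  moreover have "(\<lambda>x\<in>carrier G. \<Sum>p\<leftarrow>ps. (\<lambda>x\<in>carrier G. fst p c * snd p x) x) = compose (carrier G) f (\<lambda>x. c \<otimes> x)"
    using ps(2) assms by (auto simp: fun_eq_iff compose_def)
  ultimately show "compose (carrier G) f (\<lambda>x. c \<otimes> x) \<in> regular G" by simp
qed (use assms in auto)

lemma right_translation_morphism:
  assumes "c \<in> carrier G"
  shows "variety_morphism (carrier G) (regular G) (carrier G) (regular G) (\<lambda>x. x \<otimes> c)"
  unfolding variety_morphism_def
proof (intro conjI ballI)
  fix f assume "f \<in> regular G"
  then obtain ps where ps: "set ps \<subseteq> regular G \<times> regular G"
    "\<forall>x\<in>carrier G. \<forall>y\<in>carrier G. f (x \<otimes> y) = (\<Sum>p\<leftarrow>ps. fst p x * snd p y)" using lag_mult by blast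
  have "(\<lambda>x\<in>carrier G. \<Sum>p\<leftarrow>ps. (\<lambda>x\<in>carrier G. snd p c * fst p x) x) \<in> regular G"
    using ps(1) by (intro regular_sum_list regular_scale) auto
  moreover have "(\<lambda>x\<in>carrier G. \<Sum>p\<leftarrow>ps. (\<lambda>x\<in>carrier G. snd p c * fst p x) x) = compose (carrier G) f (\<lambda>x. x \<otimes> c)"
    using ps(2) assms by (auto simp: fun_eq_iff compose_def mult.commute)
  ultimately show "compose (carrier G) f (\<lambda>x. x \<otimes> c) \<in> regular G" by simp
qed (use assms in auto)

lemma openin_principal: "f \<in> regular G \<Longrightarrow> openin (zariski_group G) {x \<in> carrier G. f x \<noteq> 0}"
  unfolding openin_zariski[OF lag_subalgebra] zariski_open_iff by (intro exI[of _ "{f}"]) auto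

lemma openin_zariski_iff:
  "openin (zariski_group G) U \<longleftrightarrow> U \<subseteq> carrier G \<and> (\<forall>x\<in>U. \<exists>f\<in>regular G. f x \<noteq> 0 \<and> {y \<in> carrier G. f y \<noteq> 0} \<subseteq> U)"
proof
  assume "openin (zariski_group G) U"
  then obtain S where "S \<subseteq> regular G" "\<forall>x. x \<in> U \<longleftrightarrow> x \<in> carrier G \<and> (\<exists>f\<in>S. f x \<noteq> 0)"
    unfolding openin_zariski[OF lag_subalgebra] zariski_open_iff by blast
  then show "U \<subseteq> carrier G \<and> (\<forall>x\<in>U. \<exists>f\<in>regular G. f x \<noteq> 0 \<and> {y \<in> carrier G. f y \<noteq> 0} \<subseteq> U)" by blast
next
  assume U: "U \<subseteq> carrier G \<and> (\<forall>x\<in>U. \<exists>f\<in>regular G. f x \<noteq> 0 \<and> {y \<in> carrier G. f y \<noteq> 0} \<subseteq> U)"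
  have "\<exists>T. openin (zariski_group G) T \<and> x \<in> T \<and> T \<subseteq> U" if "x \<in> U" for x
  proof -
    obtain f where "f \<in> regular G" "f x \<noteq> 0" "{y \<in> carrier G. f y \<noteq> 0} \<subseteq> U" using U \<open>x \<in> U\<close> by blast
    then show ?thesis using openin_principal U \<open>x \<in> U\<close> by (intro exI[of _ "{y \<in> carrier G. f y \<noteq> 0}"]) auto
  qed
  then show "openin (zariski_group G) U" using openin_subopen[of "zariski_group G" U] by blast
qed

lemma topspace_zariski_group: "topspace (zariski_group G) = carrier G"
proof
  show "topspace (zariski_group G) \<subseteq> carrier G" using openin_zariski_iff openin_topspace by blast
  have "(\<lambda>x\<in>carrier G. 1) \<in> regular G" using fun_subalgebraD(2)[OF lag_subalgebra] by simp
  from openin_subset[OF openin_principal[OF this]] show "carrier G \<subseteq> topspace (zariski_group G)" by auto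
qed

lemma closedin_zeros:
  assumes "S \<subseteq> regular G"
  shows "closedin (zariski_group G) {x \<in> carrier G. \<forall>f\<in>S. f x = 0}"
proof -
  have "carrier G - {x \<in> carrier G. \<forall>f\<in>S. f x = 0} = (\<Union>f\<in>S. {x \<in> carrier G. f x \<noteq> 0})" by auto
  moreover have "openin (zariski_group G) (\<Union>f\<in>S. {x \<in> carrier G. f x \<noteq> 0})" using assms openin_principal by blast
  ultimately show ?thesis unfolding closedin_def topspace_zariski_group by auto
qed

lemma closedin_zariski_zeros:
  assumes "closedin (zariski_group G) K"
  shows "\<exists>S\<subseteq>regular G. K = {x \<in> carrier G. \<forall>f\<in>S. f x = 0}"
proof -
  have K: "K \<subseteq> carrier G" "openin (zariski_group G) (carrier G - K)" using assms by (auto simp: closedin_def topspace_zariski_group)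
  then obtain S where "S \<subseteq> regular G" "\<forall>x. x \<in> carrier G - K \<longleftrightarrow> x \<in> carrier G \<and> (\<exists>f\<in>S. f x \<noteq> 0)"
    unfolding openin_zariski[OF lag_subalgebra] zariski_open_iff by blast
  then show ?thesis using K by (intro exI[of _ S]) blast
qed

lemma morphism_continuous:
  assumes "variety_morphism (carrier G) (regular G) (carrier G) (regular G) \<phi>"
  shows "continuous_map (zariski_group G) (zariski_group G) \<phi>"
  unfolding continuous_map_def topspace_zariski_group
proof (intro conjI allI impI)
  have \<phi>: "\<phi> \<in> carrier G \<rightarrow> carrier G" "\<And>f. f \<in> regular G \<Longrightarrow> compose (carrier G) f \<phi> \<in> regular G"
    using assms by (auto simp: variety_morphism_def)
  show "\<phi> \<in> carrier G \<rightarrow> carrier G" by (rule \<phi>(1))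
  fix U assume U: "openin (zariski_group G) U"
  show "openin (zariski_group G) {x \<in> carrier G. \<phi> x \<in> U}"
    unfolding openin_zariski_iff
  proof (intro conjI ballI)
    fix x assume x: "x \<in> {x \<in> carrier G. \<phi> x \<in> U}"
    then obtain f where f: "f \<in> regular G" "f (\<phi> x) \<noteq> 0" "{y \<in> carrier G. f y \<noteq> 0} \<subseteq> U"
      using U unfolding openin_zariski_iff by blast
    show "\<exists>f\<in>regular G. f x \<noteq> 0 \<and> {y \<in> carrier G. f y \<noteq> 0} \<subseteq> {x \<in> carrier G. \<phi> x \<in> U}"
      using f x \<phi> by (intro bexI[of _ "compose (carrier G) f \<phi>"]) (auto simp: compose_def)
  qed auto
qed

lemma conjugation_continuous:
  assumes "c \<in> carrier G"
  shows "continuous_map (zariski_group G) (zariski_group G) (\<lambda>x. c \<otimes> x \<otimes> inv c)"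
proof -
  have "continuous_map (zariski_group G) (zariski_group G) ((\<lambda>x. x \<otimes> inv c) \<circ> (\<lambda>x. c \<otimes> x))"
    using assms
    by (intro continuous_map_compose[of "zariski_group G" "zariski_group G" _ "zariski_group G"] morphism_continuous left_translation_morphism right_translation_morphism)
      auto
  then show ?thesis by (simp add: comp_def)
qed

section \<open>Centralisers and identity components\<close>

lemma centralizer_subgroup:
  assumes "A \<subseteq> carrier G"
  shows "subgroup (centralizer G A) G"
proof (rule subgroupI)
  show "centralizer G A \<noteq> {}" using assms by (auto simp: centralizer_def intro!: exI[of _ \<one>])
next
  fix x assume x: "x \<in> centralizer G A"
  have "inv x \<otimes> a = a \<otimes> inv x" if "a \<in> A" for a
  proof -
    have a: "a \<in> carrier G" "x \<in> carrier G" "x \<otimes> a = a \<otimes> x" using x that assms by (auto simp: centralizer_def)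
    have "inv x \<otimes> (a \<otimes> x) \<otimes> inv x = a \<otimes> inv x"
      unfolding a(3)[symmetric] using a(1,2) by (simp add: inv_mult_cancel)
    then show ?thesis using a(1,2) by (simp add: m_assoc)
  qed
  then show "inv x \<in> centralizer G A" using x by (auto simp: centralizer_def)
next
  fix x y assume xy: "x \<in> centralizer G A" "y \<in> centralizer G A"
  have "x \<otimes> y \<otimes> a = a \<otimes> (x \<otimes> y)" if "a \<in> A" for a
  proof -
    have a: "a \<in> carrier G" "x \<in> carrier G" "y \<in> carrier G" "x \<otimes> a = a \<otimes> x" "y \<otimes> a = a \<otimes> y"
      using xy that assms by (auto simp: centralizer_def)
    have "x \<otimes> y \<otimes> a = x \<otimes> (y \<otimes> a)" using a(1-3) by (simp add: m_assoc)
    also have "\<dots> = x \<otimes> a \<otimes> y" unfolding a(5) using a(1-3) by (simp add: m_assoc)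
    finally show ?thesis unfolding a(4) using a(1-3) by (simp add: m_assoc)
  qed
  then show "x \<otimes> y \<in> centralizer G A" using xy by (auto simp: centralizer_def)
qed (auto simp: centralizer_def)

text \<open>
  It is the zero set of the functions \<open>f (x \<otimes> a) - f (a \<otimes> x)\<close>, as regular functions separate points.
\<close>

lemma centralizer_closed:
  assumes A: "A \<subseteq> carrier G"
  shows "closedin (zariski_group G) (centralizer G A)"
proof -
  define D where "D = (\<lambda>(f, a). \<lambda>x\<in>carrier G. f (x \<otimes> a) + (- 1) * f (a \<otimes> x)) ` (regular G \<times> A)"
  have "D \<subseteq> regular G"
  proof
    fix h assume "h \<in> D"
    then obtain f a where fa: "f \<in> regular G" "a \<in> A" "h = (\<lambda>x\<in>carrier G. f (x \<otimes> a) + (- 1) * f (a \<otimes> x))"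
      by (auto simp: D_def)
    have a: "a \<in> carrier G" using fa(2) A by blast
    have "compose (carrier G) f (\<lambda>x. x \<otimes> a) \<in> regular G" "compose (carrier G) f (\<lambda>x. a \<otimes> x) \<in> regular G"
      using fa(1) left_translation_morphism[OF a] right_translation_morphism[OF a] by (auto simp: variety_morphism_def)
    then have "(\<lambda>x\<in>carrier G. compose (carrier G) f (\<lambda>x. x \<otimes> a) x
        + (\<lambda>x\<in>carrier G. (- 1) * compose (carrier G) f (\<lambda>x. a \<otimes> x) x) x) \<in> regular G"
      by (intro fun_subalgebraD(3)[OF lag_subalgebra] regular_scale)
    moreover have "(\<lambda>x\<in>carrier G. compose (carrier G) f (\<lambda>x. x \<otimes> a) x
        + (\<lambda>x\<in>carrier G. (- 1) * compose (carrier G) f (\<lambda>x. a \<otimes> x) x) x) = h"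
      unfolding fa(3) by (auto simp: fun_eq_iff compose_def)
    ultimately show "h \<in> regular G" by simp
  qed
  moreover have "centralizer G A = {x \<in> carrier G. \<forall>h\<in>D. h x = 0}"
  proof -
    have "x \<otimes> a = a \<otimes> x \<longleftrightarrow> (\<forall>f\<in>regular G. f (x \<otimes> a) + (- 1) * f (a \<otimes> x) = 0)"
      if "x \<in> carrier G" "a \<in> A" for x a
    proof
      assume "\<forall>f\<in>regular G. f (x \<otimes> a) + (- 1) * f (a \<otimes> x) = 0"
      then show "x \<otimes> a = a \<otimes> x" using that A by (intro lag_separate) auto
    qed auto
    then show ?thesis by (auto simp: centralizer_def D_def)
  qed
  ultimately show ?thesis using closedin_zeros by simp
qed

context
  fixes C assumes C: "subgroup C G"
begin

lemma identity_component_subset: "identity_component G C \<subseteq> C"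
  using connected_component_of_subset_topspace[of "subtopology (zariski_group G) C" \<one>] by (auto simp: identity_component_def)

lemma identity_component_connected: "connectedin (zariski_group G) (identity_component G C)"
  using connectedin_connected_component_of[of "subtopology (zariski_group G) C" \<one>]
  by (simp add: identity_component_def connectedin_subtopology)

lemma one_in_identity_component: "\<one> \<in> identity_component G C"
proof -
  have "\<one> \<in> topspace (subtopology (zariski_group G) C)"
    using subgroup.one_closed[OF C] by (simp add: topspace_zariski_group)
  then show ?thesis unfolding identity_component_def mem_Collect_eq connected_component_of_refl .
qed

lemma connected_subset_identity_component:
  assumes "connectedin (zariski_group G) S" "S \<subseteq> C" "\<one> \<in> S"
  shows "S \<subseteq> identity_component G C"
  unfolding identity_component_def using assms
  by (intro connected_component_of_maximal) (auto simp: connectedin_subtopology)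

lemma identity_component_closed:
  assumes "closedin (zariski_group G) C"
  shows "closedin (zariski_group G) (identity_component G C)"
  unfolding identity_component_def
  using closedin_trans_full[OF closedin_connected_component_of assms] .

end

lemma identity_component_image:
  assumes "subgroup C G" "subgroup C' G" "continuous_map (zariski_group G) (zariski_group G) \<phi>" "\<phi> ` C \<subseteq> C'" "\<phi> \<one> = \<one>"
  shows "\<phi> ` identity_component G C \<subseteq> identity_component G C'"
proof (rule connected_subset_identity_component[OF assms(2)])
  show "connectedin (zariski_group G) (\<phi> ` identity_component G C)"
    by (rule connectedin_continuous_map_image[OF assms(3) identity_component_connected[OF assms(1)]])
  show "\<phi> ` identity_component G C \<subseteq> C'" using identity_component_subset[OF assms(1)] assms(4) by blast
  show "\<one> \<in> \<phi> ` identity_component G C"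
    using one_in_identity_component[OF assms(1)] assms(5) by force
qed

lemma identity_component_subgroup:
  assumes C: "subgroup C G"
  shows "subgroup (identity_component G C) G"
proof -
  let ?I = "identity_component G C"
  have sub: "?I \<subseteq> carrier G" using identity_component_subset[OF C] subgroup.subset[OF C] by blast
  \<comment> \<open>For \<open>c\<close> in the component, its translate by \<open>inv c\<close> is connected and contains the identity.\<close>
  have div: "inv c \<otimes> d \<in> ?I" if c: "c \<in> ?I" "d \<in> ?I" for c d
  proof -
    have cC: "c \<in> C" "c \<in> carrier G" using c identity_component_subset[OF C] sub by auto
    have "(\<lambda>x. inv c \<otimes> x) ` ?I \<subseteq> ?I"
    proof (rule connected_subset_identity_component[OF C])
      show "connectedin (zariski_group G) ((\<lambda>x. inv c \<otimes> x) ` ?I)"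
        using cC by (intro connectedin_continuous_map_image[OF _ identity_component_connected[OF C]]
            morphism_continuous left_translation_morphism) auto
      show "(\<lambda>x. inv c \<otimes> x) ` ?I \<subseteq> C"
        using cC identity_component_subset[OF C] subgroup.m_closed[OF C] subgroup.m_inv_closed[OF C] by blast
      show "\<one> \<in> (\<lambda>x. inv c \<otimes> x) ` ?I" using c cC by (intro image_eqI[of _ _ c]) auto
    qed
    then show ?thesis using c by blast
  qed
  have inv: "inv c \<in> ?I" if "c \<in> ?I" for c
    using div[OF that one_in_identity_component[OF C]] that sub by auto
  show ?thesis
  proof (rule subgroupI)
    fix c d assume "c \<in> ?I" "d \<in> ?I"
    then show "c \<otimes> d \<in> ?I" using div[OF inv[of c], of d] sub by auto
  qed (use sub inv one_in_identity_component[OF C] in auto)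
qed

end

section \<open>The Lang-Steinberg theorem for closed subgroups\<close>

definition retraction :: "('a, 'm) monoid_scheme \<Rightarrow> 'a set \<Rightarrow> 'a \<Rightarrow> 'a" where
  "retraction G H = (\<lambda>x. if x \<in> H then x else \<one>\<^bsub>G\<^esub>)"

definition coordinate_ring :: "('a, 'k::alg_closed_field) alg_group \<Rightarrow> 'a set \<Rightarrow> ('a \<Rightarrow> 'k) set" where
  "coordinate_ring G H = (\<lambda>f. f \<circ> retraction G H) ` regular G"

context
  fixes G :: "('a, 'k::alg_closed_field) alg_group" (structure) and H :: "'a set"
  assumes lag: "linear_algebraic_group G" and H: "subgroup H G"
begin

interpretation group G by (rule lag_group[OF lag])

lemma retraction_in: "retraction G H x \<in> H"
  and retraction_id: "x \<in> H \<Longrightarrow> retraction G H x = x"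
  and retraction_carrier: "retraction G H x \<in> carrier G"
  using subgroup.one_closed[OF H] subgroup.subset[OF H] by (auto simp: retraction_def)

lemma retraction_idem: "retraction G H (retraction G H x) = retraction G H x"
  by (rule retraction_id[OF retraction_in])

lemma coordinate_ringI: "f \<in> regular G \<Longrightarrow> f \<circ> retraction G H \<in> coordinate_ring G H"
  by (auto simp: coordinate_ring_def)

lemma restrict_comp_retraction: "restrict f (carrier G) \<circ> retraction G H = f \<circ> retraction G H"
  by (simp add: fun_eq_iff retraction_carrier)

lemma compose_comp_retraction:
  "compose (carrier G) f \<phi> \<circ> retraction G H = (\<lambda>x. f (\<phi> (retraction G H x)))"
  by (simp add: fun_eq_iff compose_def retraction_carrier)

lemmas regular_subalgebra = fun_subalgebraD[OF lag_subalgebra[OF lag]]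

lemma coordinate_ring_constants: "constants \<subseteq> coordinate_ring G H"
proof
  fix b :: "'a \<Rightarrow> 'k" assume "b \<in> constants"
  then obtain c where c: "b = (\<lambda>_. c)" by (auto simp: constants_iff)
  have "(\<lambda>x\<in>carrier G. c) \<circ> retraction G H \<in> coordinate_ring G H" by (intro coordinate_ringI regular_subalgebra(2)) simp
  moreover have "(\<lambda>x\<in>carrier G. c) \<circ> retraction G H = b"
    unfolding restrict_comp_retraction c by (simp add: comp_def)
  ultimately show "b \<in> coordinate_ring G H" by simp
qed

lemma coordinate_ring_add_mult:
  assumes "b \<in> coordinate_ring G H" "c \<in> coordinate_ring G H"
  shows "b + c \<in> coordinate_ring G H" "b * c \<in> coordinate_ring G H"
proof -
  obtain f g where fg: "f \<in> regular G" "g \<in> regular G" "b = f \<circ> retraction G H" "c = g \<circ> retraction G H"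
    using assms by (auto simp: coordinate_ring_def)
  have "b + c = (\<lambda>x\<in>carrier G. f x + g x) \<circ> retraction G H" "b * c = (\<lambda>x\<in>carrier G. f x * g x) \<circ> retraction G H"
    unfolding restrict_comp_retraction by (simp_all add: fg fun_eq_iff)
  then show "b + c \<in> coordinate_ring G H" "b * c \<in> coordinate_ring G H"
    using coordinate_ringI[OF regular_subalgebra(3)[OF fg(1,2)]] coordinate_ringI[OF regular_subalgebra(4)[OF fg(1,2)]] by simp_all
qed

lemma coordinate_ring_subring: "is_subring (coordinate_ring G H)"
  unfolding is_subring_def
proof (intro conjI ballI)
  have const: "(\<lambda>_. c) \<in> coordinate_ring G H" for c
    by (rule constants_subset_member[OF coordinate_ring_constants])
  show "1 \<in> coordinate_ring G H" unfolding one_fun_def by (rule const)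
  fix b c assume bc: "b \<in> coordinate_ring G H" "c \<in> coordinate_ring G H"
  have "b - c = b + (\<lambda>_. - 1) * c" by (simp add: fun_eq_iff)
  then show "b - c \<in> coordinate_ring G H" using bc const coordinate_ring_add_mult by metis
  show "b * c \<in> coordinate_ring G H" by (rule coordinate_ring_add_mult(2)[OF bc])
qed

lemma coordinate_ring_generated:
  "\<exists>T. finite T \<and> T \<subseteq> coordinate_ring G H \<and>
     (\<forall>X. is_subring X \<longrightarrow> constants \<union> T \<subseteq> X \<longrightarrow> coordinate_ring G H \<subseteq> X)"
proof -
  obtain T where T: "finite T" "T \<subseteq> regular G" "regular G = fun_subalgebra UNIV (carrier G) hull T"
    using lag_variety[OF lag] unfolding affine_variety_def finitely_generated_algebra_def by blast
  show ?thesis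
  proof (intro exI[of _ "(\<lambda>f. f \<circ> retraction G H) ` T"] conjI allI impI)
    fix X :: "('a \<Rightarrow> 'k) set" assume X: "is_subring X" "constants \<union> (\<lambda>f. f \<circ> retraction G H) ` T \<subseteq> X"
    let ?t = "{f \<in> extensional (carrier G). f \<circ> retraction G H \<in> X}"
    have "fun_subalgebra UNIV (carrier G) ?t"
      unfolding fun_subalgebra_def
    proof (intro conjI ballI)
      fix c :: 'k
      have "(\<lambda>_. c) \<in> X" using X(2) by (auto simp: constants_def)
      then show "(\<lambda>x\<in>carrier G. c) \<in> ?t" unfolding mem_Collect_eq restrict_comp_retraction by (simp add: comp_def)
    next
      fix f g assume fg: "f \<in> ?t" "g \<in> ?t"
      have "(\<lambda>x. f x + g x) \<circ> retraction G H = (f \<circ> retraction G H) + (g \<circ> retraction G H)"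
        "(\<lambda>x. f x * g x) \<circ> retraction G H = (f \<circ> retraction G H) * (g \<circ> retraction G H)"
        by (simp_all add: fun_eq_iff)
      then show "(\<lambda>x\<in>carrier G. f x + g x) \<in> ?t" "(\<lambda>x\<in>carrier G. f x * g x) \<in> ?t"
        unfolding mem_Collect_eq restrict_comp_retraction
        using fg subring_add[OF X(1)] subring_mult[OF X(1)] by simp_all
    qed auto
    moreover have "T \<subseteq> ?t" using T(2) X(2) regular_subalgebra(1) by blast
    ultimately have "regular G \<subseteq> ?t" unfolding T(3) by (intro hull_minimal)
    then show "coordinate_ring G H \<subseteq> X" by (auto simp: coordinate_ring_def)
  qed (use T in \<open>auto intro: coordinate_ringI\<close>)
qed

text \<open>
  A character of the coordinate ring of \<open>H\<close> restricts to one of the coordinate ring of \<open>G\<close>, hence is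
  evaluation at a point of \<open>G\<close>; the equations defining \<open>H\<close> vanish there.
\<close>

lemma coordinate_ring_points:
  assumes closed: "closedin (zariski_group G) H"
    and const: "\<And>c. \<phi> (\<lambda>_. c) = c"
    and hom: "\<And>b c. b \<in> coordinate_ring G H \<Longrightarrow> c \<in> coordinate_ring G H \<Longrightarrow>
        \<phi> (b + c) = \<phi> b + \<phi> c \<and> \<phi> (b * c) = \<phi> b * \<phi> c"
  shows "\<exists>!x. x \<in> H \<and> (\<forall>b\<in>coordinate_ring G H. \<phi> b = b x)"
proof -
  let ?\<psi> = "\<lambda>f. \<phi> (f \<circ> retraction G H)"
  have "algebra_hom (carrier G) (regular G) ?\<psi>"
    unfolding algebra_hom_def restrict_comp_retraction
  proof (intro conjI allI ballI)
    show "\<phi> ((\<lambda>_. c) \<circ> retraction G H) = c" for c using const[of c] by (simp add: comp_def)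
  next
    fix f g assume "f \<in> regular G" "g \<in> regular G"
    then have "f \<circ> retraction G H \<in> coordinate_ring G H" "g \<circ> retraction G H \<in> coordinate_ring G H"
      by (auto intro: coordinate_ringI)
    from hom[OF this] show "\<phi> ((\<lambda>x. f x + g x) \<circ> retraction G H) = ?\<psi> f + ?\<psi> g"
      "\<phi> ((\<lambda>x. f x * g x) \<circ> retraction G H) = ?\<psi> f * ?\<psi> g"
      by (simp_all add: comp_def plus_fun_def times_fun_def)
  qed
  then have ex: "\<exists>!x. x \<in> carrier G \<and> (\<forall>f\<in>regular G. ?\<psi> f = f x)"
    using lag_variety[OF lag] unfolding affine_variety_def by blast
  then obtain x where x: "x \<in> carrier G" "\<And>f. f \<in> regular G \<Longrightarrow> ?\<psi> f = f x" by blast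
  obtain S where S: "S \<subseteq> regular G" "H = {x \<in> carrier G. \<forall>f\<in>S. f x = 0}"
    using closedin_zariski_zeros[OF lag closed] by blast
  have "f x = 0" if "f \<in> S" for f
  proof -
    have "f \<circ> retraction G H = (\<lambda>_. 0)" using that S(2) retraction_in by (auto simp: fun_eq_iff)
    then show ?thesis using x(2)[of f] const[of 0] that S(1) by auto
  qed
  then have xH: "x \<in> H" using S(2) x(1) by blast
  show ?thesis
  proof (rule ex1I[of _ x])
    show "x \<in> H \<and> (\<forall>b\<in>coordinate_ring G H. \<phi> b = b x)"
      using xH x(2) by (auto simp: coordinate_ring_def retraction_id)
  next
    fix y assume y: "y \<in> H \<and> (\<forall>b\<in>coordinate_ring G H. \<phi> b = b y)"
    then have "y \<in> carrier G" "\<forall>f\<in>regular G. ?\<psi> f = f y"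
      using subgroup.subset[OF H] by (auto simp: coordinate_ring_def retraction_id)
    then show "y = x" using ex x by blast
  qed
qed

lemma closed_subgroup_affine_group:
  assumes closed: "closedin (zariski_group G) H"
  shows "affine_group (G\<lparr>carrier := H\<rparr>) (coordinate_ring G H) (retraction G H)"
proof (intro affine_group.intro affine_group_axioms.intro)
  show "Group.group (G\<lparr>carrier := H\<rparr>)" by (rule subgroup_imp_group[OF H])
  show "retraction G H = (\<lambda>x. if x \<in> carrier (G\<lparr>carrier := H\<rparr>) then x else \<one>\<^bsub>G\<lparr>carrier := H\<rparr>\<^esub>)"
    by (auto simp: retraction_def fun_eq_iff)
  show "is_subring (coordinate_ring G H)" by (rule coordinate_ring_subring)
  show "constants \<subseteq> coordinate_ring G H" by (rule coordinate_ring_constants)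
  show "\<exists>T. finite T \<and> T \<subseteq> coordinate_ring G H \<and>
     (\<forall>X. is_subring X \<longrightarrow> constants \<union> T \<subseteq> X \<longrightarrow> coordinate_ring G H \<subseteq> X)"
    by (rule coordinate_ring_generated)
next
  fix b assume "b \<in> coordinate_ring G H"
  then obtain f where f: "f \<in> regular G" "b = f \<circ> retraction G H" by (auto simp: coordinate_ring_def)
  show "b (retraction G H x) = b x" for x by (simp add: f retraction_idem)
  obtain ps where ps: "set ps \<subseteq> regular G \<times> regular G"
    "\<forall>x\<in>carrier G. \<forall>y\<in>carrier G. f (x \<otimes> y) = (\<Sum>p\<leftarrow>ps. fst p x * snd p y)"
    using lag_mult[OF lag f(1)] by blast
  have "b (x \<otimes> y) = (\<Sum>p\<leftarrow>ps. (fst p \<circ> retraction G H) x * (snd p \<circ> retraction G H) y)" if "x \<in> H" "y \<in> H" for x y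
    using that ps(2) subgroup.subset[OF H] subgroup.m_closed[OF H] by (simp add: f retraction_id subset_iff)
  then show "\<exists>ps. set ps \<subseteq> coordinate_ring G H \<times> coordinate_ring G H \<and>
      (\<forall>x\<in>carrier (G\<lparr>carrier := H\<rparr>). \<forall>y\<in>carrier (G\<lparr>carrier := H\<rparr>).
        b (x \<otimes>\<^bsub>G\<lparr>carrier := H\<rparr>\<^esub> y) = (\<Sum>p\<leftarrow>ps. fst p x * snd p y))"
    using ps(1)
    by (intro exI[of _ "map (\<lambda>p. (fst p \<circ> retraction G H, snd p \<circ> retraction G H)) ps"])
      (force simp: comp_def intro: coordinate_ringI[unfolded comp_def])
  have "compose (carrier G) f (\<lambda>x. inv x) \<in> regular G"
    using lag_inv[OF lag] f(1) by (auto simp: variety_morphism_def)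
  from coordinate_ringI[OF this]
  have "(\<lambda>x. f (inv (retraction G H x))) \<in> coordinate_ring G H" unfolding compose_comp_retraction .
  moreover have "b (inv\<^bsub>G\<lparr>carrier := H\<rparr>\<^esub> (retraction G H x)) = f (inv (retraction G H x))" for x
    by (simp add: f m_inv_consistent[OF H retraction_in] retraction_id subgroup.m_inv_closed[OF H retraction_in])
  ultimately show "(\<lambda>x. b (inv\<^bsub>G\<lparr>carrier := H\<rparr>\<^esub> (retraction G H x))) \<in> coordinate_ring G H"
    by (simp only:)
next
  fix \<phi> :: "('a \<Rightarrow> 'k) \<Rightarrow> 'k"
  assume const: "\<And>c. \<phi> (\<lambda>_. c) = c"
    and hom: "\<And>b c. b \<in> coordinate_ring G H \<Longrightarrow> c \<in> coordinate_ring G H \<Longrightarrow>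
      \<phi> (b + c) = \<phi> b + \<phi> c \<and> \<phi> (b * c) = \<phi> b * \<phi> c"
  have "\<exists>!x. x \<in> H \<and> (\<forall>b\<in>coordinate_ring G H. \<phi> b = b x)"
    by (rule coordinate_ring_points[OF closed]) (rule const, rule hom)
  moreover have "carrier (G\<lparr>carrier := H\<rparr>) = H" by simp
  ultimately show "\<exists>!x. x \<in> carrier (G\<lparr>carrier := H\<rparr>) \<and> (\<forall>b\<in>coordinate_ring G H. \<phi> b = b x)"
    by (simp only:)
qed

theorem lang_steinberg_closed_subgroup:
  assumes closed: "closedin (zariski_group G) H" and connected: "connectedin (zariski_group G) H"
    and char: "CHAR('k) > 0" and F: "steinberg_endomorphism G F" "F ` H \<subseteq> H" and d: "d \<in> H"
  shows "\<exists>x\<in>H. x \<otimes> inv (F x) = d"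
proof -
  let ?H = "G\<lparr>carrier := H\<rparr>" and ?B = "coordinate_ring G H" and ?r = "retraction G H"
  interpret A: affine_group ?H ?B ?r by (rule closed_subgroup_affine_group[OF closed])
  obtain m e where me: "0 < e" "frobenius_morphism (CHAR('k) ^ e) G (F ^^ m)"
    using F(1) unfolding steinberg_endomorphism_def by blast
  obtain A\<^sub>0 where A\<^sub>0: "Fq_structure (CHAR('k) ^ e) (carrier G) (regular G) A\<^sub>0"
    "\<forall>f\<in>A\<^sub>0. compose (carrier G) f (F ^^ m) = (\<lambda>x\<in>carrier G. f x ^ CHAR('k) ^ e)"
    using me(2) unfolding frobenius_morphism_def by blast
  have Fhom: "F \<in> hom G G" and Fvar: "variety_morphism (carrier G) (regular G) (carrier G) (regular G) F"
    using F(1) unfolding steinberg_endomorphism_def algebraic_endomorphism_def by blast+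
  have FH: "F x \<in> H" if "x \<in> H" for x using F(2) that by blast
  have regular_endo: "A.regular_endo F"
    unfolding A.regular_endo_def A.regular_map_def
  proof (intro conjI allI ballI)
    show "F \<in> hom ?H ?H" using Fhom FH subgroup.subset[OF H] by (auto simp: hom_def subset_iff)
    show "(F \<circ> ?r) x \<in> carrier ?H" for x using FH[OF retraction_in] by simp
    fix b assume "b \<in> ?B"
    then obtain f where f: "f \<in> regular G" "b = f \<circ> ?r" by (auto simp: coordinate_ring_def)
    have "compose (carrier G) f F \<in> regular G" using Fvar f(1) by (auto simp: variety_morphism_def)
    from coordinate_ringI[OF this] have "(\<lambda>x. f (F (?r x))) \<in> ?B" unfolding compose_comp_retraction .
    moreover have "b \<circ> (F \<circ> ?r) = (\<lambda>x. f (F (?r x)))"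
      by (simp add: fun_eq_iff f(2) retraction_id FH retraction_in)
    ultimately show "b \<circ> (F \<circ> ?r) \<in> ?B" by simp
  qed
  let ?A = "(\<lambda>f. f \<circ> ?r) ` A\<^sub>0"
  have A0sub: "A\<^sub>0 \<subseteq> regular G" using A\<^sub>0(1) by (simp add: Fq_structure_def)
  have span: "\<forall>f\<in>regular G. \<exists>T c. finite T \<and> T \<subseteq> A\<^sub>0 \<and> f = (\<lambda>x\<in>carrier G. \<Sum>t\<in>T. c t * t x)"
    using A\<^sub>0(1) unfolding Fq_structure_def by (elim conjE)
  interpret S: affine_group_steinberg ?H ?B ?r F m "CHAR('k) ^ e" e ?A
  proof (intro affine_group_steinberg.intro affine_group_steinberg_axioms.intro)
    show "affine_group ?H ?B ?r" by (rule A.affine_group_axioms)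
    show "A.regular_endo F" by (rule regular_endo)
    show "?A \<subseteq> ?B" using A0sub by (auto intro: coordinate_ringI)
    show "?B \<subseteq> rspan constants ?A"
    proof
      fix b assume "b \<in> ?B"
      then obtain f where f: "f \<in> regular G" "b = f \<circ> ?r" by (auto simp: coordinate_ring_def)
      obtain T c where T: "finite T" "T \<subseteq> A\<^sub>0" "f = (\<lambda>x\<in>carrier G. \<Sum>t\<in>T. c t * t x)"
        using span[rule_format, OF f(1)] by (elim exE conjE)
      have "b = (\<Sum>t\<in>T. (\<lambda>_. c t) * (t \<circ> ?r))"
        unfolding f(2) T(3) restrict_comp_retraction by (simp add: fun_eq_iff sum_fun_apply)
      also have "\<dots> \<in> rspan constants ?A"
        using T(2) by (intro rspan_sum rspan_gen) (auto simp: constants_iff)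
      finally show "b \<in> rspan constants ?A" .
    qed
    show "t ((F ^^ m) x) = t x ^ CHAR('k) ^ e" if tx: "t \<in> ?A" "x \<in> carrier ?H" for t x
    proof -
      obtain f where f: "f \<in> A\<^sub>0" "t = f \<circ> ?r" using tx(1) by blast
      have "(F ^^ m) x \<in> H" using tx(2) by (induction m) (auto intro: FH)
      moreover have "x \<in> carrier G" "x \<in> H" using tx(2) subgroup.subset[OF H] by auto
      moreover from this have "f ((F ^^ m) x) = f x ^ CHAR('k) ^ e"
        using fun_cong[OF A\<^sub>0(2)[rule_format, OF f(1)], of x] by (simp add: compose_def)
      ultimately show ?thesis by (simp add: f(2) retraction_id)
    qed
    show "prime CHAR('k)" using char by (rule prime_CHAR_semidom)
  qed (use me in auto)
  have "\<exists>x\<in>carrier ?H. x \<otimes>\<^bsub>?H\<^esub> inv\<^bsub>?H\<^esub> (F x) = d"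
  proof (rule S.lang_steinberg)
    show "d \<in> carrier ?H" using d by simp
  next
    let ?Z = "zariski_group G"
    have local_open: "openin (subtopology ?Z H) U"
      if U: "U \<subseteq> H" "\<And>x. x \<in> U \<Longrightarrow> \<exists>h\<in>?B. h x \<noteq> 0 \<and> {y \<in> H. h y \<noteq> 0} \<subseteq> U" for U
    proof -
      have "\<exists>T. openin (subtopology ?Z H) T \<and> x \<in> T \<and> T \<subseteq> U" if x: "x \<in> U" for x
      proof -
        obtain h where h: "h \<in> ?B" "h x \<noteq> 0" "{y \<in> H. h y \<noteq> 0} \<subseteq> U" using U(2)[OF x] by blast
        obtain f where f: "f \<in> regular G" "h = f \<circ> ?r" using h(1) unfolding coordinate_ring_def by blast
        have "openin (subtopology ?Z H) ({y \<in> carrier G. f y \<noteq> 0} \<inter> H)"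
          using openin_principal[OF lag f(1)] by (auto simp: openin_subtopology)
        moreover have "{y \<in> carrier G. f y \<noteq> 0} \<inter> H = {y \<in> H. h y \<noteq> 0}"
          using subgroup.subset[OF H] by (auto simp: f(2) retraction_id)
        moreover have "x \<in> {y \<in> H. h y \<noteq> 0}" using h(2) x U(1) by blast
        ultimately show ?thesis using h(3) by metis
      qed
      then show ?thesis using openin_subopen[of "subtopology ?Z H" U] by blast
    qed
    fix U assume U: "U \<subseteq> carrier ?H"
      and 1: "\<And>x. x \<in> U \<Longrightarrow> \<exists>h\<in>?B. h x \<noteq> 0 \<and> {y \<in> carrier ?H. h y \<noteq> 0} \<subseteq> U"
      and 2: "\<And>x. x \<in> carrier ?H - U \<Longrightarrow> \<exists>h\<in>?B. h x \<noteq> 0 \<and> {y \<in> carrier ?H. h y \<noteq> 0} \<subseteq> carrier ?H - U"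
    have top: "topspace (subtopology ?Z H) = H"
      using topspace_zariski_group[OF lag] subgroup.subset[OF H] by auto
    have "openin (subtopology ?Z H) U" using U 1 by (intro local_open) auto
    moreover have "openin (subtopology ?Z H) (H - U)" using 2 by (intro local_open) auto
    then have "closedin (subtopology ?Z H) U" using U unfolding closedin_def top by simp
    moreover have "connected_space (subtopology ?Z H)" using connected by (simp add: connectedin_def)
    ultimately show "U = {} \<or> U = carrier ?H" unfolding connected_space_clopen_in top by simp
  qed
  then show ?thesis using m_inv_consistent[OF H] FH by auto
qed

end

section \<open>Fixed points of twisted quotients\<close>

context group
begin

lemma conjugate_set_image: "conjugate_set G g A = (\<lambda>a. g \<otimes> a \<otimes> inv g) ` A"
  by (auto simp: conjugate_set_def l_coset_def r_coset_def)

lemma conjugate_set_iff: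
  assumes "g \<in> carrier G" "A \<subseteq> carrier G"
  shows "y \<in> conjugate_set G g A \<longleftrightarrow> y \<in> carrier G \<and> inv g \<otimes> y \<otimes> g \<in> A"
proof
  assume "y \<in> conjugate_set G g A"
  then obtain a where "a \<in> A" "a \<in> carrier G" "y = g \<otimes> a \<otimes> inv g" using assms(2) by (auto simp: conjugate_set_image)
  then show "y \<in> carrier G \<and> inv g \<otimes> y \<otimes> g \<in> A" using assms(1) by (simp add: m_assoc inv_mult_cancel)
next
  assume y: "y \<in> carrier G \<and> inv g \<otimes> y \<otimes> g \<in> A"
  have "g \<otimes> (inv g \<otimes> (y \<otimes> (g \<otimes> inv g))) = y"
    using assms(1) y inv_mult_cancel[of "inv g" y] by simp
  then have "y = g \<otimes> (inv g \<otimes> y \<otimes> g) \<otimes> inv g" using assms(1) y by (simp add: m_assoc)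
  then show "y \<in> conjugate_set G g A" unfolding conjugate_set_image using y by blast
qed

text \<open>
  The map \<open>y \<mapsto> H #> (g\<^sup>-\<^sup>1 y g)\<close> on the fixed points of \<open>F\<close> in \<open>gNg\<^sup>-\<^sup>1\<close> is a homomorphism to the fixed cosets.
  The hypothesis \<open>lang\<close>, the Lang-Steinberg theorem for \<open>gHg\<^sup>-\<^sup>1\<close>, makes it surjective; the first
  isomorphism theorem does the rest.
\<close>

lemma twisted_quotient_iso:
  assumes F: "F \<in> hom G G" and N: "subgroup N G" and H: "H \<lhd> G\<lparr>carrier := N\<rparr>"
    and FN: "F ` N \<subseteq> N" and FH: "F ` H \<subseteq> H"
    and g: "g \<in> carrier G" and n: "inv g \<otimes> F g \<in> N" and w: "w = H #> (inv g \<otimes> F g)"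
    and lang: "\<And>d. d \<in> conjugate_set G g H \<Longrightarrow> \<exists>x\<in>conjugate_set G g H. x \<otimes> inv (F x) = d"
  shows "subgroup_quotient G (fixed_points F (conjugate_set G g N)) (fixed_points F (conjugate_set G g H))
    \<cong> twisted_fixed_group G N H F w"
proof -
  let ?N = "G\<lparr>carrier := N\<rparr>" and ?Q = "subgroup_quotient G N H"
  interpret F: group_hom G G F by unfold_locales (rule F)
  interpret NN: group ?N by (rule subgroup_imp_group[OF N])
  interpret HN: normal H ?N by (rule H)
  interpret Q: group ?Q by (rule HN.factorgroup_is_group)
  have NG: "x \<in> carrier G" if "x \<in> N" for x using that subgroup.subset[OF N] by blast
  have Hs: "subgroup H G" by (rule incl_subgroup[OF N HN.subgroup_axioms])
  have HN': "x \<in> N" if "x \<in> H" for x using that HN.subset by auto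
  note Nc = subgroup.m_closed[OF N] subgroup.m_inv_closed[OF N] subgroup.one_closed[OF N]
  note Hc = subgroup.m_closed[OF Hs] subgroup.m_inv_closed[OF Hs] subgroup.one_closed[OF Hs]
  have FNc: "F x \<in> N" if "x \<in> N" for x using FN that by blast
  have FHc: "F x \<in> H" if "x \<in> H" for x using FH that by blast
  have rc: "r_coset ?N = r_coset G" and sm: "set_mult ?N = set_mult G"
    by (simp_all add: fun_eq_iff r_coset_def set_mult_def)
  have carQ: "carrier ?Q = (\<lambda>x. H #> x) ` N" by (simp add: carrier_FactGroup rc)
  have mult: "(H #> x) <#> (H #> y) = H #> (x \<otimes> y)" if "x \<in> N" "y \<in> N" for x y
    using HN.rcos_sum[of x y] that by (simp add: rc sm)
  have coset_eq: "H #> x = H #> y \<longleftrightarrow> x \<otimes> inv y \<in> H" if "x \<in> N" "y \<in> N" for x y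
  proof
    assume "H #> x = H #> y"
    then have "x \<in> H #> y" using rcos_self[OF NG[OF that(1)] Hs] by simp
    then obtain h where h: "h \<in> H" "x = h \<otimes> y" by (auto simp: r_coset_def)
    moreover have "h \<in> carrier G" using h(1) by (intro NG HN')
    ultimately show "x \<otimes> inv y \<in> H" using NG[OF that(2)] by (simp add: m_assoc)
  next
    assume "x \<otimes> inv y \<in> H"
    moreover have "x = x \<otimes> inv y \<otimes> y" using that NG by (simp add: m_assoc)
    ultimately have "x \<in> H #> y" unfolding r_coset_def by blast
    from repr_independence[OF this _ Hs] show "H #> x = H #> y" using that NG by simp
  qed
  have invQ: "inv\<^bsub>?Q\<^esub> (H #> x) = H #> inv x" if "x \<in> N" for x
    using HN.inv_FactGroup[of "H #> x"] HN.rcos_inv[of x] m_inv_consistent[OF N that] that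
    by (simp add: carQ rc)
  define \<nu> where "\<nu> = inv g \<otimes> F g"
  have \<nu>: "\<nu> \<in> N" using n by (simp add: \<nu>_def)
  define \<sigma> where "\<sigma> x = \<nu> \<otimes> F x \<otimes> inv \<nu>" for x
  have \<sigma>N: "\<sigma> x \<in> N" if "x \<in> N" for x using that \<nu> FNc Nc by (simp add: \<sigma>_def)
  have \<sigma>m: "\<sigma> (x \<otimes> y) = \<sigma> x \<otimes> \<sigma> y" if "x \<in> N" "y \<in> N" for x y
    using that \<nu> NG by (simp add: \<sigma>_def m_assoc inv_mult_cancel)
  have \<sigma>i: "\<sigma> (inv x) = inv (\<sigma> x)" if "x \<in> N" for x
    using that \<nu> NG by (simp add: \<sigma>_def inv_mult_group m_assoc)
  have twist: "twisted_map G N H F w (H #> x) = H #> \<sigma> x" if x: "x \<in> N" for x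
  proof -
    have "induced_map G H F (H #> x) = H #> F x"
    proof
      show "induced_map G H F (H #> x) \<subseteq> H #> F x"
      proof
        fix y assume "y \<in> induced_map G H F (H #> x)"
        then obtain h k where hk: "h \<in> H" "k \<in> H" "y = h \<otimes> F (k \<otimes> x)"
          by (auto simp: induced_map_def set_mult_def r_coset_def)
        then have "y = (h \<otimes> F k) \<otimes> F x" using x NG HN' by (simp add: m_assoc)
        then show "y \<in> H #> F x" using hk Hc(1) FHc by (auto simp: r_coset_def)
      qed
    next
      show "H #> F x \<subseteq> induced_map G H F (H #> x)"
      proof
        fix y assume "y \<in> H #> F x"
        then obtain h where h: "h \<in> H" "y = h \<otimes> F x" by (auto simp: r_coset_def)
        moreover have "x \<in> H #> x" by (rule rcos_self[OF NG[OF x] Hs])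
        ultimately show "y \<in> induced_map G H F (H #> x)"
          unfolding induced_map_def set_mult_def by blast
      qed
    qed
    then show ?thesis
      using invQ[OF \<nu>] mult \<nu> x FNc Nc
      by (simp add: twisted_map_def sm w \<sigma>_def flip: \<nu>_def)
  qed
  let ?T = "twisted_fixed_group G N H F w"
  let ?X = "fixed_points (twisted_map G N H F w) (carrier ?Q)"
  have X_iff: "H #> x \<in> ?X \<longleftrightarrow> H #> \<sigma> x = H #> x" if "x \<in> N" for x
    using that twist by (auto simp: fixed_points_def carQ)
  have "subgroup ?X ?Q"
  proof (rule Q.subgroupI)
    show "?X \<subseteq> carrier ?Q" by (auto simp: fixed_points_def)
    have "\<sigma> \<one> = \<one>" using \<nu> NG by (simp add: \<sigma>_def)
    then show "?X \<noteq> {}" using X_iff[OF Nc(3)] by auto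
  next
    fix a assume a: "a \<in> ?X"
    then obtain x where x: "x \<in> N" "a = H #> x" by (auto simp: fixed_points_def carQ)
    have "inv\<^bsub>?Q\<^esub> (H #> \<sigma> x) = inv\<^bsub>?Q\<^esub> (H #> x)" using X_iff[OF x(1)] a x(2) by simp
    then show "inv\<^bsub>?Q\<^esub> a \<in> ?X" using x invQ \<sigma>N \<sigma>i X_iff[OF Nc(2)[OF x(1)]] by simp
  next
    fix a b assume ab: "a \<in> ?X" "b \<in> ?X"
    then obtain x y where xy: "x \<in> N" "a = H #> x" "y \<in> N" "b = H #> y" by (auto simp: fixed_points_def carQ)
    have "H #> \<sigma> (x \<otimes> y) = (H #> \<sigma> x) <#> (H #> \<sigma> y)" using xy \<sigma>m mult \<sigma>N by simp
    also have "\<dots> = H #> (x \<otimes> y)" using X_iff xy ab mult by simp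
    finally have "H #> (x \<otimes> y) \<in> ?X" using X_iff Nc(1) xy by simp
    then show "a \<otimes>\<^bsub>?Q\<^esub> b \<in> ?X" using xy mult by (simp add: sm)
  qed
  then have T: "group ?T" unfolding twisted_fixed_group_def by (rule Q.subgroup_imp_group)
  define \<iota> where "\<iota> y = inv g \<otimes> y \<otimes> g" for y
  have \<iota>m: "\<iota> (x \<otimes> y) = \<iota> x \<otimes> \<iota> y" if "x \<in> carrier G" "y \<in> carrier G" for x y
    using that g inv_mult_cancel[of "inv g"] by (simp add: \<iota>_def m_assoc)
  have \<iota>i: "\<iota> (inv x) = inv (\<iota> x)" if "x \<in> carrier G" for x
    using that g by (simp add: \<iota>_def inv_mult_group m_assoc)
  have \<iota>F: "\<iota> (F y) = \<sigma> (\<iota> y)" if "y \<in> carrier G" for y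
    using that g inv_mult_cancel inv_mult_cancel[of "inv (F g)"]
    by (simp add: \<iota>_def \<sigma>_def \<nu>_def inv_mult_group m_assoc)
  have conj: "y \<in> conjugate_set G g S \<longleftrightarrow> y \<in> carrier G \<and> \<iota> y \<in> S" if "S \<subseteq> carrier G" for y S
    using conjugate_set_iff[OF g that] by (simp add: \<iota>_def)
  note conjN = conj[OF subgroup.subset[OF N]] and conjH = conj[OF subgroup.subset[OF Hs]]
  let ?K = "fixed_points F (conjugate_set G g N)"
  have K_iff: "y \<in> ?K \<longleftrightarrow> y \<in> carrier G \<and> \<iota> y \<in> N \<and> F y = y" for y
    by (auto simp: fixed_points_def conjN)
  have K: "subgroup ?K G"
  proof (rule subgroupI)
    show "?K \<subseteq> carrier G" using K_iff by blast
    have "\<one> \<in> ?K" using g Nc(3) by (simp add: K_iff \<iota>_def)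
    then show "?K \<noteq> {}" by blast
  qed (auto simp: K_iff \<iota>m \<iota>i Nc)
  let ?KG = "G\<lparr>carrier := ?K\<rparr>"
  let ?\<theta> = "\<lambda>y. H #> \<iota> y"
  have "?\<theta> \<in> hom ?KG ?T"
  proof (rule homI)
    fix y assume "y \<in> carrier ?KG"
    then have y: "y \<in> carrier G" "\<iota> y \<in> N" "F y = y" by (auto simp: K_iff)
    have "\<sigma> (\<iota> y) = \<iota> y" using \<iota>F[OF y(1)] y(3) by simp
    then have "H #> \<iota> y \<in> ?X" using X_iff[OF y(2)] by simp
    then show "?\<theta> y \<in> carrier ?T" by (simp add: twisted_fixed_group_def)
  next
    fix x y assume "x \<in> carrier ?KG" "y \<in> carrier ?KG"
    then show "?\<theta> (x \<otimes>\<^bsub>?KG\<^esub> y) = ?\<theta> x \<otimes>\<^bsub>?T\<^esub> ?\<theta> y"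
      by (simp add: twisted_fixed_group_def sm K_iff \<iota>m mult)
  qed
  then interpret \<theta>: group_hom ?KG ?T ?\<theta>
    by (intro group_hom.intro group_hom_axioms.intro subgroup_imp_group[OF K] T)
  have "?\<theta> ` carrier ?KG = carrier ?T"
  proof
    show "?\<theta> ` carrier ?KG \<subseteq> carrier ?T" using \<theta>.hom_closed by blast
    show "carrier ?T \<subseteq> ?\<theta> ` carrier ?KG"
    proof
      fix X assume "X \<in> carrier ?T"
      then have X: "X \<in> ?X" by (simp add: twisted_fixed_group_def)
      then obtain x where x: "x \<in> N" "X = H #> x" by (auto simp: fixed_points_def carQ)
      define y where "y = g \<otimes> x \<otimes> inv g"
      have y: "y \<in> carrier G" using g NG[OF x(1)] by (simp add: y_def)
      have \<iota>y: "\<iota> y = x" using g NG[OF x(1)] by (simp add: y_def \<iota>_def m_assoc inv_mult_cancel)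
      have "H #> \<sigma> x = H #> x" using X_iff[OF x(1)] X x(2) by simp
      then have d: "\<sigma> x \<otimes> inv x \<in> H" using coset_eq \<sigma>N x(1) by blast
      \<comment> \<open>\<open>y\<close> is a preimage of the coset, fixed only up to the factor \<open>d'\<close> in \<open>gHg\<^sup>-\<^sup>1\<close>; multiplying it by
        \<open>inv u\<close>, where \<open>u (F u)\<^sup>-\<^sup>1 = d'\<^sup>-\<^sup>1\<close>, makes it fixed.\<close>
      define d' where "d' = F y \<otimes> inv y"
      have d': "d' \<in> carrier G" using y by (simp add: d'_def)
      have "\<iota> d' = \<sigma> x \<otimes> inv x" using y by (simp add: d'_def \<iota>m \<iota>i \<iota>F \<iota>y)
      then have "inv d' \<in> conjugate_set G g H" using d d' Hc(2) by (simp add: conjH \<iota>i)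
      then obtain u where u: "u \<in> conjugate_set G g H" "u \<otimes> inv (F u) = inv d'" using lang by blast
      have uG: "u \<in> carrier G" "\<iota> u \<in> H" using u(1) by (auto simp: conjH)
      have "inv (F u) = inv u \<otimes> (u \<otimes> inv (F u))" using uG by (simp add: inv_mult_cancel)
      also have "\<dots> = inv u \<otimes> inv d'" by (simp only: u(2))
      finally have "inv (F u) = inv u \<otimes> (y \<otimes> inv (F y))" using y by (simp add: d'_def inv_mult_group)
      then have "F (inv u \<otimes> y) = inv u \<otimes> y" using uG y by (simp add: m_assoc)
      moreover have \<iota>uy: "\<iota> (inv u \<otimes> y) = inv (\<iota> u) \<otimes> x" using uG y by (simp add: \<iota>m \<iota>i \<iota>y)
      moreover have "inv (\<iota> u) \<in> H" using uG(2) Hc(2) by blast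
      ultimately have "inv u \<otimes> y \<in> carrier ?KG" using uG y x(1) HN' Nc(1) by (simp add: K_iff)
      moreover have "?\<theta> (inv u \<otimes> y) = X"
      proof -
        have "inv (\<iota> u) \<otimes> x \<otimes> inv x = inv (\<iota> u)" using NG[OF x(1)] NG[OF HN'[OF uG(2)]] by (simp add: m_assoc)
        then show ?thesis
          unfolding \<iota>uy x(2) using coset_eq[of "inv (\<iota> u) \<otimes> x" x] \<open>inv (\<iota> u) \<in> H\<close> x(1) HN' Nc(1) by simp
      qed
      ultimately show "X \<in> ?\<theta> ` carrier ?KG" by blast
    qed
  qed
  then have "?KG Mod kernel ?KG ?T ?\<theta> \<cong> ?T" by (rule \<theta>.FactGroup_iso)
  moreover have "kernel ?KG ?T ?\<theta> = fixed_points F (conjugate_set G g H)"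
  proof -
    have "H #> \<iota> y = H \<longleftrightarrow> \<iota> y \<in> H" if "\<iota> y \<in> N" for y
      using coset_eq[OF that Nc(3)] coset_mult_one[of H] subgroup.subset[OF Hs] NG[OF that] by simp
    then show ?thesis
      using HN' by (auto simp: kernel_def twisted_fixed_group_def K_iff fixed_points_def conjH conjN)
  qed
  ultimately show ?thesis by simp
qed

lemma normalizer_iff:
  assumes "A \<subseteq> carrier G"
  shows "x \<in> normalizer G A \<longleftrightarrow> x \<in> carrier G \<and> (\<lambda>a. x \<otimes> a \<otimes> inv x) ` A = A"
  using assms conjugate_set_image[of x A]
  by (auto simp: normalizer_def stabilizer_def conjugate_set_def)

lemma normalizer_conjugate_set:
  assumes g: "g \<in> carrier G" and A: "A \<subseteq> carrier G"
  shows "normalizer G (conjugate_set G g A) = conjugate_set G g (normalizer G A)"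
proof -
  have AG: "a \<in> carrier G" if "a \<in> A" for a using A that by blast
  have sub: "conjugate_set G g A \<subseteq> carrier G" using g A by (auto simp: conjugate_set_image)
  have nsub: "normalizer G A \<subseteq> carrier G" using normalizer_iff[OF A] by blast
  let ?\<kappa> = "\<lambda>a. g \<otimes> a \<otimes> inv g"
  have "x \<in> normalizer G (conjugate_set G g A) \<longleftrightarrow> inv g \<otimes> x \<otimes> g \<in> normalizer G A" if x: "x \<in> carrier G" for x
  proof -
    let ?x = "inv g \<otimes> x \<otimes> g"
    have "x \<otimes> ?\<kappa> a \<otimes> inv x = ?\<kappa> (?x \<otimes> a \<otimes> inv ?x)" if "a \<in> A" for a
      using g x AG[OF that] inv_mult_cancel[of "inv g"] by (simp add: m_assoc inv_mult_group inv_mult_cancel)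
    then have "(\<lambda>b. x \<otimes> b \<otimes> inv x) ` conjugate_set G g A = ?\<kappa> ` ((\<lambda>a. ?x \<otimes> a \<otimes> inv ?x) ` A)"
      unfolding conjugate_set_image image_image by (intro image_cong refl)
    moreover have "inj_on ?\<kappa> (carrier G)" using g by (auto simp: inj_on_def)
    moreover have "(\<lambda>a. ?x \<otimes> a \<otimes> inv ?x) ` A \<subseteq> carrier G" using g x AG by auto
    ultimately have "(\<lambda>b. x \<otimes> b \<otimes> inv x) ` conjugate_set G g A = conjugate_set G g A
        \<longleftrightarrow> (\<lambda>a. ?x \<otimes> a \<otimes> inv ?x) ` A = A"
      unfolding conjugate_set_image[of g A] using A by (metis inj_on_image_eq_iff)
    then show ?thesis using g x normalizer_iff[OF sub] normalizer_iff[OF A] by simp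
  qed
  then show ?thesis
    using conjugate_set_iff[OF g nsub] normalizer_iff[OF sub] by blast
qed

lemma centralizer_conjugate_set:
  assumes g: "g \<in> carrier G" and A: "A \<subseteq> carrier G"
  shows "centralizer G (conjugate_set G g A) = conjugate_set G g (centralizer G A)"
proof -
  have commute: "x \<otimes> (g \<otimes> a \<otimes> inv g) = g \<otimes> a \<otimes> inv g \<otimes> x \<longleftrightarrow> inv g \<otimes> x \<otimes> g \<otimes> a = a \<otimes> (inv g \<otimes> x \<otimes> g)"
    if xa: "x \<in> carrier G" "a \<in> carrier G" for x a
  proof -
    have "g \<otimes> (inv g \<otimes> x \<otimes> g \<otimes> a) \<otimes> inv g = x \<otimes> (g \<otimes> a \<otimes> inv g)"
      "g \<otimes> (a \<otimes> (inv g \<otimes> x \<otimes> g)) \<otimes> inv g = g \<otimes> a \<otimes> inv g \<otimes> x"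
      using xa g inv_mult_cancel[of "inv g"] by (simp_all add: m_assoc)
    moreover have "g \<otimes> u \<otimes> inv g = g \<otimes> v \<otimes> inv g \<longleftrightarrow> u = v" if "u \<in> carrier G" "v \<in> carrier G" for u v
      using that g by auto
    ultimately show ?thesis using xa g by (metis inv_closed m_closed)
  qed
  have sub: "centralizer G A \<subseteq> carrier G" by (auto simp: centralizer_def)
  show ?thesis
  proof (rule Set.set_eqI)
    fix x
    have "x \<in> centralizer G (conjugate_set G g A)
        \<longleftrightarrow> x \<in> carrier G \<and> (\<forall>a\<in>A. x \<otimes> (g \<otimes> a \<otimes> inv g) = g \<otimes> a \<otimes> inv g \<otimes> x)"
      by (simp add: centralizer_def conjugate_set_image)
    also have "\<dots> \<longleftrightarrow> x \<in> carrier G \<and> inv g \<otimes> x \<otimes> g \<in> centralizer G A"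
      using commute A g by (auto simp: centralizer_def subset_iff)
    finally show "x \<in> centralizer G (conjugate_set G g A) \<longleftrightarrow> x \<in> conjugate_set G g (centralizer G A)"
      using conjugate_set_iff[OF g sub] by simp
  qed
qed

end

theorem proposition4p4:
  fixes G :: "('a, 'k::alg_closed_field) alg_group"
    and F :: "'a \<Rightarrow> 'a"
    and A A\<^sub>w :: "'a set"
    and w :: "'a set"
    and g :: 'a
  assumes "CHAR('k) > 0"
    and "connected_reductive_group G"
    and "steinberg_endomorphism G F"
    and "subgroup A G" and "finite A" and "A \<subseteq> fixed_points F (carrier G)"
    and "w \<in> carrier (subgroup_quotient G (centralizer G A) (identity_component G (centralizer G A)))"
    and "g \<in> carrier G"
    and "(inv\<^bsub>G\<^esub> g \<otimes>\<^bsub>G\<^esub> F g) <#\<^bsub>G\<^esub> identity_component G (centralizer G A) = w"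
    and "A\<^sub>w = conjugate_set G g A" and "A\<^sub>w \<subseteq> fixed_points F (carrier G)"
  shows "subgroup_quotient G
           (fixed_points F (normalizer G A\<^sub>w))
           (fixed_points F (identity_component G (centralizer G A\<^sub>w)))
         \<cong> twisted_fixed_group G
             (normalizer G A) (identity_component G (centralizer G A)) F w
       \<and> subgroup_quotient G
           (fixed_points F (centralizer G A\<^sub>w))
           (fixed_points F (identity_component G (centralizer G A\<^sub>w)))
         \<cong> twisted_fixed_group G
             (centralizer G A) (identity_component G (centralizer G A)) F w"
proof -
  have lag: "linear_algebraic_group G" using assms(2) by (simp add: connected_reductive_group_def)
  interpret group G by (rule lag_group[OF lag])
  let ?C = "centralizer G A" and ?I = "identity_component G (centralizer G A)" and ?N = "normalizer G A"
  let ?Cw = "centralizer G A\<^sub>w" and ?Iw = "identity_component G (centralizer G A\<^sub>w)"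
  note g = assms(8)
  have AG: "A \<subseteq> carrier G" by (rule subgroup.subset[OF assms(4)])
  have AwG: "A\<^sub>w \<subseteq> carrier G" using assms(11) by (auto simp: fixed_points_def)
  have F: "F \<in> hom G G" and Fcont: "continuous_map (zariski_group G) (zariski_group G) F"
    using assms(3) morphism_continuous[OF lag]
    unfolding steinberg_endomorphism_def algebraic_endomorphism_def by blast+
  interpret F: group_hom G G F by unfold_locales (rule F)
  have Fcent: "F ` centralizer G S \<subseteq> centralizer G S" if S: "S \<subseteq> fixed_points F (carrier G)" for S
  proof
    fix y assume "y \<in> F ` centralizer G S"
    then obtain x where x: "x \<in> centralizer G S" "y = F x" by blast
    have "F x \<otimes>\<^bsub>G\<^esub> a = a \<otimes>\<^bsub>G\<^esub> F x" if "a \<in> S" for a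
    proof -
      have a: "a \<in> carrier G" "F a = a" using S that by (auto simp: fixed_points_def)
      have "F (x \<otimes>\<^bsub>G\<^esub> a) = F (a \<otimes>\<^bsub>G\<^esub> x)" using x(1) that by (simp add: centralizer_def)
      then show ?thesis using a x(1) by (simp add: centralizer_def)
    qed
    then show "y \<in> centralizer G S" using x by (simp add: centralizer_def)
  qed
  have C: "subgroup ?C G" and Cw: "subgroup ?Cw G" using centralizer_subgroup[OF lag] AG AwG by blast+
  have I: "subgroup ?I G" and Iw: "subgroup ?Iw G" using identity_component_subgroup[OF lag] C Cw by blast+
  have IC: "?I \<subseteq> ?C" by (rule identity_component_subset[OF lag C])
  have Cw_eq: "?Cw = conjugate_set G g ?C" unfolding assms(10) by (rule centralizer_conjugate_set[OF g AG])
  have FI: "F ` ?I \<subseteq> ?I" "F ` ?Iw \<subseteq> ?Iw"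
    using identity_component_image[OF lag _ _ Fcont] Fcent[OF assms(6)] Fcent[OF assms(11)] C Cw by simp_all
  have Iw_eq: "?Iw = conjugate_set G g ?I"
  proof
    have IG: "?I \<subseteq> carrier G" by (rule subgroup.subset[OF I])
    have "(\<lambda>x. g \<otimes>\<^bsub>G\<^esub> x \<otimes>\<^bsub>G\<^esub> inv\<^bsub>G\<^esub> g) ` ?I \<subseteq> ?Iw"
      using g Cw_eq conjugation_continuous[OF lag g]
      by (intro identity_component_image[OF lag C Cw]) (auto simp: conjugate_set_image)
    then show "conjugate_set G g ?I \<subseteq> ?Iw" by (simp add: conjugate_set_image)
    have "(\<lambda>x. inv\<^bsub>G\<^esub> g \<otimes>\<^bsub>G\<^esub> x \<otimes>\<^bsub>G\<^esub> inv\<^bsub>G\<^esub> (inv\<^bsub>G\<^esub> g)) ` ?Iw \<subseteq> ?I"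
    proof (rule identity_component_image[OF lag Cw C])
      show "continuous_map (zariski_group G) (zariski_group G) (\<lambda>x. inv\<^bsub>G\<^esub> g \<otimes>\<^bsub>G\<^esub> x \<otimes>\<^bsub>G\<^esub> inv\<^bsub>G\<^esub> (inv\<^bsub>G\<^esub> g))"
        using g by (intro conjugation_continuous[OF lag]) simp
      show "(\<lambda>x. inv\<^bsub>G\<^esub> g \<otimes>\<^bsub>G\<^esub> x \<otimes>\<^bsub>G\<^esub> inv\<^bsub>G\<^esub> (inv\<^bsub>G\<^esub> g)) ` ?Cw \<subseteq> ?C"
        using conjugate_set_iff[OF g subgroup.subset[OF C]] g unfolding Cw_eq by auto
    qed (use g in simp)
    then show "?Iw \<subseteq> conjugate_set G g ?I"
      using conjugate_set_iff[OF g IG] subgroup.subset[OF Iw] g by auto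
  qed
  have CN: "?C \<subseteq> ?N"
  proof
    fix x assume x: "x \<in> ?C"
    have "x \<otimes>\<^bsub>G\<^esub> a \<otimes>\<^bsub>G\<^esub> inv\<^bsub>G\<^esub> x = a" if "a \<in> A" for a
    proof -
      have a: "a \<in> carrier G" "x \<in> carrier G" "x \<otimes>\<^bsub>G\<^esub> a = a \<otimes>\<^bsub>G\<^esub> x" using x that AG by (auto simp: centralizer_def)
      show ?thesis unfolding a(3) using a(1,2) by (simp add: m_assoc)
    qed
    then have "(\<lambda>a. x \<otimes>\<^bsub>G\<^esub> a \<otimes>\<^bsub>G\<^esub> inv\<^bsub>G\<^esub> x) ` A = A" by simp
    then show "x \<in> ?N" using x normalizer_iff[OF AG] by (simp add: centralizer_def)
  qed
  have N: "subgroup ?N G" by (rule normalizer_imp_subgroup[OF AG])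
  have NG: "?N \<subseteq> carrier G" by (rule subgroup.subset[OF N])
  have normal: "?I \<lhd> G\<lparr>carrier := M\<rparr>" if M: "subgroup M G" "?C \<subseteq> M" "M \<subseteq> ?N" for M
  proof -
    interpret M: group "G\<lparr>carrier := M\<rparr>" by (rule subgroup_imp_group[OF M(1)])
    have "x \<otimes>\<^bsub>G\<^esub> h \<otimes>\<^bsub>G\<^esub> inv\<^bsub>G\<^esub> x \<in> ?I" if x: "x \<in> M" and h: "h \<in> ?I" for x h
    proof -
      have xN: "x \<in> carrier G" "(\<lambda>a. x \<otimes>\<^bsub>G\<^esub> a \<otimes>\<^bsub>G\<^esub> inv\<^bsub>G\<^esub> x) ` A = A"
        using x M(3) normalizer_iff[OF AG] by blast+
      then have "conjugate_set G x ?C = ?C"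
        using centralizer_conjugate_set[OF xN(1) AG] by (simp add: conjugate_set_image)
      then have "(\<lambda>c. x \<otimes>\<^bsub>G\<^esub> c \<otimes>\<^bsub>G\<^esub> inv\<^bsub>G\<^esub> x) ` ?C \<subseteq> ?C" by (simp add: conjugate_set_image)
      then have "(\<lambda>c. x \<otimes>\<^bsub>G\<^esub> c \<otimes>\<^bsub>G\<^esub> inv\<^bsub>G\<^esub> x) ` ?I \<subseteq> ?I"
        using xN(1) conjugation_continuous[OF lag xN(1)] by (intro identity_component_image[OF lag C C]) auto
      then show ?thesis using h by blast
    qed
    then show ?thesis
      using subgroup_incl[OF I M(1)] IC M(2) m_inv_consistent[OF M(1)]
      by (intro M.normal_invI) auto
  qed
  let ?n = "inv\<^bsub>G\<^esub> g \<otimes>\<^bsub>G\<^esub> F g"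
  \<comment> \<open>\<open>n\<close> lies in its own coset \<open>w\<close>, which consists of elements of the centraliser.\<close>
  have n: "?n \<in> ?C"
  proof -
    have "?n \<in> carrier G" using g by simp
    then have "?n \<in> ?n <#\<^bsub>G\<^esub> ?I"
      using subgroup.one_closed[OF I] unfolding l_coset_def by force
    then have "?n \<in> w" by (simp only: assms(9))
    moreover obtain x where "x \<in> ?C" "w = ?I #>\<^bsub>G\<^esub> x"
      using assms(7) by (auto simp: carrier_FactGroup r_coset_def)
    ultimately show ?thesis using IC subgroup.m_closed[OF C] by (auto simp: r_coset_def)
  qed
  have w: "w = ?I #>\<^bsub>G\<^esub> ?n"
    using normal.coset_eq[OF normal[OF C subset_refl CN]] n assms(9) by (simp add: r_coset_def l_coset_def)
  have lang: "\<exists>x\<in>conjugate_set G g ?I. x \<otimes>\<^bsub>G\<^esub> inv\<^bsub>G\<^esub> (F x) = d" if "d \<in> conjugate_set G g ?I" for d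
    using lang_steinberg_closed_subgroup[OF lag Iw identity_component_closed[OF lag Cw centralizer_closed[OF lag AwG]]
        identity_component_connected[OF lag Cw] assms(1,3) FI(2)] that
    unfolding Iw_eq by blast
  have FN: "F ` ?N \<subseteq> ?N"
  proof
    fix y assume "y \<in> F ` ?N"
    then obtain x where x: "x \<in> carrier G" "(\<lambda>a. x \<otimes>\<^bsub>G\<^esub> a \<otimes>\<^bsub>G\<^esub> inv\<^bsub>G\<^esub> x) ` A = A" "y = F x"
      using normalizer_iff[OF AG] by blast
    have "F x \<otimes>\<^bsub>G\<^esub> a \<otimes>\<^bsub>G\<^esub> inv\<^bsub>G\<^esub> (F x) = x \<otimes>\<^bsub>G\<^esub> a \<otimes>\<^bsub>G\<^esub> inv\<^bsub>G\<^esub> x" if "a \<in> A" for a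
    proof -
      have "x \<otimes>\<^bsub>G\<^esub> a \<otimes>\<^bsub>G\<^esub> inv\<^bsub>G\<^esub> x \<in> A" using x(2) that by blast
      then have "F (x \<otimes>\<^bsub>G\<^esub> a \<otimes>\<^bsub>G\<^esub> inv\<^bsub>G\<^esub> x) = x \<otimes>\<^bsub>G\<^esub> a \<otimes>\<^bsub>G\<^esub> inv\<^bsub>G\<^esub> x" "F a = a" "a \<in> carrier G"
        using assms(6) that by (auto simp: fixed_points_def)
      then show ?thesis using x(1) by simp
    qed
    then have "(\<lambda>a. F x \<otimes>\<^bsub>G\<^esub> a \<otimes>\<^bsub>G\<^esub> inv\<^bsub>G\<^esub> (F x)) ` A = A" using x(2) by simp
    then show "y \<in> ?N" using x(1,3) normalizer_iff[OF AG] by simp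
  qed
  have Nw_eq: "normalizer G A\<^sub>w = conjugate_set G g ?N"
    unfolding assms(10) by (rule normalizer_conjugate_set[OF g AG])
  show ?thesis
    unfolding Nw_eq Iw_eq unfolding Cw_eq
  proof
    show "subgroup_quotient G (fixed_points F (conjugate_set G g ?N)) (fixed_points F (conjugate_set G g ?I))
      \<cong> twisted_fixed_group G ?N ?I F w"
      using n CN by (intro twisted_quotient_iso[OF F N normal[OF N CN subset_refl] FN FI(1) g _ w lang]) auto
    show "subgroup_quotient G (fixed_points F (conjugate_set G g ?C)) (fixed_points F (conjugate_set G g ?I))
      \<cong> twisted_fixed_group G ?C ?I F w"
      by (rule twisted_quotient_iso[OF F C normal[OF C subset_refl CN] Fcent[OF assms(6)] FI(1) g n w lang])
  qed
qed

end
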